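(* Let $R$ be a ring Morita equivalent to a right duo perfect ring and let $M$ be a right $R$-module. Then the following conditions are equivalent: (i) $M$ is Baer. (ii) $M$ is dual Baer. (iii) $M$ is semisimple.
   Context: Rings have a unit element and modules are right unitary modules. Let $S=\mathrm{End}_R(M)$. $M$ is Baer if for every non-empty subset $X\subseteq S$ the submodule $\bigcap_{f\in X}\ker f$ is a direct summand of $M$. $M$ is dual Baer if for every submodule $N\leq M$ the right ideal $\mathrm{Hom}_R(M,N)$ of $S$ equals $eS$ for some $e=e^2\in S$. A ring is right duo if every right ideal is a two-sided ideal; a ring is perfect if it is both left and right perfect. *)

theory Defs
  imports "HOL-Algebra.QuotRing"
begin

section \<open>Right modules\<close>

text \<open>
  The module locale of HOL-Algebra is restricted to commutative rings, so right modules over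
  arbitrary unital rings are introduced here. As in HOL-Algebra, the record extends the ring
  record only in order to reuse the additive structure; its multiplication and unit are not used.
\<close>

record ('m, 'r) right_module = "'m ring" +
  rsmult :: "['m, 'r] \<Rightarrow> 'm" (infixl \<open>\<cdot>\<index>\<close> 70)

definition is_right_module :: "('r, 'x) ring_scheme \<Rightarrow> ('m, 'r) right_module \<Rightarrow> bool" where
  "is_right_module R M \<longleftrightarrow> ring R \<and> abelian_group M \<and>
     (\<forall>m\<in>carrier M. \<forall>r\<in>carrier R. m \<cdot>\<^bsub>M\<^esub> r \<in> carrier M) \<and>
     (\<forall>m\<in>carrier M. \<forall>n\<in>carrier M. \<forall>r\<in>carrier R.
        (m \<oplus>\<^bsub>M\<^esub> n) \<cdot>\<^bsub>M\<^esub> r = m \<cdot>\<^bsub>M\<^esub> r \<oplus>\<^bsub>M\<^esub> n \<cdot>\<^bsub>M\<^esub> r) \<and>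
     (\<forall>m\<in>carrier M. \<forall>r\<in>carrier R. \<forall>s\<in>carrier R.
        m \<cdot>\<^bsub>M\<^esub> (r \<oplus>\<^bsub>R\<^esub> s) = m \<cdot>\<^bsub>M\<^esub> r \<oplus>\<^bsub>M\<^esub> m \<cdot>\<^bsub>M\<^esub> s) \<and>
     (\<forall>m\<in>carrier M. \<forall>r\<in>carrier R. \<forall>s\<in>carrier R.
        m \<cdot>\<^bsub>M\<^esub> (r \<otimes>\<^bsub>R\<^esub> s) = (m \<cdot>\<^bsub>M\<^esub> r) \<cdot>\<^bsub>M\<^esub> s) \<and>
     (\<forall>m\<in>carrier M. m \<cdot>\<^bsub>M\<^esub> \<one>\<^bsub>R\<^esub> = m)"

definition submodule_of :: "('r, 'x) ring_scheme \<Rightarrow> ('m, 'r) right_module \<Rightarrow> 'm set \<Rightarrow> bool" where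
  "submodule_of R M N \<longleftrightarrow> additive_subgroup N M \<and>
     (\<forall>n\<in>N. \<forall>r\<in>carrier R. n \<cdot>\<^bsub>M\<^esub> r \<in> N)"

definition direct_summand :: "('r, 'x) ring_scheme \<Rightarrow> ('m, 'r) right_module \<Rightarrow> 'm set \<Rightarrow> bool" where
  "direct_summand R M N \<longleftrightarrow> submodule_of R M N \<and>
     (\<exists>K. submodule_of R M K \<and> N \<inter> K = {\<zero>\<^bsub>M\<^esub>} \<and> N <+>\<^bsub>M\<^esub> K = carrier M)"

definition simple_submodule :: "('r, 'x) ring_scheme \<Rightarrow> ('m, 'r) right_module \<Rightarrow> 'm set \<Rightarrow> bool" where
  "simple_submodule R M N \<longleftrightarrow> submodule_of R M N \<and> N \<noteq> {\<zero>\<^bsub>M\<^esub>} \<and>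
     (\<forall>K. submodule_of R M K \<and> K \<subseteq> N \<longrightarrow> K = {\<zero>\<^bsub>M\<^esub>} \<or> K = N)"

definition submodule_span :: "('r, 'x) ring_scheme \<Rightarrow> ('m, 'r) right_module \<Rightarrow> 'm set \<Rightarrow> 'm set" where
  "submodule_span R M X = \<Inter>{N. submodule_of R M N \<and> X \<subseteq> N}"

text \<open>A module is semisimple if it is the sum of its simple submodules.\<close>

definition semisimple_module :: "('r, 'x) ring_scheme \<Rightarrow> ('m, 'r) right_module \<Rightarrow> bool" where
  "semisimple_module R M \<longleftrightarrow> submodule_span R M (\<Union>{N. simple_submodule R M N}) = carrier M"


section \<open>Homomorphisms, Baer and dual Baer modules\<close>

text \<open>
  Homomorphisms are extensional functions (undefined outside the carrier), so that equality of
  homomorphisms is equality of functions.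
\<close>

definition module_hom ::
  "('r, 'x) ring_scheme \<Rightarrow> ('m, 'r) right_module \<Rightarrow> ('n, 'r) right_module \<Rightarrow> ('m \<Rightarrow> 'n) set" where
  "module_hom R M N = {f \<in> carrier M \<rightarrow>\<^sub>E carrier N.
     (\<forall>x\<in>carrier M. \<forall>y\<in>carrier M. f (x \<oplus>\<^bsub>M\<^esub> y) = f x \<oplus>\<^bsub>N\<^esub> f y) \<and>
     (\<forall>x\<in>carrier M. \<forall>r\<in>carrier R. f (x \<cdot>\<^bsub>M\<^esub> r) = f x \<cdot>\<^bsub>N\<^esub> r)}"

text \<open>The endomorphism ring acts from the left: the product of f and g is f after g.\<close>

definition End_ring :: "('r, 'x) ring_scheme \<Rightarrow> ('m, 'r) right_module \<Rightarrow> ('m \<Rightarrow> 'm) ring" where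
  "End_ring R M =
     \<lparr>carrier = module_hom R M M,
      mult = (\<lambda>f g. compose (carrier M) f g),
      one = (\<lambda>x\<in>carrier M. x),
      zero = (\<lambda>x\<in>carrier M. \<zero>\<^bsub>M\<^esub>),
      add = (\<lambda>f g. \<lambda>x\<in>carrier M. f x \<oplus>\<^bsub>M\<^esub> g x)\<rparr>"

definition hom_kernel :: "('m, 'r) right_module \<Rightarrow> ('n, 'r) right_module \<Rightarrow> ('m \<Rightarrow> 'n) \<Rightarrow> 'm set" where
  "hom_kernel M N f = {x \<in> carrier M. f x = \<zero>\<^bsub>N\<^esub>}"

definition baer_module :: "('r, 'x) ring_scheme \<Rightarrow> ('m, 'r) right_module \<Rightarrow> bool" where
  "baer_module R M \<longleftrightarrow>
     (\<forall>X. X \<subseteq> carrier (End_ring R M) \<and> X \<noteq> {} \<longrightarrow> direct_summand R M (\<Inter>f\<in>X. hom_kernel M M f))"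

text \<open>In the following definition Hom(M,N) is viewed inside End(M) in the usual way, and the
  left coset of the carrier is the principal right ideal generated by e.\<close>

definition dual_baer_module :: "('r, 'x) ring_scheme \<Rightarrow> ('m, 'r) right_module \<Rightarrow> bool" where
  "dual_baer_module R M \<longleftrightarrow>
     (\<forall>N. submodule_of R M N \<longrightarrow>
       (\<exists>e\<in>carrier (End_ring R M).
          e \<otimes>\<^bsub>End_ring R M\<^esub> e = e \<and>
          {f \<in> carrier (End_ring R M). f ` carrier M \<subseteq> N} =
            e <#\<^bsub>End_ring R M\<^esub> carrier (End_ring R M)))"


section \<open>Right duo rings and perfect rings\<close>

definition right_ideal :: "'r set \<Rightarrow> ('r, 'x) ring_scheme \<Rightarrow> bool" where
  "right_ideal I R \<longleftrightarrow> additive_subgroup I R \<and> (\<forall>a\<in>I. \<forall>r\<in>carrier R. a \<otimes>\<^bsub>R\<^esub> r \<in> I)"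

text \<open>The HOL-Algebra predicate \<^term>\<open>ideal\<close> means two-sided ideal.\<close>

definition right_duo :: "('r, 'x) ring_scheme \<Rightarrow> bool" where
  "right_duo R \<longleftrightarrow> (\<forall>I. right_ideal I R \<longrightarrow> ideal I R)"

definition maximal_right_ideal :: "'r set \<Rightarrow> ('r, 'x) ring_scheme \<Rightarrow> bool" where
  "maximal_right_ideal I R \<longleftrightarrow> right_ideal I R \<and> I \<noteq> carrier R \<and>
     (\<forall>K. right_ideal K R \<and> I \<subseteq> K \<longrightarrow> K = I \<or> K = carrier R)"

definition jacobson_radical :: "('r, 'x) ring_scheme \<Rightarrow> 'r set" where
  "jacobson_radical R = {x \<in> carrier R. \<forall>I. maximal_right_ideal I R \<longrightarrow> x \<in> I}"

definition regular_module :: "('r, 'x) ring_scheme \<Rightarrow> ('r, 'r) right_module" where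
  "regular_module R =
     \<lparr>carrier = carrier R, mult = mult R, one = one R, zero = zero R, add = add R,
      rsmult = mult R\<rparr>"

definition semisimple_ring :: "('r, 'x) ring_scheme \<Rightarrow> bool" where
  "semisimple_ring R \<longleftrightarrow> semisimple_module R (regular_module R)"

definition list_prod :: "('r, 'x) ring_scheme \<Rightarrow> 'r list \<Rightarrow> 'r" where
  "list_prod R xs = foldr (mult R) xs \<one>\<^bsub>R\<^esub>"

text \<open>
  T-nilpotence: for every sequence in A some product $a_0 a_1 \cdots a_n$ (left), respectively
  $a_n \cdots a_1 a_0$ (right), vanishes.
\<close>

definition left_T_nilpotent :: "'r set \<Rightarrow> ('r, 'x) ring_scheme \<Rightarrow> bool" where
  "left_T_nilpotent A R \<longleftrightarrow>
     (\<forall>a :: nat \<Rightarrow> 'r. range a \<subseteq> A \<longrightarrow> (\<exists>n. list_prod R (map a [0..<Suc n]) = \<zero>\<^bsub>R\<^esub>))"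

definition right_T_nilpotent :: "'r set \<Rightarrow> ('r, 'x) ring_scheme \<Rightarrow> bool" where
  "right_T_nilpotent A R \<longleftrightarrow>
     (\<forall>a :: nat \<Rightarrow> 'r. range a \<subseteq> A \<longrightarrow> (\<exists>n. list_prod R (map a (rev [0..<Suc n])) = \<zero>\<^bsub>R\<^esub>))"

text \<open>Perfect rings are defined as in Lam, A First Course in Noncommutative Rings, Section 23.\<close>

definition left_perfect :: "('r, 'x) ring_scheme \<Rightarrow> bool" where
  "left_perfect R \<longleftrightarrow>
     semisimple_ring (R Quot jacobson_radical R) \<and> left_T_nilpotent (jacobson_radical R) R"

definition right_perfect :: "('r, 'x) ring_scheme \<Rightarrow> bool" where
  "right_perfect R \<longleftrightarrow>
     semisimple_ring (R Quot jacobson_radical R) \<and> right_T_nilpotent (jacobson_radical R) R"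

definition perfect_ring :: "('r, 'x) ring_scheme \<Rightarrow> bool" where
  "perfect_ring R \<longleftrightarrow> left_perfect R \<and> right_perfect R"


section \<open>Morita equivalence\<close>

text \<open>
  The category Mod-R over a universe type has as objects all right R-modules whose elements have
  that type, and as morphisms the module homomorphisms. A functor between two such categories is
  given by an object map and a morphism map; the latter also receives domain and codomain.
\<close>

type_synonym ('u, 'r, 't) ob_map = "('u, 'r) right_module \<Rightarrow> ('u, 't) right_module"
type_synonym ('u, 'r) mor_map =
  "('u, 'r) right_module \<Rightarrow> ('u, 'r) right_module \<Rightarrow> ('u \<Rightarrow> 'u) \<Rightarrow> ('u \<Rightarrow> 'u)"

definition module_functor ::
  "('r, 'x) ring_scheme \<Rightarrow> ('t, 'y) ring_scheme \<Rightarrow> ('u, 'r, 't) ob_map \<Rightarrow> ('u, 'r) mor_map \<Rightarrow> bool" where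
  "module_functor R T Fo Fm \<longleftrightarrow>
     (\<forall>M. is_right_module R M \<longrightarrow> is_right_module T (Fo M)) \<and>
     (\<forall>M N f. is_right_module R M \<and> is_right_module R N \<and> f \<in> module_hom R M N \<longrightarrow>
        Fm M N f \<in> module_hom T (Fo M) (Fo N)) \<and>
     (\<forall>M. is_right_module R M \<longrightarrow>
        Fm M M (\<lambda>x\<in>carrier M. x) = (\<lambda>x\<in>carrier (Fo M). x)) \<and>
     (\<forall>L M N f g. is_right_module R L \<and> is_right_module R M \<and> is_right_module R N \<and>
        f \<in> module_hom R L M \<and> g \<in> module_hom R M N \<longrightarrow>
        Fm L N (compose (carrier L) g f) = compose (carrier (Fo L)) (Fm M N g) (Fm L M f))"

definition naturally_isomorphic ::
  "('r, 'x) ring_scheme \<Rightarrow> ('t, 'y) ring_scheme \<Rightarrow> ('u, 'r, 't) ob_map \<Rightarrow> ('u, 'r) mor_map \<Rightarrow>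
     ('u, 'r, 't) ob_map \<Rightarrow> ('u, 'r) mor_map \<Rightarrow> bool" where
  "naturally_isomorphic R T Fo Fm Go Gm \<longleftrightarrow>
     (\<exists>\<eta>. (\<forall>M. is_right_module R M \<longrightarrow>
             \<eta> M \<in> module_hom T (Fo M) (Go M) \<and> bij_betw (\<eta> M) (carrier (Fo M)) (carrier (Go M))) \<and>
          (\<forall>M N f. is_right_module R M \<and> is_right_module R N \<and> f \<in> module_hom R M N \<longrightarrow>
             compose (carrier (Fo M)) (\<eta> N) (Fm M N f) =
             compose (carrier (Fo M)) (Gm M N f) (\<eta> M)))"

definition module_categories_equivalent ::
  "'u itself \<Rightarrow> ('r, 'x) ring_scheme \<Rightarrow> ('t, 'y) ring_scheme \<Rightarrow> bool" where
  "module_categories_equivalent U R T \<longleftrightarrow>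
     (\<exists>(Fo :: ('u, 'r, 't) ob_map) Fm (Go :: ('u, 't, 'r) ob_map) Gm.
        module_functor R T Fo Fm \<and> module_functor T R Go Gm \<and>
        naturally_isomorphic R R (\<lambda>M. M) (\<lambda>M N f. f)
          (\<lambda>M. Go (Fo M)) (\<lambda>M N f. Gm (Fo M) (Fo N) (Fm M N f)) \<and>
        naturally_isomorphic T T (\<lambda>M. M) (\<lambda>M N f. f)
          (\<lambda>M. Fo (Go M)) (\<lambda>M N f. Fm (Go M) (Go N) (Gm M N f)))"

text \<open>
  Two rings are Morita equivalent if their categories of right modules are equivalent. HOL has no
  quantification over types, so the categories are taken over a universe type. The sum below is
  infinite and contains copies of the elements of both rings, so it supports the regular modules,
  all submodules, quotients and coproducts of at most universe-many modules; hence the relation is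
  the usual Morita equivalence, whatever the type 'm is. The parameter 'm serves to choose a
  universe that also contains a copy of any given module with elements of type 'm.
\<close>

type_synonym ('m, 'r, 't) module_universe = "'m + 'r + 't + nat"

definition morita_equivalent ::
  "'m itself \<Rightarrow> ('r, 'x) ring_scheme \<Rightarrow> ('t, 'y) ring_scheme \<Rightarrow> bool" where
  "morita_equivalent U R T \<longleftrightarrow>
     module_categories_equivalent TYPE(('m, 'r, 't) module_universe) R T"

end

theory Submission
  imports Defs
begin

text \<open>
  Over any ring a module is semisimple iff all its submodules are direct summands, and this gives
  both Baer conditions. For the converse over a right duo perfect ring \<open>T\<close> with radical \<open>J\<close>, every
  maximal right ideal \<open>m\<close> has a central idempotent \<open>e\<close> with \<open>1 - e \<in> m\<close> and \<open>e m \<subseteq> J\<close>: modulo \<open>J\<close> it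
  is a complement of \<open>m\<close>, and it lifts because \<open>J\<close> is nil. With \<open>e\<close>, left T-nilpotence shows that
  each simple quotient of a module \<open>M\<close> embeds in \<open>M\<close>, and right T-nilpotence that each simple submodule
  is a quotient of \<open>M\<close>. Hence \<open>M J\<close> is an intersection of kernels and the socle is a sum of images
  of endomorphisms. If \<open>M\<close> is Baer, \<open>M J\<close> is a summand and so vanishes by right T-nilpotence; if \<open>M\<close>
  is dual Baer, the socle is a summand and, being essential by left T-nilpotence, equals \<open>M\<close>. In
  both cases \<open>M J = 0\<close>, so \<open>M\<close> is semisimple.

  Both Baer conditions have formulations in terms of morphisms only, with kernels and cokernels
  replaced by their universal properties, so they pass through an equivalence of module categories.
  Semisimplicity is carried back as the splitting of all injective homomorphisms.
\<close>

section \<open>Right modules and their submodules\<close>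

text \<open>Being right duo is not a Morita invariant (a 2 by 2 matrix ring over a field is not
  right duo), so the arguments with elements and ideals are confined to \<open>T\<close>, and only
  statements about morphisms travel to \<open>R\<close>. Over \<open>T\<close> the decisive fact is
  that \<open>a T\<close> is two-sided, so every \<open>r a\<close> has the form \<open>a s\<close>.
  It makes the elements of a module killed by a given scalar a submodule, and it strengthens
  \<open>c^n a^n = 0\<close> to \<open>c^n T a^n = 0\<close>, which is why the lifted idempotents
  are central. Centrality makes multiplication by \<open>e\<close> linear. It thereby trades a
  factor from \<open>m\<close>, about which nothing is known, for one from \<open>J\<close>, where
  T-nilpotence applies. On the categorical side the functors are not assumed additive, so
  preservation of zero morphisms has to be derived from the natural isomorphisms. Injectivity, too,
  is not visibly a property of arrows; it is transported by pulling back the inclusion of a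
  kernel.\<close>

locale right_module_over =
  fixes R :: "('r, 'x) ring_scheme" and M :: "('m, 'r) right_module"
  assumes right_module: "is_right_module R M"
begin

sublocale R: ring R
  using right_module by (simp add: is_right_module_def)

sublocale M: abelian_group M
  using right_module by (simp add: is_right_module_def)

lemma smult_closed [simp, intro]:
  "\<lbrakk>x \<in> carrier M; r \<in> carrier R\<rbrakk> \<Longrightarrow> x \<cdot>\<^bsub>M\<^esub> r \<in> carrier M"
  using right_module by (simp add: is_right_module_def)

lemma smult_add_left:
  "\<lbrakk>x \<in> carrier M; y \<in> carrier M; r \<in> carrier R\<rbrakk>
    \<Longrightarrow> (x \<oplus>\<^bsub>M\<^esub> y) \<cdot>\<^bsub>M\<^esub> r = x \<cdot>\<^bsub>M\<^esub> r \<oplus>\<^bsub>M\<^esub> y \<cdot>\<^bsub>M\<^esub> r"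
  using right_module by (simp add: is_right_module_def)

lemma smult_add_right:
  "\<lbrakk>x \<in> carrier M; r \<in> carrier R; s \<in> carrier R\<rbrakk>
    \<Longrightarrow> x \<cdot>\<^bsub>M\<^esub> (r \<oplus>\<^bsub>R\<^esub> s) = x \<cdot>\<^bsub>M\<^esub> r \<oplus>\<^bsub>M\<^esub> x \<cdot>\<^bsub>M\<^esub> s"
  using right_module by (simp add: is_right_module_def)

lemma smult_assoc:
  "\<lbrakk>x \<in> carrier M; r \<in> carrier R; s \<in> carrier R\<rbrakk>
    \<Longrightarrow> (x \<cdot>\<^bsub>M\<^esub> r) \<cdot>\<^bsub>M\<^esub> s = x \<cdot>\<^bsub>M\<^esub> (r \<otimes>\<^bsub>R\<^esub> s)"
  using right_module by (simp add: is_right_module_def)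

lemma smult_one [simp]: "x \<in> carrier M \<Longrightarrow> x \<cdot>\<^bsub>M\<^esub> \<one>\<^bsub>R\<^esub> = x"
  using right_module by (simp add: is_right_module_def)

lemma smult_zero_right [simp]:
  assumes "x \<in> carrier M" shows "x \<cdot>\<^bsub>M\<^esub> \<zero>\<^bsub>R\<^esub> = \<zero>\<^bsub>M\<^esub>"
proof -
  have "x \<cdot>\<^bsub>M\<^esub> \<zero>\<^bsub>R\<^esub> \<oplus>\<^bsub>M\<^esub> x \<cdot>\<^bsub>M\<^esub> \<zero>\<^bsub>R\<^esub> = x \<cdot>\<^bsub>M\<^esub> \<zero>\<^bsub>R\<^esub>"
    using smult_add_right[of x "\<zero>\<^bsub>R\<^esub>" "\<zero>\<^bsub>R\<^esub>"] assms by simp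
  then show ?thesis
    using M.add.r_cancel_one' assms by (metis R.zero_closed smult_closed)
qed

lemma smult_zero_left [simp]:
  assumes "r \<in> carrier R" shows "\<zero>\<^bsub>M\<^esub> \<cdot>\<^bsub>M\<^esub> r = \<zero>\<^bsub>M\<^esub>"
proof -
  have "\<zero>\<^bsub>M\<^esub> \<cdot>\<^bsub>M\<^esub> r = (\<zero>\<^bsub>M\<^esub> \<cdot>\<^bsub>M\<^esub> \<zero>\<^bsub>R\<^esub>) \<cdot>\<^bsub>M\<^esub> r"
    by simp
  also have "\<dots> = \<zero>\<^bsub>M\<^esub>"
    using assms by (subst smult_assoc) simp_all
  finally show ?thesis .
qed

lemma smult_minus_right:
  assumes "x \<in> carrier M" "r \<in> carrier R" shows "x \<cdot>\<^bsub>M\<^esub> (\<ominus>\<^bsub>R\<^esub> r) = \<ominus>\<^bsub>M\<^esub> (x \<cdot>\<^bsub>M\<^esub> r)"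
proof -
  have "x \<cdot>\<^bsub>M\<^esub> (\<ominus>\<^bsub>R\<^esub> r) \<oplus>\<^bsub>M\<^esub> x \<cdot>\<^bsub>M\<^esub> r = \<zero>\<^bsub>M\<^esub>"
    using smult_add_right[of x "\<ominus>\<^bsub>R\<^esub> r" r] assms by (simp add: R.l_neg)
  then show ?thesis
    using assms by (simp add: M.minus_equality)
qed

lemma smult_minus_one:
  "x \<in> carrier M \<Longrightarrow> x \<cdot>\<^bsub>M\<^esub> (\<ominus>\<^bsub>R\<^esub> \<one>\<^bsub>R\<^esub>) = \<ominus>\<^bsub>M\<^esub> x"
  by (simp add: smult_minus_right)

lemma smult_minus_left:
  assumes "x \<in> carrier M" "r \<in> carrier R" shows "(\<ominus>\<^bsub>M\<^esub> x) \<cdot>\<^bsub>M\<^esub> r = \<ominus>\<^bsub>M\<^esub> (x \<cdot>\<^bsub>M\<^esub> r)"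
proof -
  have "(\<ominus>\<^bsub>M\<^esub> x) \<cdot>\<^bsub>M\<^esub> r \<oplus>\<^bsub>M\<^esub> x \<cdot>\<^bsub>M\<^esub> r = \<zero>\<^bsub>M\<^esub>"
    using smult_add_left[of "\<ominus>\<^bsub>M\<^esub> x" x r] assms by (simp add: M.l_neg)
  then show ?thesis
    using assms by (simp add: M.minus_equality)
qed

section \<open>Submodules: closure rules, intersections, unions of chains, sums\<close>

lemma submoduleI:
  assumes "N \<subseteq> carrier M" "\<zero>\<^bsub>M\<^esub> \<in> N"
    and "\<And>x y. \<lbrakk>x \<in> N; y \<in> N\<rbrakk> \<Longrightarrow> x \<oplus>\<^bsub>M\<^esub> y \<in> N"
    and "\<And>x r. \<lbrakk>x \<in> N; r \<in> carrier R\<rbrakk> \<Longrightarrow> x \<cdot>\<^bsub>M\<^esub> r \<in> N"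
  shows "submodule_of R M N"
proof -
  have "\<ominus>\<^bsub>M\<^esub> x \<in> N" if "x \<in> N" for x
    using assms(4)[OF that, of "\<ominus>\<^bsub>R\<^esub> \<one>\<^bsub>R\<^esub>"] assms(1) that smult_minus_one by auto
  then have "subgroup N (add_monoid M)"
    using assms by (intro M.add.subgroupI) (auto simp: a_inv_def)
  then show ?thesis
    using assms by (simp add: submodule_of_def additive_subgroup_def)
qed

lemma submodule_carrier: "\<lbrakk>submodule_of R M N; x \<in> N\<rbrakk> \<Longrightarrow> x \<in> carrier M"
  by (auto simp: submodule_of_def dest: additive_subgroup.a_Hcarr)

lemma submodule_subset: "submodule_of R M N \<Longrightarrow> N \<subseteq> carrier M"
  using submodule_carrier by blast

lemma submodule_zero: "submodule_of R M N \<Longrightarrow> \<zero>\<^bsub>M\<^esub> \<in> N"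
  by (auto simp: submodule_of_def dest: additive_subgroup.zero_closed)

lemma submodule_add: "\<lbrakk>submodule_of R M N; x \<in> N; y \<in> N\<rbrakk> \<Longrightarrow> x \<oplus>\<^bsub>M\<^esub> y \<in> N"
  by (auto simp: submodule_of_def dest: additive_subgroup.a_closed)

lemma submodule_smult: "\<lbrakk>submodule_of R M N; x \<in> N; r \<in> carrier R\<rbrakk> \<Longrightarrow> x \<cdot>\<^bsub>M\<^esub> r \<in> N"
  by (auto simp: submodule_of_def)

lemma submodule_neg: "\<lbrakk>submodule_of R M N; x \<in> N\<rbrakk> \<Longrightarrow> \<ominus>\<^bsub>M\<^esub> x \<in> N"
  using submodule_smult[of N x "\<ominus>\<^bsub>R\<^esub> \<one>\<^bsub>R\<^esub>"] submodule_carrier smult_minus_one by fastforce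

lemma submodule_minus: "\<lbrakk>submodule_of R M N; x \<in> N; y \<in> N\<rbrakk> \<Longrightarrow> x \<ominus>\<^bsub>M\<^esub> y \<in> N"
  by (simp add: a_minus_def submodule_add submodule_neg)

lemma submodule_add_cancel:
  assumes "submodule_of R M N" "x \<in> N" "y \<in> carrier M" "x \<oplus>\<^bsub>M\<^esub> y \<in> N"
  shows "y \<in> N"
proof -
  have "\<ominus>\<^bsub>M\<^esub> x \<oplus>\<^bsub>M\<^esub> (x \<oplus>\<^bsub>M\<^esub> y) = y"
    using assms submodule_carrier by (simp add: M.r_neg2 M.r_neg1)
  then show ?thesis
    using assms submodule_add submodule_neg by metis
qed

lemma submodule_carrier_self: "submodule_of R M (carrier M)"
  by (rule submoduleI) auto

lemma submodule_trivial: "submodule_of R M {\<zero>\<^bsub>M\<^esub>}"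
  by (rule submoduleI) auto

lemma submodule_Inter:
  assumes "\<And>N. N \<in> \<N> \<Longrightarrow> submodule_of R M N" "\<N> \<noteq> {}"
  shows "submodule_of R M (\<Inter>\<N>)"
proof (rule submoduleI)
  obtain N where "N \<in> \<N>"
    using assms(2) by blast
  then show "\<Inter>\<N> \<subseteq> carrier M"
    using submodule_subset[OF assms(1)] by blast
qed (auto simp: assms(1) submodule_zero submodule_add submodule_smult)

lemma submodule_Int:
  "\<lbrakk>submodule_of R M N; submodule_of R M K\<rbrakk> \<Longrightarrow> submodule_of R M (N \<inter> K)"
  using submodule_Inter[of "{N, K}"] by auto

lemma submodule_Union_chain:
  assumes "\<And>N. N \<in> \<C> \<Longrightarrow> submodule_of R M N" "\<C> \<noteq> {}"
    and "\<And>N K. \<lbrakk>N \<in> \<C>; K \<in> \<C>\<rbrakk> \<Longrightarrow> N \<subseteq> K \<or> K \<subseteq> N"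
  shows "submodule_of R M (\<Union>\<C>)"
proof (rule submoduleI)
  fix x y assume "x \<in> \<Union>\<C>" "y \<in> \<Union>\<C>"
  then obtain N K where "N \<in> \<C>" "x \<in> N" "K \<in> \<C>" "y \<in> K" by blast
  then show "x \<oplus>\<^bsub>M\<^esub> y \<in> \<Union>\<C>"
    using assms(3)[of N K] submodule_add[OF assms(1)] by blast
next
  show "\<Union>\<C> \<subseteq> carrier M"
    using submodule_subset[OF assms(1)] by blast
  show "\<zero>\<^bsub>M\<^esub> \<in> \<Union>\<C>"
    using submodule_zero[OF assms(1)] assms(2) by blast
  show "x \<cdot>\<^bsub>M\<^esub> r \<in> \<Union>\<C>" if "x \<in> \<Union>\<C>" "r \<in> carrier R" for x r
    using submodule_smult[OF assms(1)] that by blast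
qed

lemma mem_set_add: "z \<in> A <+>\<^bsub>M\<^esub> B \<longleftrightarrow> (\<exists>a\<in>A. \<exists>b\<in>B. z = a \<oplus>\<^bsub>M\<^esub> b)"
  by (auto simp: set_add_def set_mult_def)

lemma submodule_set_add:
  assumes N: "submodule_of R M N" and K: "submodule_of R M K"
  shows "submodule_of R M (N <+>\<^bsub>M\<^esub> K)"
proof (rule submoduleI)
  show "\<zero>\<^bsub>M\<^esub> \<in> N <+>\<^bsub>M\<^esub> K"
    using submodule_zero[OF N] submodule_zero[OF K] by (force simp: mem_set_add)
next
  fix x y assume "x \<in> N <+>\<^bsub>M\<^esub> K" "y \<in> N <+>\<^bsub>M\<^esub> K"
  then obtain a b c d where *: "a \<in> N" "b \<in> K" "c \<in> N" "d \<in> K" "x = a \<oplus>\<^bsub>M\<^esub> b" "y = c \<oplus>\<^bsub>M\<^esub> d"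
    by (auto simp: mem_set_add)
  then have "x \<oplus>\<^bsub>M\<^esub> y = (a \<oplus>\<^bsub>M\<^esub> c) \<oplus>\<^bsub>M\<^esub> (b \<oplus>\<^bsub>M\<^esub> d)"
    using submodule_carrier[OF N] submodule_carrier[OF K] by (simp add: M.add.m_ac)
  then show "x \<oplus>\<^bsub>M\<^esub> y \<in> N <+>\<^bsub>M\<^esub> K"
    using * N K submodule_add unfolding mem_set_add by blast
next
  fix x r assume "x \<in> N <+>\<^bsub>M\<^esub> K" and r: "r \<in> carrier R"
  then obtain a b where *: "a \<in> N" "b \<in> K" "x = a \<oplus>\<^bsub>M\<^esub> b"
    by (auto simp: mem_set_add)
  then have "x \<cdot>\<^bsub>M\<^esub> r = a \<cdot>\<^bsub>M\<^esub> r \<oplus>\<^bsub>M\<^esub> b \<cdot>\<^bsub>M\<^esub> r"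
    using submodule_carrier[OF N] submodule_carrier[OF K] r by (simp add: smult_add_left)
  then show "x \<cdot>\<^bsub>M\<^esub> r \<in> N <+>\<^bsub>M\<^esub> K"
    using * N K r submodule_smult unfolding mem_set_add by blast
qed (use submodule_carrier[OF N] submodule_carrier[OF K] in \<open>auto simp: mem_set_add\<close>)

lemma set_add_upper1:
  assumes "submodule_of R M N" "submodule_of R M K" shows "N \<subseteq> N <+>\<^bsub>M\<^esub> K"
proof
  fix x assume "x \<in> N"
  moreover have "x = x \<oplus>\<^bsub>M\<^esub> \<zero>\<^bsub>M\<^esub>"
    using calculation assms submodule_carrier by simp
  ultimately show "x \<in> N <+>\<^bsub>M\<^esub> K"
    using assms submodule_zero unfolding mem_set_add by blast
qed

lemma set_add_upper2:
  assumes "submodule_of R M N" "submodule_of R M K" shows "K \<subseteq> N <+>\<^bsub>M\<^esub> K"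
proof
  fix x assume "x \<in> K"
  moreover have "x = \<zero>\<^bsub>M\<^esub> \<oplus>\<^bsub>M\<^esub> x"
    using calculation assms submodule_carrier by simp
  ultimately show "x \<in> N <+>\<^bsub>M\<^esub> K"
    using assms submodule_zero unfolding mem_set_add by blast
qed

lemma set_add_least:
  assumes "submodule_of R M L" "N \<subseteq> L" "K \<subseteq> L" shows "N <+>\<^bsub>M\<^esub> K \<subseteq> L"
  using assms submodule_add by (auto simp: mem_set_add subset_iff)

section \<open>Cyclic submodules and maximality\<close>

definition cyclic :: "'m \<Rightarrow> 'm set" where
  "cyclic x = (\<lambda>r. x \<cdot>\<^bsub>M\<^esub> r) ` carrier R"

lemma submodule_cyclic:
  assumes x: "x \<in> carrier M" shows "submodule_of R M (cyclic x)"
proof (rule submoduleI)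
  show "\<zero>\<^bsub>M\<^esub> \<in> cyclic x"
    unfolding cyclic_def using smult_zero_right[OF x] by (metis R.zero_closed image_eqI)
next
  fix y z assume "y \<in> cyclic x" "z \<in> cyclic x"
  then show "y \<oplus>\<^bsub>M\<^esub> z \<in> cyclic x"
    unfolding cyclic_def using x by (auto simp flip: smult_add_right)
next
  fix y r assume "y \<in> cyclic x" "r \<in> carrier R"
  then show "y \<cdot>\<^bsub>M\<^esub> r \<in> cyclic x"
    unfolding cyclic_def using x by (auto simp: smult_assoc)
qed (use x in \<open>auto simp: cyclic_def\<close>)

lemma cyclic_self: "x \<in> carrier M \<Longrightarrow> x \<in> cyclic x"
  unfolding cyclic_def using smult_one by (metis R.one_closed image_eqI)

lemma mem_add_cyclic:
  "z \<in> N <+>\<^bsub>M\<^esub> cyclic x \<longleftrightarrow> (\<exists>n\<in>N. \<exists>r\<in>carrier R. z = n \<oplus>\<^bsub>M\<^esub> x \<cdot>\<^bsub>M\<^esub> r)"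
  by (auto simp: mem_set_add cyclic_def)

text \<open>The single appeal to Zorn's lemma. The set \<open>B\<close> is left free because it is
  chosen in three ways: the nonzero part of a submodule (maximal complements), a single element
  (maximal submodules without that element), and the unit (maximal right ideals).\<close>

lemma ex_maximal_submodule_avoiding:
  assumes "submodule_of R M N" "N \<inter> B = {}"
  shows "\<exists>P. submodule_of R M P \<and> N \<subseteq> P \<and> P \<inter> B = {} \<and>
    (\<forall>Q. submodule_of R M Q \<longrightarrow> P \<subset> Q \<longrightarrow> Q \<inter> B \<noteq> {})"
proof -
  let ?A = "{P. submodule_of R M P \<and> N \<subseteq> P \<and> P \<inter> B = {}}"
  have "\<exists>P\<in>?A. \<forall>Q\<in>?A. P \<subseteq> Q \<longrightarrow> Q = P"
  proof (rule subset_Zorn_nonempty)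
    show "?A \<noteq> {}"
      using assms by blast
  next
    fix \<C> assume "\<C> \<noteq> {}" and "subset.chain ?A \<C>"
    then have "\<C> \<subseteq> ?A" and "\<And>P Q. \<lbrakk>P \<in> \<C>; Q \<in> \<C>\<rbrakk> \<Longrightarrow> P \<subseteq> Q \<or> Q \<subseteq> P"
      unfolding subset.chain_def by blast+
    then have "submodule_of R M (\<Union>\<C>)"
      using \<open>\<C> \<noteq> {}\<close> by (intro submodule_Union_chain) auto
    then show "\<Union>\<C> \<in> ?A"
      using \<open>\<C> \<subseteq> ?A\<close> \<open>\<C> \<noteq> {}\<close> by blast
  qed
  then obtain P where P: "P \<in> ?A" and max: "\<forall>Q\<in>?A. P \<subseteq> Q \<longrightarrow> Q = P"
    by (rule bexE)
  have "Q \<inter> B \<noteq> {}" if "submodule_of R M Q" "P \<subset> Q" for Q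
    using that P max by blast
  then show ?thesis
    using P by blast
qed


section \<open>Semisimple modules\<close>

text \<open>The working form of semisimplicity, since both Baer conditions ask for summands. The two
  are shown to be equivalent over an arbitrary ring in this section.\<close>

definition complemented :: bool where
  "complemented \<longleftrightarrow> (\<forall>N. submodule_of R M N \<longrightarrow> direct_summand R M N)"

lemma submodule_span_submodule: "X \<subseteq> carrier M \<Longrightarrow> submodule_of R M (submodule_span R M X)"
  unfolding submodule_span_def using submodule_carrier_self by (intro submodule_Inter) auto

lemma submodule_span_least: "\<lbrakk>submodule_of R M N; X \<subseteq> N\<rbrakk> \<Longrightarrow> submodule_span R M X \<subseteq> N"
  unfolding submodule_span_def by blast

lemma submodule_span_upper: "X \<subseteq> submodule_span R M X"
  unfolding submodule_span_def by blast

lemma zero_of_disjoint_sum: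
  assumes "submodule_of R M N" "submodule_of R M K" "N \<inter> K = {\<zero>\<^bsub>M\<^esub>}"
    and "n \<in> N" "k \<in> K" "n \<oplus>\<^bsub>M\<^esub> k = \<zero>\<^bsub>M\<^esub>"
  shows "n = \<zero>\<^bsub>M\<^esub>" "k = \<zero>\<^bsub>M\<^esub>"
proof -
  have c: "n \<in> carrier M" "k \<in> carrier M"
    using assms submodule_carrier by auto
  have "n = \<ominus>\<^bsub>M\<^esub> k"
    using assms(6) c by (simp add: M.minus_equality)
  then have "n \<in> N \<inter> K"
    using assms(2,4,5) submodule_neg[of K k] by simp
  then show "n = \<zero>\<^bsub>M\<^esub>"
    using assms(3) by blast
  then show "k = \<zero>\<^bsub>M\<^esub>"
    using assms(6) c by simp
qed

text \<open>The last conclusion is maximality of \<open>P\<close> read on elements: adjoining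
  \<open>x\<close> to \<open>P\<close> must produce a nonzero element of \<open>N\<close>. To show
  that \<open>N + P\<close> is everything, it is applied to an \<open>x\<close> that generates, or
  lies in, a simple submodule.\<close>

lemma maximal_complement:
  assumes "submodule_of R M N"
  obtains P where "submodule_of R M P" "N \<inter> P = {\<zero>\<^bsub>M\<^esub>}"
    "\<And>x. \<lbrakk>x \<in> carrier M; x \<notin> P\<rbrakk> \<Longrightarrow>
      \<exists>p\<in>P. \<exists>r\<in>carrier R. p \<oplus>\<^bsub>M\<^esub> x \<cdot>\<^bsub>M\<^esub> r \<in> N \<and> p \<oplus>\<^bsub>M\<^esub> x \<cdot>\<^bsub>M\<^esub> r \<noteq> \<zero>\<^bsub>M\<^esub>"
proof -
  obtain P where P: "submodule_of R M P" "P \<inter> (N - {\<zero>\<^bsub>M\<^esub>}) = {}"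
    and max: "\<And>Q. \<lbrakk>submodule_of R M Q; P \<subset> Q\<rbrakk> \<Longrightarrow> Q \<inter> (N - {\<zero>\<^bsub>M\<^esub>}) \<noteq> {}"
    using ex_maximal_submodule_avoiding[OF submodule_trivial, of "N - {\<zero>\<^bsub>M\<^esub>}"] by blast
  show thesis
  proof
    show "N \<inter> P = {\<zero>\<^bsub>M\<^esub>}"
      using P submodule_zero assms by blast
    fix x assume x: "x \<in> carrier M" "x \<notin> P"
    then have "P \<subset> P <+>\<^bsub>M\<^esub> cyclic x"
      using set_add_upper1[OF P(1) submodule_cyclic] set_add_upper2[OF P(1) submodule_cyclic]
        cyclic_self[OF x(1)] by blast
    then have "(P <+>\<^bsub>M\<^esub> cyclic x) \<inter> (N - {\<zero>\<^bsub>M\<^esub>}) \<noteq> {}"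
      using max submodule_set_add[OF P(1) submodule_cyclic[OF x(1)]] by blast
    then obtain z where "z \<in> P <+>\<^bsub>M\<^esub> cyclic x" "z \<in> N" "z \<noteq> \<zero>\<^bsub>M\<^esub>"
      by blast
    then show "\<exists>p\<in>P. \<exists>r\<in>carrier R. p \<oplus>\<^bsub>M\<^esub> x \<cdot>\<^bsub>M\<^esub> r \<in> N \<and> p \<oplus>\<^bsub>M\<^esub> x \<cdot>\<^bsub>M\<^esub> r \<noteq> \<zero>\<^bsub>M\<^esub>"
      unfolding mem_add_cyclic by blast
  qed (use P in auto)
qed

text \<open>It suffices that \<open>N + P\<close> contains each simple \<open>A\<close>. Otherwise
  \<open>A\<close> meets \<open>N + P\<close> trivially. Maximality of \<open>P\<close> yields a
  nonzero \<open>p + x r\<close> in \<open>N\<close> with \<open>x\<close> in \<open>A\<close>, so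
  \<open>x r\<close> lies in \<open>A\<close> and in \<open>N + P\<close> and vanishes; then
  \<open>p\<close> is a nonzero element of \<open>N\<close> and of \<open>P\<close>.\<close>

lemma semisimple_imp_complemented:
  assumes "semisimple_module R M" shows complemented
  unfolding complemented_def
proof safe
  fix N assume N: "submodule_of R M N"
  obtain P where P: "submodule_of R M P" "N \<inter> P = {\<zero>\<^bsub>M\<^esub>}"
    and max: "\<And>x. \<lbrakk>x \<in> carrier M; x \<notin> P\<rbrakk> \<Longrightarrow>
      \<exists>p\<in>P. \<exists>r\<in>carrier R. p \<oplus>\<^bsub>M\<^esub> x \<cdot>\<^bsub>M\<^esub> r \<in> N \<and> p \<oplus>\<^bsub>M\<^esub> x \<cdot>\<^bsub>M\<^esub> r \<noteq> \<zero>\<^bsub>M\<^esub>"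
    using maximal_complement[OF N] by blast
  note NP = submodule_set_add[OF N P(1)]
  have "A \<subseteq> N <+>\<^bsub>M\<^esub> P" if A: "simple_submodule R M A" for A
  proof (rule ccontr)
    assume "\<not> A \<subseteq> N <+>\<^bsub>M\<^esub> P"
    then obtain x where x: "x \<in> A" "x \<notin> N <+>\<^bsub>M\<^esub> P" by blast
    have sA: "submodule_of R M A"
      using A by (simp add: simple_submodule_def)
    have "A \<inter> (N <+>\<^bsub>M\<^esub> P) \<noteq> A"
      using x by blast
    then have disj: "A \<inter> (N <+>\<^bsub>M\<^esub> P) = {\<zero>\<^bsub>M\<^esub>}"
      using A submodule_Int[OF sA NP] unfolding simple_submodule_def by blast
    have "x \<notin> P" "x \<in> carrier M"
      using x set_add_upper2[OF N P(1)] submodule_carrier[OF sA] by auto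
    then obtain p r where pr: "p \<in> P" "r \<in> carrier R"
      "p \<oplus>\<^bsub>M\<^esub> x \<cdot>\<^bsub>M\<^esub> r \<in> N" "p \<oplus>\<^bsub>M\<^esub> x \<cdot>\<^bsub>M\<^esub> r \<noteq> \<zero>\<^bsub>M\<^esub>"
      using max by blast
    have "x \<cdot>\<^bsub>M\<^esub> r \<in> N <+>\<^bsub>M\<^esub> P"
      using submodule_add_cancel[OF NP] pr set_add_upper1[OF N P(1)] set_add_upper2[OF N P(1)]
        \<open>x \<in> carrier M\<close> by blast
    then have "x \<cdot>\<^bsub>M\<^esub> r = \<zero>\<^bsub>M\<^esub>"
      using disj submodule_smult[OF sA x(1) pr(2)] by blast
    then have "p \<in> N" "p \<noteq> \<zero>\<^bsub>M\<^esub>"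
      using pr submodule_carrier[OF P(1)] by auto
    then show False
      using P pr(1) by blast
  qed
  then have "submodule_span R M (\<Union>{A. simple_submodule R M A}) \<subseteq> N <+>\<^bsub>M\<^esub> P"
    by (intro submodule_span_least NP) blast
  then have "N <+>\<^bsub>M\<^esub> P = carrier M"
    using assms submodule_subset[OF NP] unfolding semisimple_module_def by blast
  then show "direct_summand R M N"
    unfolding direct_summand_def using N P by blast
qed

text \<open>By the modular law, a complement of \<open>A\<close> in the whole module, cut down to
  \<open>K\<close>, is a complement of \<open>A\<close> in \<open>K\<close>.\<close>

lemma complemented_relative:
  assumes complemented "submodule_of R M A" "submodule_of R M K" "A \<subseteq> K"
  obtains B where "submodule_of R M B" "B \<subseteq> K" "A \<inter> B = {\<zero>\<^bsub>M\<^esub>}" "A <+>\<^bsub>M\<^esub> B = K"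
proof -
  obtain C where C: "submodule_of R M C" "A \<inter> C = {\<zero>\<^bsub>M\<^esub>}" "A <+>\<^bsub>M\<^esub> C = carrier M"
    using assms unfolding complemented_def direct_summand_def by blast
  show thesis
  proof (rule that[of "C \<inter> K"])
    show "A <+>\<^bsub>M\<^esub> (C \<inter> K) = K"
    proof
      show "K \<subseteq> A <+>\<^bsub>M\<^esub> (C \<inter> K)"
      proof
        fix x assume x: "x \<in> K"
        then have "x \<in> A <+>\<^bsub>M\<^esub> C"
          using C(3) submodule_carrier assms(3) by blast
        then obtain a c where ac: "a \<in> A" "c \<in> C" "x = a \<oplus>\<^bsub>M\<^esub> c"
          by (auto simp: mem_set_add)
        then have "c \<in> K"
          using submodule_add_cancel[OF assms(3), of a c] assms(4) x submodule_carrier[OF C(1)] by blast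
        then show "x \<in> A <+>\<^bsub>M\<^esub> (C \<inter> K)"
          using ac by (auto simp: mem_set_add)
      qed
    qed (use assms(4) set_add_least[OF assms(3)] in blast)
    show "submodule_of R M (C \<inter> K)"
      by (rule submodule_Int[OF C(1) assms(3)])
  qed (use C(2) assms(4) in blast)+
qed

text \<open>Let \<open>P\<close> be maximal without \<open>x\<close>, and let \<open>A\<close> be a
  complement of the intersection of \<open>P\<close> and \<open>K\<close> inside \<open>K\<close>.
  If \<open>A\<close> split as a sum of nonzero \<open>B\<close> and \<open>C\<close>, then by
  maximality \<open>x\<close> would lie in \<open>P + B\<close> and in \<open>P + C\<close>. The
  difference of the two expressions lies in both \<open>P\<close> and \<open>A\<close>, hence is
  zero, so the components in \<open>B\<close> and \<open>C\<close> agree and vanish, and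
  \<open>x\<close> would lie in \<open>P\<close>.\<close>

lemma complemented_ex_simple:
  assumes complemented and K: "submodule_of R M K" and x: "x \<in> K" "x \<noteq> \<zero>\<^bsub>M\<^esub>"
  obtains A where "simple_submodule R M A" "A \<subseteq> K"
proof -
  have "{\<zero>\<^bsub>M\<^esub>} \<inter> {x} = {}"
    using x by simp
  from ex_maximal_submodule_avoiding[OF submodule_trivial this] obtain P where P: "submodule_of R M P" "{\<zero>\<^bsub>M\<^esub>} \<subseteq> P" "P \<inter> {x} = {}"
    and max: "\<And>Q. \<lbrakk>submodule_of R M Q; P \<subset> Q\<rbrakk> \<Longrightarrow> Q \<inter> {x} \<noteq> {}"
    by blast
  define L where "L = P \<inter> K"
  have L: "submodule_of R M L" "L \<subseteq> K" "x \<notin> L"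
    using P K submodule_Int by (auto simp: L_def)
  obtain A where A: "submodule_of R M A" "A \<subseteq> K" "L \<inter> A = {\<zero>\<^bsub>M\<^esub>}" "L <+>\<^bsub>M\<^esub> A = K"
    by (rule complemented_relative[OF assms(1) L(1) K L(2)])
  have big: "x \<in> P <+>\<^bsub>M\<^esub> B" if B: "submodule_of R M B" "B \<subseteq> A" "B \<noteq> {\<zero>\<^bsub>M\<^esub>}" for B
  proof -
    have "\<not> B \<subseteq> P"
    proof
      assume "B \<subseteq> P"
      then have "B \<subseteq> {\<zero>\<^bsub>M\<^esub>}"
        using B(2) A(2,3) unfolding L_def by blast
      then show False
        using B(3) submodule_zero[OF B(1)] by auto
    qed
    then have "P \<subset> P <+>\<^bsub>M\<^esub> B"
      using set_add_upper1[OF P(1) B(1)] set_add_upper2[OF P(1) B(1)] by blast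
    then show ?thesis
      using max submodule_set_add[OF P(1) B(1)] by blast
  qed
  have "simple_submodule R M A"
    unfolding simple_submodule_def
  proof (intro conjI allI impI)
    show "A \<noteq> {\<zero>\<^bsub>M\<^esub>}"
    proof
      assume "A = {\<zero>\<^bsub>M\<^esub>}"
      then have "L <+>\<^bsub>M\<^esub> A \<subseteq> L"
        using set_add_least[OF L(1)] submodule_zero[OF L(1)] by blast
      then show False
        using A(4) x L(3) by blast
    qed
  next
    fix B assume "submodule_of R M B \<and> B \<subseteq> A"
    then have B: "submodule_of R M B" "B \<subseteq> A" by auto
    obtain C where C: "submodule_of R M C" "C \<subseteq> A" "B \<inter> C = {\<zero>\<^bsub>M\<^esub>}" "B <+>\<^bsub>M\<^esub> C = A"
      by (rule complemented_relative[OF assms(1) B(1) A(1) B(2)])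
    show "B = {\<zero>\<^bsub>M\<^esub>} \<or> B = A"
    proof (rule ccontr)
      assume neq: "\<not> (B = {\<zero>\<^bsub>M\<^esub>} \<or> B = A)"
      have "C \<noteq> {\<zero>\<^bsub>M\<^esub>}"
      proof
        assume "C = {\<zero>\<^bsub>M\<^esub>}"
        then have "B <+>\<^bsub>M\<^esub> C \<subseteq> B"
          using set_add_least[OF B(1)] submodule_zero[OF B(1)] by blast
        then show False
          using C(4) neq B(2) by blast
      qed
      then have "x \<in> P <+>\<^bsub>M\<^esub> B" "x \<in> P <+>\<^bsub>M\<^esub> C"
        using big[of B] big[of C] B C(1,2) neq by blast+
      then obtain p b q c where pbqc: "p \<in> P" "b \<in> B" "x = p \<oplus>\<^bsub>M\<^esub> b" "q \<in> P" "c \<in> C" "x = q \<oplus>\<^bsub>M\<^esub> c"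
        by (auto simp: mem_set_add)
      have cs: "p \<in> carrier M" "b \<in> carrier M" "q \<in> carrier M" "c \<in> carrier M"
        using pbqc P B C submodule_carrier by auto
      define d where "d = \<ominus>\<^bsub>M\<^esub> p \<oplus>\<^bsub>M\<^esub> q"
      have d: "d \<in> P" "d \<in> carrier M"
        unfolding d_def using pbqc cs submodule_neg[OF P(1)] submodule_add[OF P(1)] by auto
      have "c \<oplus>\<^bsub>M\<^esub> d = \<ominus>\<^bsub>M\<^esub> p \<oplus>\<^bsub>M\<^esub> (q \<oplus>\<^bsub>M\<^esub> c)"
        unfolding d_def using cs by (simp add: M.add.m_ac)
      also have "\<dots> = b"
        using pbqc(3,6) cs by (metis M.r_neg1)
      finally have b: "c \<oplus>\<^bsub>M\<^esub> d = b" .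
      then have "d \<in> A"
        using submodule_add_cancel[OF A(1), of c d] pbqc(2,5) B(2) C(2) d(2) by auto
      then have "d = \<zero>\<^bsub>M\<^esub>"
        using A(2,3) d(1) unfolding L_def by blast
      then have "b \<in> B \<inter> C"
        using b cs pbqc(2,5) by simp
      then have "b = \<zero>\<^bsub>M\<^esub>"
        using C(3) by simp
      then show False
        using pbqc cs P by simp
    qed
  qed (fact A(1))
  then show thesis
    using A(2) by (rule that)
qed

text \<open>A nonzero complement of the socle would contain a simple submodule, which lies in the
  socle as well.\<close>

lemma complemented_imp_semisimple:
  assumes complemented shows "semisimple_module R M"
proof -
  define S where "S = submodule_span R M (\<Union>{N. simple_submodule R M N})"
  have "\<Union>{N. simple_submodule R M N} \<subseteq> carrier M"
    using submodule_subset by (auto simp: simple_submodule_def)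
  then have S: "submodule_of R M S"
    unfolding S_def by (rule submodule_span_submodule)
  then obtain K where K: "submodule_of R M K" "S \<inter> K = {\<zero>\<^bsub>M\<^esub>}" "S <+>\<^bsub>M\<^esub> K = carrier M"
    using assms unfolding complemented_def direct_summand_def by blast
  have "K \<subseteq> {\<zero>\<^bsub>M\<^esub>}"
  proof (rule ccontr)
    assume "\<not> K \<subseteq> {\<zero>\<^bsub>M\<^esub>}"
    then obtain x where "x \<in> K" "x \<noteq> \<zero>\<^bsub>M\<^esub>"
      by blast
    then obtain A where A: "simple_submodule R M A" "A \<subseteq> K"
      by (rule complemented_ex_simple[OF assms K(1)])
    then have "A \<subseteq> S"
      unfolding S_def using submodule_span_upper[of "\<Union>{N. simple_submodule R M N}"] by blast
    then have "A \<subseteq> {\<zero>\<^bsub>M\<^esub>}"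
      using A(2) K(2) by blast
    moreover have "A \<noteq> {\<zero>\<^bsub>M\<^esub>}" "\<zero>\<^bsub>M\<^esub> \<in> A"
      using A(1) submodule_zero by (auto simp: simple_submodule_def)
    ultimately show False
      by auto
  qed
  then have "carrier M \<subseteq> S"
    using set_add_least[OF S, of S K] K(3) submodule_zero[OF S] by blast
  then show ?thesis
    unfolding semisimple_module_def using submodule_subset[OF S] S_def by blast
qed

end

section \<open>Homomorphisms\<close>

lemma module_homI:
  assumes "f \<in> carrier M \<rightarrow>\<^sub>E carrier N"
    and "\<And>x y. \<lbrakk>x \<in> carrier M; y \<in> carrier M\<rbrakk> \<Longrightarrow> f (x \<oplus>\<^bsub>M\<^esub> y) = f x \<oplus>\<^bsub>N\<^esub> f y"
    and "\<And>x r. \<lbrakk>x \<in> carrier M; r \<in> carrier R\<rbrakk> \<Longrightarrow> f (x \<cdot>\<^bsub>M\<^esub> r) = f x \<cdot>\<^bsub>N\<^esub> r"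
  shows "f \<in> module_hom R M N"
  using assms by (simp add: module_hom_def)

lemma module_hom_closed: "\<lbrakk>f \<in> module_hom R M N; x \<in> carrier M\<rbrakk> \<Longrightarrow> f x \<in> carrier N"
  by (auto simp: module_hom_def)

lemma module_hom_add:
  "\<lbrakk>f \<in> module_hom R M N; x \<in> carrier M; y \<in> carrier M\<rbrakk> \<Longrightarrow> f (x \<oplus>\<^bsub>M\<^esub> y) = f x \<oplus>\<^bsub>N\<^esub> f y"
  by (simp add: module_hom_def)

lemma module_hom_smult:
  "\<lbrakk>f \<in> module_hom R M N; x \<in> carrier M; r \<in> carrier R\<rbrakk> \<Longrightarrow> f (x \<cdot>\<^bsub>M\<^esub> r) = f x \<cdot>\<^bsub>N\<^esub> r"
  by (simp add: module_hom_def)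

lemma module_hom_extensional: "f \<in> module_hom R M N \<Longrightarrow> f \<in> extensional (carrier M)"
  by (auto simp: module_hom_def PiE_def)

lemma module_hom_eqI:
  assumes "f \<in> module_hom R M N" "g \<in> module_hom R M N'" "\<And>x. x \<in> carrier M \<Longrightarrow> f x = g x"
  shows "f = g"
  using module_hom_extensional[OF assms(1)] module_hom_extensional[OF assms(2)] assms(3)
  by (rule extensionalityI)

lemma module_hom_zero:
  assumes "is_right_module R M" "is_right_module R N" and f: "f \<in> module_hom R M N"
  shows "f \<zero>\<^bsub>M\<^esub> = \<zero>\<^bsub>N\<^esub>"
proof -
  interpret M: right_module_over R M by unfold_locales fact
  interpret N: right_module_over R N by unfold_locales fact
  have "f (\<zero>\<^bsub>M\<^esub> \<cdot>\<^bsub>M\<^esub> \<zero>\<^bsub>R\<^esub>) = f \<zero>\<^bsub>M\<^esub> \<cdot>\<^bsub>N\<^esub> \<zero>\<^bsub>R\<^esub>"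
    by (rule module_hom_smult[OF f]) auto
  then show ?thesis
    using module_hom_closed[OF f] by simp
qed

lemma module_hom_compose:
  assumes "is_right_module R L" and f: "f \<in> module_hom R L M" and g: "g \<in> module_hom R M N"
  shows "compose (carrier L) g f \<in> module_hom R L N"
proof -
  interpret L: right_module_over R L by unfold_locales fact
  show ?thesis
    by (rule module_homI)
      (auto simp: compose_def module_hom_closed[OF f] module_hom_closed[OF g] module_hom_add[OF f]
        module_hom_add[OF g] module_hom_smult[OF f] module_hom_smult[OF g])
qed

lemma module_hom_id: "is_right_module R M \<Longrightarrow> (\<lambda>x\<in>carrier M. x) \<in> module_hom R M M"
proof -
  assume "is_right_module R M"
  then interpret right_module_over R M by unfold_locales
  show ?thesis by (rule module_homI) auto
qed

lemma module_hom_const_zero: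
  assumes "is_right_module R M" "is_right_module R N"
  shows "(\<lambda>x\<in>carrier M. \<zero>\<^bsub>N\<^esub>) \<in> module_hom R M N"
proof -
  interpret M: right_module_over R M by unfold_locales fact
  interpret N: right_module_over R N by unfold_locales fact
  show ?thesis by (rule module_homI) auto
qed

lemma hom_kernel_submodule:
  assumes "is_right_module R M" "is_right_module R N" and f: "f \<in> module_hom R M N"
  shows "submodule_of R M (hom_kernel M N f)"
proof -
  interpret M: right_module_over R M by unfold_locales fact
  interpret N: right_module_over R N by unfold_locales fact
  show ?thesis
    by (rule M.submoduleI)
      (auto simp: hom_kernel_def module_hom_zero[OF assms] module_hom_add[OF f] module_hom_smult[OF f])
qed

lemma module_hom_image_submodule:
  assumes "is_right_module R M" "is_right_module R N" and f: "f \<in> module_hom R M N"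
    and A: "submodule_of R M A"
  shows "submodule_of R N (f ` A)"
proof -
  interpret M: right_module_over R M by unfold_locales fact
  interpret N: right_module_over R N by unfold_locales fact
  note Ac = M.submodule_carrier[OF A]
  show ?thesis
  proof (rule N.submoduleI)
    show "f ` A \<subseteq> carrier N"
      using Ac module_hom_closed[OF f] by blast
    show "\<zero>\<^bsub>N\<^esub> \<in> f ` A"
      using module_hom_zero[OF assms(1-3)] M.submodule_zero[OF A] by (metis image_eqI)
    show "x \<oplus>\<^bsub>N\<^esub> y \<in> f ` A" if xy: "x \<in> f ` A" "y \<in> f ` A" for x y
    proof -
      obtain a b where ab: "a \<in> A" "b \<in> A" "x = f a" "y = f b"
        using xy by blast
      then have "x \<oplus>\<^bsub>N\<^esub> y = f (a \<oplus>\<^bsub>M\<^esub> b)"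
        using module_hom_add[OF f] Ac by simp
      then show ?thesis
        using M.submodule_add[OF A ab(1,2)] by (rule image_eqI)
    qed
    show "x \<cdot>\<^bsub>N\<^esub> r \<in> f ` A" if xr: "x \<in> f ` A" "r \<in> carrier R" for x r
    proof -
      obtain a where a: "a \<in> A" "x = f a"
        using xr by blast
      then have "x \<cdot>\<^bsub>N\<^esub> r = f (a \<cdot>\<^bsub>M\<^esub> r)"
        using module_hom_smult[OF f] Ac xr by simp
      then show ?thesis
        using M.submodule_smult[OF A a(1) xr(2)] by (rule image_eqI)
    qed
  qed
qed

lemma bij_module_hom_inv:
  assumes "is_right_module R M" and f: "f \<in> module_hom R M N"
    and bij: "bij_betw f (carrier M) (carrier N)"
  obtains g where "g \<in> module_hom R N M" "\<And>x. x \<in> carrier M \<Longrightarrow> g (f x) = x"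
    "\<And>y. y \<in> carrier N \<Longrightarrow> f (g y) = y"
proof
  interpret M: right_module_over R M by unfold_locales fact
  define g where "g = (\<lambda>y\<in>carrier N. inv_into (carrier M) f y)"
  have inj: "inj_on f (carrier M)" and surj: "f ` carrier M = carrier N"
    using bij by (auto simp: bij_betw_def)
  show gf: "g (f x) = x" if "x \<in> carrier M" for x
    using that inj module_hom_closed[OF f] by (simp add: g_def)
  show fg: "f (g y) = y" if "y \<in> carrier N" for y
    using that surj by (simp add: g_def f_inv_into_f)
  have surjE: "\<exists>x\<in>carrier M. y = f x" if "y \<in> carrier N" for y
    using that surj by blast
  show "g \<in> module_hom R N M"
  proof (rule module_homI)
    show "g \<in> carrier N \<rightarrow>\<^sub>E carrier M"
      using surj by (auto simp: g_def inv_into_into)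
    show "g (y \<oplus>\<^bsub>N\<^esub> z) = g y \<oplus>\<^bsub>M\<^esub> g z" if yz: "y \<in> carrier N" "z \<in> carrier N" for y z
    proof -
      obtain a b where "a \<in> carrier M" "b \<in> carrier M" "y = f a" "z = f b"
        using surjE yz by meson
      then show ?thesis
        using gf by (simp flip: module_hom_add[OF f])
    qed
    show "g (y \<cdot>\<^bsub>N\<^esub> r) = g y \<cdot>\<^bsub>M\<^esub> r" if yr: "y \<in> carrier N" "r \<in> carrier R" for y r
    proof -
      obtain a where "a \<in> carrier M" "y = f a"
        using surjE yr by meson
      then show ?thesis
        using gf yr(2) by (simp flip: module_hom_smult[OF f])
    qed
  qed
qed

lemma (in right_module_over) submodule_is_right_module:
  assumes N: "submodule_of R M N" shows "is_right_module R (M\<lparr>carrier := N\<rparr>)"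
proof -
  note c = submodule_carrier[OF N]
  have "abelian_group (M\<lparr>carrier := N\<rparr>)"
  proof (rule abelian_groupI; simp add: c M.a_assoc)
    show "x \<oplus>\<^bsub>M\<^esub> y \<in> N" if "x \<in> N" "y \<in> N" for x y
      using N that by (rule submodule_add)
    show "\<zero>\<^bsub>M\<^esub> \<in> N"
      using N by (rule submodule_zero)
    show "x \<oplus>\<^bsub>M\<^esub> y = y \<oplus>\<^bsub>M\<^esub> x" if "x \<in> N" "y \<in> N" for x y
      using that c by (simp add: M.a_comm)
    show "\<exists>y\<in>N. y \<oplus>\<^bsub>M\<^esub> x = \<zero>\<^bsub>M\<^esub>" if "x \<in> N" for x
      using submodule_neg[OF N that] M.l_neg[OF c[OF that]] by blast
  qed
  then show ?thesis
    unfolding is_right_module_def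
    using R.ring_axioms submodule_smult[OF N] c
    by (simp add: smult_add_left smult_add_right smult_assoc)
qed

lemma submodule_inclusion_hom:
  assumes "is_right_module R M" and N: "submodule_of R M N"
  shows "(\<lambda>x\<in>N. x) \<in> module_hom R (M\<lparr>carrier := N\<rparr>) M"
proof -
  interpret right_module_over R M by unfold_locales fact
  show ?thesis
    by (rule module_homI)
      (auto simp: submodule_carrier[OF N] submodule_add[OF N] submodule_smult[OF N])
qed

lemma carrier_End_ring [simp]: "carrier (End_ring R M) = module_hom R M M"
  by (simp add: End_ring_def)

lemma mult_End_ring [simp]: "f \<otimes>\<^bsub>End_ring R M\<^esub> g = compose (carrier M) f g"
  by (simp add: End_ring_def)

section \<open>Summands and both Baer conditions in terms of projections\<close>

context right_module_over
begin

text \<open>This replaces the complement, a subset, by an endomorphism, the first step towards a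
  condition on morphisms. One direction takes the component in \<open>N\<close>, well defined since
  the sum is direct; in the other the complement is the kernel of \<open>e\<close>.\<close>

lemma direct_summand_iff_projection:
  "direct_summand R M N \<longleftrightarrow> submodule_of R M N \<and>
    (\<exists>e\<in>module_hom R M M. (\<forall>x\<in>carrier M. e x \<in> N) \<and> (\<forall>x\<in>N. e x = x))"
proof
  assume "direct_summand R M N"
  then obtain K where N: "submodule_of R M N" and K: "submodule_of R M K"
    and NK: "N \<inter> K = {\<zero>\<^bsub>M\<^esub>}" "N <+>\<^bsub>M\<^esub> K = carrier M"
    by (auto simp: direct_summand_def)
  note cN = submodule_carrier[OF N] and cK = submodule_carrier[OF K]
  define e where "e = (\<lambda>x\<in>carrier M. THE n. n \<in> N \<and> (\<exists>k\<in>K. x = n \<oplus>\<^bsub>M\<^esub> k))"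
  have e: "e (n \<oplus>\<^bsub>M\<^esub> k) = n" if nk: "n \<in> N" "k \<in> K" for n k
  proof -
    have "n' = n" if n': "n' \<in> N" "k' \<in> K" "n \<oplus>\<^bsub>M\<^esub> k = n' \<oplus>\<^bsub>M\<^esub> k'" for n' k'
    proof -
      have "(n \<ominus>\<^bsub>M\<^esub> n') \<oplus>\<^bsub>M\<^esub> (k \<ominus>\<^bsub>M\<^esub> k') = (n \<oplus>\<^bsub>M\<^esub> k) \<oplus>\<^bsub>M\<^esub> \<ominus>\<^bsub>M\<^esub> (n' \<oplus>\<^bsub>M\<^esub> k')"
        using cN[OF nk(1)] cK[OF nk(2)] cN[OF n'(1)] cK[OF n'(2)]
        by (simp add: a_minus_def M.minus_add M.add.m_ac)
      also have "\<dots> = \<zero>\<^bsub>M\<^esub>"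
        unfolding n'(3) using cN[OF n'(1)] cK[OF n'(2)] by (simp add: M.r_neg)
      finally have "n \<ominus>\<^bsub>M\<^esub> n' = \<zero>\<^bsub>M\<^esub>"
        by (rule zero_of_disjoint_sum(1)[OF N K NK(1) submodule_minus[OF N nk(1) n'(1)]
              submodule_minus[OF K nk(2) n'(2)]])
      then show ?thesis
        using cN[OF nk(1)] cN[OF n'(1)] M.minus_equality[of n "\<ominus>\<^bsub>M\<^esub> n'"]
        by (simp add: a_minus_def)
    qed
    then have "(THE m. m \<in> N \<and> (\<exists>l\<in>K. n \<oplus>\<^bsub>M\<^esub> k = m \<oplus>\<^bsub>M\<^esub> l)) = n"
      using nk by (intro the_equality) blast+
    then show ?thesis
      using nk cN cK by (simp add: e_def)
  qed
  have dec: "\<exists>n\<in>N. \<exists>k\<in>K. x = n \<oplus>\<^bsub>M\<^esub> k" if "x \<in> carrier M" for x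
    using that mem_set_add[of x N K] unfolding NK(2) by blast
  have eN: "e x \<in> N" if "x \<in> carrier M" for x
    using dec[OF that] e by auto
  have "e \<in> module_hom R M M"
  proof (rule module_homI)
    show "e \<in> carrier M \<rightarrow>\<^sub>E carrier M"
      using eN cN by (auto simp: e_def)
    fix x assume x: "x \<in> carrier M"
    then obtain n k where nk: "n \<in> N" "k \<in> K" "x = n \<oplus>\<^bsub>M\<^esub> k"
      using dec by blast
    show "e (x \<oplus>\<^bsub>M\<^esub> y) = e x \<oplus>\<^bsub>M\<^esub> e y" if y: "y \<in> carrier M" for y
    proof -
      obtain n' k' where nk': "n' \<in> N" "k' \<in> K" "y = n' \<oplus>\<^bsub>M\<^esub> k'"
        using dec[OF y] by blast
      then have "x \<oplus>\<^bsub>M\<^esub> y = (n \<oplus>\<^bsub>M\<^esub> n') \<oplus>\<^bsub>M\<^esub> (k \<oplus>\<^bsub>M\<^esub> k')"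
        using nk cN cK by (simp add: M.add.m_ac)
      then show ?thesis
        using nk nk' by (simp add: e submodule_add[OF N] submodule_add[OF K])
    qed
    show "e (x \<cdot>\<^bsub>M\<^esub> r) = e x \<cdot>\<^bsub>M\<^esub> r" if r: "r \<in> carrier R" for r
    proof -
      have "x \<cdot>\<^bsub>M\<^esub> r = n \<cdot>\<^bsub>M\<^esub> r \<oplus>\<^bsub>M\<^esub> k \<cdot>\<^bsub>M\<^esub> r"
        using nk cN cK r by (simp add: smult_add_left)
      then show ?thesis
        using nk r by (simp add: e submodule_smult[OF N] submodule_smult[OF K])
    qed
  qed
  moreover have "e x = x" if "x \<in> N" for x
    using e[OF that submodule_zero[OF K]] cN that by simp
  ultimately show "submodule_of R M N \<and>
      (\<exists>e\<in>module_hom R M M. (\<forall>x\<in>carrier M. e x \<in> N) \<and> (\<forall>x\<in>N. e x = x))"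
    using N eN by blast
next
  assume "submodule_of R M N \<and>
    (\<exists>e\<in>module_hom R M M. (\<forall>x\<in>carrier M. e x \<in> N) \<and> (\<forall>x\<in>N. e x = x))"
  then obtain e where N: "submodule_of R M N" and e: "e \<in> module_hom R M M"
    and eN: "\<And>x. x \<in> carrier M \<Longrightarrow> e x \<in> N" and e_id: "\<And>x. x \<in> N \<Longrightarrow> e x = x"
    by blast
  note cN = submodule_carrier[OF N]
  define K where "K = hom_kernel M M e"
  have K: "submodule_of R M K"
    unfolding K_def using right_module right_module e by (rule hom_kernel_submodule)
  have "N \<inter> K = {\<zero>\<^bsub>M\<^esub>}"
  proof
    show "N \<inter> K \<subseteq> {\<zero>\<^bsub>M\<^esub>}"
      using e_id by (auto simp: K_def hom_kernel_def)
  qed (use submodule_zero[OF N] submodule_zero[OF K] in auto)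
  moreover have "N <+>\<^bsub>M\<^esub> K = carrier M"
  proof
    show "N <+>\<^bsub>M\<^esub> K \<subseteq> carrier M"
      by (rule submodule_subset[OF submodule_set_add[OF N K]])
    show "carrier M \<subseteq> N <+>\<^bsub>M\<^esub> K"
    proof
      fix x assume x: "x \<in> carrier M"
      have ex: "e x \<in> N" "e x \<in> carrier M"
        using eN[OF x] cN by auto
      define k where "k = \<ominus>\<^bsub>M\<^esub> e x \<oplus>\<^bsub>M\<^esub> x"
      have k: "k \<in> carrier M" "x = e x \<oplus>\<^bsub>M\<^esub> k"
        unfolding k_def using x ex(2) by (simp_all add: M.r_neg2)
      have "e x = e (e x) \<oplus>\<^bsub>M\<^esub> e k"
        using k module_hom_add[OF e ex(2) k(1)] by simp
      then have "e k = \<zero>\<^bsub>M\<^esub>"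
        using e_id[OF ex(1)] ex(2) module_hom_closed[OF e k(1)] M.add.l_cancel_one'[of "e x" "e k"] by simp
      then have "k \<in> K"
        using k(1) by (simp add: K_def hom_kernel_def)
      then show "x \<in> N <+>\<^bsub>M\<^esub> K"
        using k(2) ex(1) mem_set_add[of x N K] by blast
    qed
  qed
  ultimately show "direct_summand R M N"
    using N K by (auto simp: direct_summand_def)
qed

lemma baer_iff_projection:
  "baer_module R M \<longleftrightarrow> (\<forall>X. X \<subseteq> module_hom R M M \<longrightarrow> X \<noteq> {} \<longrightarrow>
    (\<exists>e\<in>module_hom R M M. (\<forall>f\<in>X. \<forall>x\<in>carrier M. f (e x) = \<zero>\<^bsub>M\<^esub>) \<and>
      (\<forall>x\<in>carrier M. (\<forall>f\<in>X. f x = \<zero>\<^bsub>M\<^esub>) \<longrightarrow> e x = x)))"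
proof -
  have "direct_summand R M (\<Inter>f\<in>X. hom_kernel M M f) \<longleftrightarrow>
    (\<exists>e\<in>module_hom R M M. (\<forall>f\<in>X. \<forall>x\<in>carrier M. f (e x) = \<zero>\<^bsub>M\<^esub>) \<and>
      (\<forall>x\<in>carrier M. (\<forall>f\<in>X. f x = \<zero>\<^bsub>M\<^esub>) \<longrightarrow> e x = x))"
    if X: "X \<subseteq> module_hom R M M" "X \<noteq> {}" for X
  proof -
    have "submodule_of R M (\<Inter>f\<in>X. hom_kernel M M f)"
      using X hom_kernel_submodule[OF right_module right_module] by (intro submodule_Inter) auto
    moreover have "(\<Inter>f\<in>X. hom_kernel M M f) = {x \<in> carrier M. \<forall>f\<in>X. f x = \<zero>\<^bsub>M\<^esub>}"
      using X(2) by (auto simp: hom_kernel_def)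
    moreover have "((\<forall>x\<in>carrier M. e x \<in> {x \<in> carrier M. \<forall>f\<in>X. f x = \<zero>\<^bsub>M\<^esub>}) \<and>
        (\<forall>x\<in>{x \<in> carrier M. \<forall>f\<in>X. f x = \<zero>\<^bsub>M\<^esub>}. e x = x)) \<longleftrightarrow>
        (\<forall>f\<in>X. \<forall>x\<in>carrier M. f (e x) = \<zero>\<^bsub>M\<^esub>) \<and>
        (\<forall>x\<in>carrier M. (\<forall>f\<in>X. f x = \<zero>\<^bsub>M\<^esub>) \<longrightarrow> e x = x)"
      if "e \<in> module_hom R M M" for e
      using module_hom_closed[OF that] by blast
    ultimately show ?thesis
      unfolding direct_summand_iff_projection by (simp cong: bex_cong)
  qed
  then show ?thesis
    unfolding baer_module_def carrier_End_ring by auto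
qed

text \<open>A map \<open>f\<close> lies in \<open>e S\<close> exactly if \<open>e f = f\<close>,
  provided that \<open>e\<close> is idempotent. On the right-hand side idempotency is the instance
  \<open>f = e\<close>, because \<open>e\<close> itself maps into \<open>N\<close>.\<close>

lemma dual_baer_iff_projection:
  "dual_baer_module R M \<longleftrightarrow> (\<forall>N. submodule_of R M N \<longrightarrow>
    (\<exists>e\<in>module_hom R M M. (\<forall>x\<in>carrier M. e x \<in> N) \<and>
      (\<forall>f\<in>module_hom R M M. (\<forall>x\<in>carrier M. f x \<in> N) \<longrightarrow> (\<forall>x\<in>carrier M. e (f x) = f x))))"
  (is "_ \<longleftrightarrow> (\<forall>N. _ \<longrightarrow> (\<exists>e\<in>_. ?P N e))")
proof -
  have "e \<otimes>\<^bsub>End_ring R M\<^esub> e = e \<and> {f \<in> carrier (End_ring R M). f ` carrier M \<subseteq> N} =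
      e <#\<^bsub>End_ring R M\<^esub> carrier (End_ring R M) \<longleftrightarrow> ?P N e" (is "?l \<longleftrightarrow> _")
    if e: "e \<in> module_hom R M M" and N: "submodule_of R M N" for e N
  proof
    assume l: ?l
    then have idem: "e (e x) = e x" if "x \<in> carrier M" for x
      using that by (metis mult_End_ring compose_eq)
    have coset: "(f \<in> module_hom R M M \<and> f ` carrier M \<subseteq> N) \<longleftrightarrow>
        (\<exists>s\<in>module_hom R M M. f = compose (carrier M) e s)" for f
      using l by (auto simp: l_coset_def set_eq_iff)
    \<comment> \<open>Writing \<open>e\<close> as \<open>e\<close> times the identity puts it into
      its own right ideal, so its image lies in \<open>N\<close>.\<close>
    have "e = compose (carrier M) e (\<lambda>x\<in>carrier M. x)"
      using module_hom_extensional[OF e] by (auto simp: compose_def extensional_def)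
    then have "e ` carrier M \<subseteq> N"
      using coset module_hom_id[OF right_module] by blast
    moreover have "e (f x) = f x"
      if f: "f \<in> module_hom R M M" "\<And>x. x \<in> carrier M \<Longrightarrow> f x \<in> N" and x: "x \<in> carrier M" for f x
    proof -
      obtain s where "s \<in> module_hom R M M" "f = compose (carrier M) e s"
        using coset[of f] f by blast
      then show ?thesis
        using x idem module_hom_closed[of s R M M] by (simp add: compose_eq)
    qed
    ultimately show "?P N e"
      by auto
  next
    assume P: "?P N e"
    have "e \<otimes>\<^bsub>End_ring R M\<^esub> e = e"
      using P e module_hom_extensional[OF e] by (auto simp: compose_def extensional_def)
    moreover have "f \<in> e <#\<^bsub>End_ring R M\<^esub> carrier (End_ring R M)"
      if f: "f \<in> module_hom R M M" "f ` carrier M \<subseteq> N" for f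
    proof -
      have "f = compose (carrier M) e f"
      proof
        fix x
        show "f x = compose (carrier M) e f x"
        proof (cases "x \<in> carrier M")
          case True
          then have "e (f x) = f x"
            using P f by (blast intro: subsetD)
          then show ?thesis
            using True by (simp add: compose_eq)
        qed (use extensional_arb[OF module_hom_extensional[OF f(1)]] in \<open>simp add: compose_def\<close>)
      qed
      then show ?thesis
        using f by (auto simp: l_coset_def)
    qed
    moreover have "f \<in> module_hom R M M \<and> f ` carrier M \<subseteq> N"
      if f: "f \<in> e <#\<^bsub>End_ring R M\<^esub> carrier (End_ring R M)" for f
    proof -
      obtain s where s: "s \<in> module_hom R M M" "f = compose (carrier M) e s"
        using f by (auto simp: l_coset_def)
      then show ?thesis
        using P module_hom_compose[OF right_module s(1) e] module_hom_closed[OF s(1)]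
        by (auto simp: compose_eq)
    qed
    ultimately show ?l
      by auto
  qed
  then show ?thesis
    unfolding dual_baer_module_def by (simp cong: bex_cong)
qed

lemma complemented_imp_baer:
  assumes complemented shows "baer_module R M"
  unfolding baer_module_def carrier_End_ring
proof (intro allI impI)
  fix X assume X: "X \<subseteq> module_hom R M M \<and> X \<noteq> {}"
  then have "submodule_of R M (\<Inter>f\<in>X. hom_kernel M M f)"
    using hom_kernel_submodule[OF right_module right_module] by (intro submodule_Inter) auto
  then show "direct_summand R M (\<Inter>f\<in>X. hom_kernel M M f)"
    using assms by (simp add: complemented_def)
qed

lemma complemented_imp_dual_baer:
  assumes complemented shows "dual_baer_module R M"
  unfolding dual_baer_iff_projection
proof (intro allI impI)
  fix N assume "submodule_of R M N"
  then obtain e where "e \<in> module_hom R M M" "\<forall>x\<in>carrier M. e x \<in> N" "\<forall>x\<in>N. e x = x"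
    using assms direct_summand_iff_projection by (auto simp: complemented_def)
  then show "\<exists>e\<in>module_hom R M M. (\<forall>x\<in>carrier M. e x \<in> N) \<and>
      (\<forall>f\<in>module_hom R M M. (\<forall>x\<in>carrier M. f x \<in> N) \<longrightarrow> (\<forall>x\<in>carrier M. e (f x) = f x))"
    by blast
qed

end

section \<open>Right duo perfect rings\<close>

lemma regular_module_simps [simp]:
  "carrier (regular_module R) = carrier R" "zero (regular_module R) = \<zero>\<^bsub>R\<^esub>"
  "add (regular_module R) = add R" "rsmult (regular_module R) = mult R"
  by (simp_all add: regular_module_def)

lemma regular_is_right_module:
  assumes "ring R" shows "is_right_module R (regular_module R)"
proof -
  interpret ring R by fact
  have "abelian_group (regular_module R)"
    by (rule abelian_groupI) (simp_all add: a_assoc, simp_all add: a_comm add.r_inv_ex)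
  then show ?thesis
    by (auto simp: is_right_module_def ring_axioms l_distr r_distr m_assoc)
qed

text \<open>Through this equivalence right ideals inherit the whole calculus of submodules.\<close>

lemma submodule_regular_iff: "submodule_of R (regular_module R) I \<longleftrightarrow> right_ideal I R"
  by (simp add: submodule_of_def right_ideal_def additive_subgroup_def subgroup_def m_inv_def)

locale right_duo_ring = ring T for T (structure) +
  assumes duo: "right_duo T"
begin

sublocale reg: right_module_over T "regular_module T"
  by unfold_locales (rule regular_is_right_module, rule ring_axioms)

lemmas right_idealI = reg.submoduleI[unfolded submodule_regular_iff regular_module_simps]
lemmas right_ideal_carrier = reg.submodule_carrier[unfolded submodule_regular_iff regular_module_simps]
lemmas right_ideal_add = reg.submodule_add[unfolded submodule_regular_iff regular_module_simps]
lemmas right_ideal_zero = reg.submodule_zero[unfolded submodule_regular_iff regular_module_simps]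
lemmas right_ideal_mult = reg.submodule_smult[unfolded submodule_regular_iff regular_module_simps]
lemmas right_ideal_cyclic = reg.submodule_cyclic[unfolded submodule_regular_iff regular_module_simps]

lemma right_ideal_mult_left:
  assumes "right_ideal I T" "a \<in> I" "r \<in> carrier T" shows "r \<otimes> a \<in> I"
proof -
  interpret ideal I T
    using duo assms(1) by (simp add: right_duo_def)
  show ?thesis
    using assms by (simp add: I_l_closed)
qed

text \<open>The elementwise content of the duo condition: \<open>a T\<close> is a left ideal too,
  hence contains \<open>r a\<close>. It allows a scalar to be moved past \<open>a\<close> at the
  price of changing it.\<close>

lemma mult_swap:
  assumes a: "a \<in> carrier T" and r: "r \<in> carrier T"
  obtains s where "s \<in> carrier T" "r \<otimes> a = a \<otimes> s"
proof -
  have "r \<otimes> a \<in> reg.cyclic a"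
    using right_ideal_mult_left[OF right_ideal_cyclic] reg.cyclic_self a r by simp
  then show thesis
    using that by (auto simp: reg.cyclic_def)
qed

section \<open>Maximal right ideals and comaximality\<close>

lemma one_notin_proper_right_ideal:
  assumes "right_ideal I T" "I \<noteq> carrier T" shows "\<one> \<notin> I"
proof
  assume "\<one> \<in> I"
  then have "r \<in> I" if "r \<in> carrier T" for r
    using right_ideal_mult[OF assms(1), of \<one> r] that by simp
  then show False
    using assms right_ideal_carrier by blast
qed

lemma ex_maximal_right_ideal:
  assumes "right_ideal I T" "\<one> \<notin> I"
  obtains m where "maximal_right_ideal m T" "I \<subseteq> m"
proof -
  have "submodule_of T (regular_module T) I" "I \<inter> {\<one>} = {}"
    using assms by (auto simp: submodule_regular_iff)
  from reg.ex_maximal_submodule_avoiding[OF this] obtain m where m: "right_ideal m T" "I \<subseteq> m" "m \<inter> {\<one>} = {}"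
    and max: "\<forall>Q. right_ideal Q T \<longrightarrow> m \<subset> Q \<longrightarrow> Q \<inter> {\<one>} \<noteq> {}"
    unfolding submodule_regular_iff by blast
  have "K = m \<or> K = carrier T" if K: "right_ideal K T" "m \<subseteq> K" for K
  proof (cases "K = m")
    case False
    then have "\<one> \<in> K"
      using max K by blast
    then show ?thesis
      using one_notin_proper_right_ideal[OF K(1)] by blast
  qed simp
  then have "maximal_right_ideal m T"
    using m by (auto simp: maximal_right_ideal_def)
  then show thesis
    using m(2) by (rule that)
qed

lemma maximal_right_ideal_right_ideal: "maximal_right_ideal m T \<Longrightarrow> right_ideal m T"
  by (simp add: maximal_right_ideal_def)

lemma maximal_right_ideal_one: "maximal_right_ideal m T \<Longrightarrow> \<one> \<notin> m"
  using one_notin_proper_right_ideal by (auto simp: maximal_right_ideal_def)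

lemma maximal_right_ideal_comaximal:
  assumes m: "maximal_right_ideal m T" and K: "right_ideal K T" "\<not> K \<subseteq> m"
  obtains a c where "a \<in> m" "c \<in> K" "a \<oplus> c = \<one>"
proof -
  note mi = maximal_right_ideal_right_ideal[OF m]
  let ?S = "m <+>\<^bsub>regular_module T\<^esub> K"
  have "right_ideal ?S T" "m \<subseteq> ?S" "K \<subseteq> ?S"
    using reg.submodule_set_add[of m K] reg.set_add_upper1[of m K] reg.set_add_upper2[of m K] mi K(1)
    by (simp_all add: submodule_regular_iff)
  then have "?S = carrier T"
    using m K(2) unfolding maximal_right_ideal_def by blast
  then have "\<one> \<in> ?S"
    by simp
  then show thesis
    using that unfolding reg.mem_set_add regular_module_simps by metis
qed

text \<open>Modulo \<open>m\<close> the element \<open>t\<close> has the right inverse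
  \<open>s\<close>, because \<open>m + t T\<close> is all of \<open>T\<close>. It is used to solve
  \<open>z t = w\<close> for \<open>z\<close> modulo multiples by \<open>m\<close>.\<close>

lemma maximal_right_ideal_invertible:
  assumes m: "maximal_right_ideal m T" and t: "t \<in> carrier T" "t \<notin> m"
  obtains a s where "a \<in> m" "s \<in> carrier T" "a \<oplus> t \<otimes> s = \<one>"
proof -
  have "right_ideal (reg.cyclic t) T" "\<not> reg.cyclic t \<subseteq> m"
    using right_ideal_cyclic[OF t(1)] reg.cyclic_self[of t] t by auto
  then obtain a c where "a \<in> m" "c \<in> reg.cyclic t" "a \<oplus> c = \<one>"
    by (rule maximal_right_ideal_comaximal[OF m])
  then show thesis
    using that by (auto simp: reg.cyclic_def)
qed

text \<open>Work modulo \<open>I\<close>, which is two-sided by the duo condition. If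
  \<open>c s\<close> is 1 and \<open>c^k u\<close> is 1, then
  \<open>c^(k+1) (s u) = c^k (c s) u\<close> is 1 again.\<close>

lemma pow_comaximal:
  fixes k :: nat
  assumes I: "right_ideal I T" and c: "c \<in> carrier T" "s \<in> carrier T" "w \<in> I" "c \<otimes> s \<oplus> w = \<one>"
  shows "\<exists>u\<in>carrier T. \<exists>v\<in>I. c [^] k \<otimes> u \<oplus> v = \<one>"
proof (induction k)
  case 0
  show ?case
    using right_ideal_zero[OF I] by (intro bexI[of _ \<one>] bexI[of _ \<zero>]) simp_all
next
  case (Suc k)
  then obtain u v where uv: "u \<in> carrier T" "v \<in> I" "c [^] k \<otimes> u \<oplus> v = \<one>"
    by blast
  have cl: "w \<in> carrier T" "v \<in> carrier T"
    using c uv right_ideal_carrier[OF I] by auto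
  have "c [^] Suc k \<otimes> (s \<otimes> u) \<oplus> (c [^] k \<otimes> (w \<otimes> u) \<oplus> v) = c [^] k \<otimes> ((c \<otimes> s \<oplus> w) \<otimes> u) \<oplus> v"
    using c(1,2) uv(1) cl by (simp add: m_assoc l_distr r_distr a_assoc)
  also have "\<dots> = \<one>"
    using c uv by simp
  finally have "c [^] Suc k \<otimes> (s \<otimes> u) \<oplus> (c [^] k \<otimes> (w \<otimes> u) \<oplus> v) = \<one>" .
  moreover have "c [^] k \<otimes> (w \<otimes> u) \<oplus> v \<in> I"
    using c uv right_ideal_mult[OF I] right_ideal_mult_left[OF I] right_ideal_add[OF I] by simp
  moreover have "s \<otimes> u \<in> carrier T"
    using c uv by simp
  ultimately show ?case
    by blast
qed

text \<open>Lifting of idempotents without a polynomial formula. As \<open>c\<close> and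
  \<open>a\<close> commute, \<open>c^n a^n = 0\<close>, while \<open>c^n T\<close> and
  \<open>a^n T\<close> are still comaximal. Splitting \<open>1 = f + e\<close> along them gives
  \<open>e T f = 0 = f T e\<close> by \<open>mult_swap\<close>, hence an idempotent that is even
  central.\<close>

lemma central_idempotent_of_nilpotent_product:
  fixes n :: nat
  assumes c: "c \<in> carrier T" "a \<in> carrier T" "c \<oplus> a = \<one>" and nil: "(c \<otimes> a) [^] n = \<zero>"
  obtains e f z p where "z \<in> carrier T" "p \<in> carrier T" "e = c [^] n \<otimes> z" "f = a [^] n \<otimes> p"
    "f \<oplus> e = \<one>" "e \<otimes> e = e" "\<forall>x\<in>carrier T. x \<otimes> e = e \<otimes> x"
proof -
  have comm: "c \<otimes> a = a \<otimes> c"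
  proof -
    \<comment> \<open>Both sides equal \<open>a\<close>, since \<open>c + a = 1\<close> may be
      multiplied by \<open>a\<close> from either side.\<close>
    have "c \<otimes> a \<oplus> a \<otimes> a = a \<otimes> c \<oplus> a \<otimes> a"
      using c by (simp flip: l_distr r_distr)
    then show ?thesis
      using c by simp
  qed
  have ca: "c [^] n \<otimes> a [^] n = \<zero>"
    using pow_mult_distrib[OF comm c(1,2), of n] nil by simp
  have ac: "a [^] n \<otimes> c [^] n = \<zero>"
    using pow_mult_distrib[OF comm[symmetric] c(2,1), of n] nil comm by simp
  \<comment> \<open>The powers are raised one after the other: \<open>c\<close> against the ideal
    \<open>a T\<close>, then \<open>a\<close> against the ideal \<open>c^n T\<close>.\<close>
  obtain u v where "u \<in> carrier T" "v \<in> reg.cyclic a" "c [^] n \<otimes> u \<oplus> v = \<one>"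
    using pow_comaximal[OF right_ideal_cyclic[OF c(2)] c(1) one_closed, of a n]
      reg.cyclic_self[of a] c by auto
  then obtain v' where uv: "u \<in> carrier T" "v' \<in> carrier T" "c [^] n \<otimes> u \<oplus> a \<otimes> v' = \<one>"
    by (auto simp: reg.cyclic_def)
  have "c [^] n \<otimes> u \<in> reg.cyclic (c [^] n)"
    using uv by (auto simp: reg.cyclic_def)
  moreover have "a \<otimes> v' \<oplus> c [^] n \<otimes> u = \<one>"
    using uv c by (simp add: a_comm)
  ultimately obtain p q where "p \<in> carrier T" "q \<in> reg.cyclic (c [^] n)" "a [^] n \<otimes> p \<oplus> q = \<one>"
    using pow_comaximal[OF right_ideal_cyclic[OF nat_pow_closed[OF c(1)]] c(2) uv(2)] by metis
  then obtain z where pz: "p \<in> carrier T" "z \<in> carrier T" "a [^] n \<otimes> p \<oplus> c [^] n \<otimes> z = \<one>"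
    by (auto simp: reg.cyclic_def)
  \<comment> \<open>Moving \<open>x\<close> past \<open>d\<close> brings \<open>b\<close> and
    \<open>d\<close> together: \<open>b x d y = b d s y\<close>.\<close>
  have annih: "(b \<otimes> x) \<otimes> (d \<otimes> y) = \<zero>"
    if "b \<otimes> d = \<zero>" and cl: "b \<in> carrier T" "d \<in> carrier T" "x \<in> carrier T" "y \<in> carrier T" for b d x y
  proof -
    obtain s where "s \<in> carrier T" "x \<otimes> d = d \<otimes> s"
      using mult_swap[OF cl(2,3)] .
    then have "(b \<otimes> x) \<otimes> (d \<otimes> y) = (b \<otimes> d) \<otimes> (s \<otimes> y)"
      using cl by (metis m_assoc m_closed)
    then show ?thesis
      using that \<open>s \<in> carrier T\<close> by simp
  qed
  define e where "e = c [^] n \<otimes> z"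
  define f where "f = a [^] n \<otimes> p"
  have ef: "e \<in> carrier T" "f \<in> carrier T" "f \<oplus> e = \<one>"
    using c pz by (simp_all add: e_def f_def)
  \<comment> \<open>The arbitrary \<open>x\<close> in the middle is what yields centrality:
    inserting \<open>1 = f + e\<close> on the free side, both \<open>e x\<close> and
    \<open>x e\<close> become \<open>e x e\<close>.\<close>
  have exf: "e \<otimes> x \<otimes> f = \<zero>" and fxe: "f \<otimes> x \<otimes> e = \<zero>" if "x \<in> carrier T" for x
    using annih[OF ca, of "z \<otimes> x" p] annih[OF ac, of "p \<otimes> x" z] that c pz
    by (simp_all add: e_def f_def m_assoc)
  have "e \<otimes> x = e \<otimes> x \<otimes> e" "x \<otimes> e = e \<otimes> x \<otimes> e" if x: "x \<in> carrier T" for x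
  proof -
    have "e \<otimes> x = e \<otimes> x \<otimes> (f \<oplus> e)"
      using ef x by simp
    also have "\<dots> = e \<otimes> x \<otimes> e"
      using ef(1,2) x exf[OF x] by (simp add: r_distr)
    finally show "e \<otimes> x = e \<otimes> x \<otimes> e" .
    have "x \<otimes> e = (f \<oplus> e) \<otimes> x \<otimes> e"
      using ef x by simp
    also have "\<dots> = e \<otimes> x \<otimes> e"
      using ef(1,2) x fxe[OF x] by (simp add: l_distr)
    finally show "x \<otimes> e = e \<otimes> x \<otimes> e" .
  qed note exe = this
  have "e \<otimes> e = e"
    using exe(1)[of \<one>] ef by simp
  moreover have "x \<otimes> e = e \<otimes> x" if "x \<in> carrier T" for x
    using exe[OF that] by simp
  ultimately show thesis
    using that pz(1,2) e_def f_def ef(3) by metis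
qed

end

section \<open>Perfectness: T-nilpotence as induction, and idempotents for maximal right
  ideals\<close>

locale right_duo_perfect_ring = right_duo_ring +
  assumes perfect: "perfect_ring T"
begin

abbreviation "J \<equiv> jacobson_radical T"

lemma right_ideal_jacobson: "right_ideal J T"
  unfolding jacobson_radical_def
  by (rule right_idealI)
    (use right_ideal_zero right_ideal_add right_ideal_mult maximal_right_ideal_right_ideal
      in \<open>auto\<close>)

lemma jacobson_subset: "maximal_right_ideal m T \<Longrightarrow> J \<subseteq> m"
  by (auto simp: jacobson_radical_def)

text \<open>If \<open>P\<close> can always be kept alive by one more right factor from
  \<open>J\<close>, dependent choice gives a sequence in \<open>J\<close> all of whose partial
  products satisfy \<open>P\<close>, and one of these products is zero. It is applied to a
  \<open>P\<close> of the form "\<open>x t\<close> is nonzero", which fails at zero, so some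
  \<open>t\<close> admits no further factor.\<close>

lemma left_T_nilpotent_induct:
  assumes "P \<one>" "\<And>t. \<lbrakk>t \<in> carrier T; P t\<rbrakk> \<Longrightarrow> \<exists>j\<in>J. P (t \<otimes> j)"
  shows "P \<zero>"
proof -
  note J = right_ideal_carrier[OF right_ideal_jacobson]
  \<comment> \<open>The choice principle leaves the start of the sequence open; the clause for
    \<open>n = 0\<close> pins it to the unit.\<close>
  have "\<exists>t. \<forall>n. (t n \<in> carrier T \<and> P (t n) \<and> (n = 0 \<longrightarrow> t n = \<one>)) \<and> (\<exists>j\<in>J. t (Suc n) = t n \<otimes> j)"
  proof (rule dependent_nat_choice)
    fix t and n :: nat
    assume "t \<in> carrier T \<and> P t \<and> (n = 0 \<longrightarrow> t = \<one>)"
    then obtain j where "j \<in> J" "P (t \<otimes> j)" "t \<in> carrier T"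
      using assms(2) by blast
    then show "\<exists>t'. (t' \<in> carrier T \<and> P t' \<and> (Suc n = 0 \<longrightarrow> t' = \<one>)) \<and> (\<exists>j\<in>J. t' = t \<otimes> j)"
      using J by (intro exI[of _ "t \<otimes> j"]) auto
  qed (use assms(1) in auto)
  then obtain t where t: "\<And>n. t n \<in> carrier T" "\<And>n. P (t n)" "t 0 = \<one>"
    and "\<And>n. \<exists>j\<in>J. t (Suc n) = t n \<otimes> j"
    by metis
  then obtain j where j: "\<And>n. j n \<in> J" "\<And>n. t (Suc n) = t n \<otimes> j n"
    by metis
  \<comment> \<open>\<open>list_prod\<close> folds from the right, so attaching a factor at the
    right end needs an induction of its own.\<close>
  have prod_append: "list_prod T (xs @ [x]) = list_prod T xs \<otimes> x"
    if "set xs \<subseteq> carrier T" "x \<in> carrier T" for xs x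
  proof -
    have "list_prod T ys \<in> carrier T" if "set ys \<subseteq> carrier T" for ys
      using that by (induction ys) (auto simp: list_prod_def)
    then show ?thesis
      using that by (induction xs) (auto simp: list_prod_def m_assoc)
  qed
  have "list_prod T (map j [0..<n]) = t n" for n
  proof (induction n)
    case (Suc n)
    have "set (map j [0..<n]) \<subseteq> carrier T" "j n \<in> carrier T"
      using j(1) J by auto
    then show ?case
      using prod_append[of "map j [0..<n]" "j n"] Suc j(2) by simp
  qed (simp add: list_prod_def t)
  moreover obtain n where "list_prod T (map j [0..<Suc n]) = \<zero>"
    using perfect j(1) unfolding perfect_ring_def left_perfect_def left_T_nilpotent_def by blast
  ultimately show ?thesis
    using t(2)[of "Suc n"] by metis
qed

text \<open>The mirror image, with new factors on the left. Such factors arise when in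
  \<open>x t\<close> the element \<open>x\<close> is itself expanded into multiples
  \<open>x' s\<close>, giving \<open>x' (s t)\<close>.\<close>

lemma right_T_nilpotent_induct:
  assumes "P \<one>" "\<And>t. \<lbrakk>t \<in> carrier T; P t\<rbrakk> \<Longrightarrow> \<exists>j\<in>J. P (j \<otimes> t)"
  shows "P \<zero>"
proof -
  note J = right_ideal_carrier[OF right_ideal_jacobson]
  have "\<exists>t. \<forall>n. (t n \<in> carrier T \<and> P (t n) \<and> (n = 0 \<longrightarrow> t n = \<one>)) \<and> (\<exists>j\<in>J. t (Suc n) = j \<otimes> t n)"
  proof (rule dependent_nat_choice)
    fix t and n :: nat
    assume "t \<in> carrier T \<and> P t \<and> (n = 0 \<longrightarrow> t = \<one>)"
    then obtain j where "j \<in> J" "P (j \<otimes> t)" "t \<in> carrier T"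
      using assms(2) by blast
    then show "\<exists>t'. (t' \<in> carrier T \<and> P t' \<and> (Suc n = 0 \<longrightarrow> t' = \<one>)) \<and> (\<exists>j\<in>J. t' = j \<otimes> t)"
      using J by (intro exI[of _ "j \<otimes> t"]) auto
  qed (use assms(1) in auto)
  then obtain t where t: "\<And>n. t n \<in> carrier T" "\<And>n. P (t n)" "t 0 = \<one>"
    and "\<And>n. \<exists>j\<in>J. t (Suc n) = j \<otimes> t n"
    by metis
  then obtain j where j: "\<And>n. j n \<in> J" "\<And>n. t (Suc n) = j n \<otimes> t n"
    by metis
  \<comment> \<open>Reversal puts the newest index at the head of the list, so the product grows
    directly along the fold.\<close>
  have "list_prod T (map j (rev [0..<n])) = t n" for n
    by (induction n) (simp_all add: list_prod_def t(3) j(2))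
  moreover obtain n where "list_prod T (map j (rev [0..<Suc n])) = \<zero>"
    using perfect j(1) unfolding perfect_ring_def right_perfect_def right_T_nilpotent_def by blast
  ultimately show ?thesis
    using t(2)[of "Suc n"] by metis
qed

text \<open>T-nilpotence applied to a constant sequence.\<close>

lemma jacobson_nil:
  assumes "x \<in> J" obtains n where "x [^] Suc n = \<zero>"
proof -
  have x: "x \<in> carrier T"
    using right_ideal_carrier[OF right_ideal_jacobson assms] .
  have "list_prod T (map (\<lambda>_. x) (rev [0..<n])) = x [^] n" for n
    using x by (induction n) (simp_all add: list_prod_def nat_pow_Suc2[symmetric] del: nat_pow_Suc)
  moreover obtain n where "list_prod T (map (\<lambda>_. x) (rev [0..<Suc n])) = \<zero>"
    using perfect assms unfolding perfect_ring_def right_perfect_def right_T_nilpotent_def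
    by (metis (no_types, lifting) image_subset_iff)
  ultimately show thesis
    using that by metis
qed

text \<open>\<open>T/J\<close> is the sum of its simple right ideals, so the proper right ideal
  \<open>m/J\<close> misses one of them, \<open>A\<close>. By simplicity \<open>A\<close> meets
  \<open>m/J\<close> in zero, and \<open>K\<close> is the preimage of \<open>A\<close>.\<close>

lemma maximal_right_ideal_complement:
  assumes m: "maximal_right_ideal m T"
  obtains K where "right_ideal K T" "\<not> K \<subseteq> m" "K \<inter> m \<subseteq> J"
proof -
  note mi = maximal_right_ideal_right_ideal[OF m]
  interpret J: ideal J T
    using duo right_ideal_jacobson by (simp add: right_duo_def)
  define \<pi> where "\<pi> = (+>) J"
  interpret \<pi>: ring_hom_ring T "T Quot J" \<pi>
    unfolding \<pi>_def by (rule J.rcos_ring_hom_ring)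
  let ?Q = "regular_module (T Quot J)"
  interpret Q: right_module_over "T Quot J" ?Q
    by unfold_locales (rule regular_is_right_module, rule J.quotient_is_ring)
  have surj: "\<exists>t\<in>carrier T. y = \<pi> t" if "y \<in> carrier (T Quot J)" for y
    using that by (auto simp: FactRing_def A_RCOSETS_def' \<pi>_def)
  have \<pi>_zero: "\<pi> t = \<zero>\<^bsub>T Quot J\<^esub> \<longleftrightarrow> t \<in> J" if "t \<in> carrier T" for t
    using that J.rcos_const_imp_mem[of t] J.a_rcos_const[of t] by (auto simp: \<pi>_def FactRing_def)
  \<comment> \<open>Since \<open>J\<close> is contained in \<open>m\<close>, membership in
    \<open>m\<close> can be tested in the quotient.\<close>
  have mem_m: "t \<in> m" if t: "\<pi> t \<in> \<pi> ` m" "t \<in> carrier T" for t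
  proof -
    obtain x where x: "x \<in> m" "\<pi> t = \<pi> x"
      using t by blast
    note xc = right_ideal_carrier[OF mi x(1)]
    have "\<pi> (t \<oplus> \<ominus> x) = \<zero>\<^bsub>T Quot J\<^esub>"
      using t xc x(2) by (simp add: \<pi>.S.r_neg)
    then have "t \<oplus> \<ominus> x \<in> m"
      using \<pi>_zero[of "t \<oplus> \<ominus> x"] t(2) xc jacobson_subset[OF m] by auto
    then have "(t \<oplus> \<ominus> x) \<oplus> x \<in> m"
      using x(1) by (rule right_ideal_add[OF mi])
    then show ?thesis
      using t xc by (simp add: a_assoc l_neg)
  qed
  have Qm: "submodule_of (T Quot J) ?Q (\<pi> ` m)"
  proof (rule Q.submoduleI)
    show "\<pi> ` m \<subseteq> carrier ?Q"
      using right_ideal_carrier[OF mi] by auto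
    show "\<zero>\<^bsub>?Q\<^esub> \<in> \<pi> ` m"
      using right_ideal_zero[OF mi] \<pi>.hom_zero by (metis image_eqI regular_module_simps(2))
    show "x \<oplus>\<^bsub>?Q\<^esub> y \<in> \<pi> ` m" if "x \<in> \<pi> ` m" "y \<in> \<pi> ` m" for x y
      using that right_ideal_add[OF mi] right_ideal_carrier[OF mi] by (auto simp flip: \<pi>.hom_add)
    show "x \<cdot>\<^bsub>?Q\<^esub> r \<in> \<pi> ` m" if "x \<in> \<pi> ` m" and r: "r \<in> carrier (T Quot J)" for x r
    proof -
      obtain s where "s \<in> carrier T" "r = \<pi> s"
        using surj[OF r] by blast
      then show ?thesis
        using that right_ideal_mult[OF mi] right_ideal_carrier[OF mi] by (auto simp flip: \<pi>.hom_mult)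
    qed
  qed
  have "\<pi> \<one> \<notin> \<pi> ` m"
    using mem_m[of \<one>] maximal_right_ideal_one[OF m] by auto
  moreover have "submodule_span (T Quot J) ?Q (\<Union>{N. simple_submodule (T Quot J) ?Q N}) = carrier ?Q"
    using perfect by (simp add: perfect_ring_def left_perfect_def semisimple_ring_def semisimple_module_def)
  ultimately have "\<not> \<Union>{N. simple_submodule (T Quot J) ?Q N} \<subseteq> \<pi> ` m"
    using Q.submodule_span_least[OF Qm] \<pi>.hom_closed[of \<one>] by auto
  then obtain A where A: "simple_submodule (T Quot J) ?Q A" "\<not> A \<subseteq> \<pi> ` m"
    by blast
  then have sA: "submodule_of (T Quot J) ?Q A"
    and min: "\<And>K. \<lbrakk>submodule_of (T Quot J) ?Q K; K \<subseteq> A\<rbrakk> \<Longrightarrow> K = {\<zero>\<^bsub>?Q\<^esub>} \<or> K = A"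
    by (auto simp: simple_submodule_def)
  define K where "K = {t \<in> carrier T. \<pi> t \<in> A}"
  have "right_ideal K T"
  proof (rule right_idealI)
    show "\<zero> \<in> K"
      using Q.submodule_zero[OF sA] by (simp add: K_def)
    show "x \<oplus> y \<in> K" if "x \<in> K" "y \<in> K" for x y
      using that Q.submodule_add[OF sA, of "\<pi> x" "\<pi> y"] by (simp add: K_def)
    show "x \<otimes> r \<in> K" if "x \<in> K" "r \<in> carrier T" for x r
      using that Q.submodule_smult[OF sA, of "\<pi> x" "\<pi> r"] by (simp add: K_def)
  qed (auto simp: K_def)
  moreover have "\<not> K \<subseteq> m"
  proof -
    obtain y where y: "y \<in> A" "y \<notin> \<pi> ` m"
      using A(2) by blast
    then obtain t where "t \<in> carrier T" "y = \<pi> t"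
      using surj Q.submodule_carrier[OF sA] by auto
    then show ?thesis
      using y by (auto simp: K_def)
  qed
  moreover have "K \<inter> m \<subseteq> J"
  proof
    fix t assume t: "t \<in> K \<inter> m"
    have "A \<inter> \<pi> ` m = {\<zero>\<^bsub>?Q\<^esub>}"
      using min[OF Q.submodule_Int[OF sA Qm]] A(2) by blast
    then have "\<pi> t = \<zero>\<^bsub>?Q\<^esub>"
      using t by (auto simp: K_def)
    then show "t \<in> J"
      using \<pi>_zero[of t] t by (simp add: K_def)
  qed
  ultimately show thesis
    by (rule that)
qed

text \<open>Write \<open>1 = a + c\<close> with \<open>a\<close> in \<open>m\<close> and
  \<open>c\<close> in \<open>K\<close>. The product \<open>c a\<close> lies in \<open>K\<close> and
  in \<open>m\<close>, hence in \<open>J\<close>, and is nilpotent. The resulting \<open>e\<close>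
  lies in \<open>c T\<close>, hence in \<open>K\<close>, so \<open>e m\<close> is contained in both
  \<open>K\<close> and \<open>m\<close>, hence in \<open>J\<close>.\<close>

lemma maximal_right_ideal_idempotent:
  assumes m: "maximal_right_ideal m T"
  obtains e f where "e \<in> carrier T" "f \<in> m" "f \<oplus> e = \<one>" "e \<otimes> e = e"
    "\<forall>x\<in>carrier T. x \<otimes> e = e \<otimes> x" "\<forall>x\<in>m. e \<otimes> x \<in> J"
proof -
  note mi = maximal_right_ideal_right_ideal[OF m]
  obtain K where K: "right_ideal K T" "\<not> K \<subseteq> m" "K \<inter> m \<subseteq> J"
    using maximal_right_ideal_complement[OF m] .
  obtain a c where ac: "a \<in> m" "c \<in> K" "a \<oplus> c = \<one>"
    using maximal_right_ideal_comaximal[OF m K(1,2)] .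
  have cl: "a \<in> carrier T" "c \<in> carrier T"
    using ac right_ideal_carrier[OF mi] right_ideal_carrier[OF K(1)] by auto
  have "c \<otimes> a \<in> J"
    using K(3) right_ideal_mult[OF K(1) ac(2)] right_ideal_mult_left[OF mi ac(1)] cl by blast
  then obtain n where n: "(c \<otimes> a) [^] Suc n = \<zero>"
    by (rule jacobson_nil)
  have "c \<oplus> a = \<one>"
    using ac cl by (simp add: a_comm)
  then obtain e f z p where zp: "z \<in> carrier T" "p \<in> carrier T" "e = c [^] Suc n \<otimes> z" "f = a [^] Suc n \<otimes> p"
    and ef: "f \<oplus> e = \<one>" "e \<otimes> e = e" "\<forall>x\<in>carrier T. x \<otimes> e = e \<otimes> x"
    by (rule central_idempotent_of_nilpotent_product[OF cl(2,1) _ n])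
  \<comment> \<open>The exponent is a successor, so at least one factor \<open>a\<close>,
    respectively \<open>c\<close>, can be split off; this places \<open>f\<close> in
    \<open>m\<close> and \<open>e\<close> in \<open>K\<close>.\<close>
  have f: "f = a \<otimes> (a [^] n \<otimes> p)" and e: "e = c \<otimes> (c [^] n \<otimes> z)"
    using zp cl by (simp_all only: nat_pow_Suc2 m_assoc nat_pow_closed)
  show thesis
  proof (rule that[of e f])
    show "f \<in> m"
      using f right_ideal_mult[OF mi ac(1)] zp cl by simp
    have eK: "e \<in> K"
      using e right_ideal_mult[OF K(1) ac(2)] zp cl by simp
    then show "e \<in> carrier T"
      using right_ideal_carrier[OF K(1)] by blast
    then show "\<forall>x\<in>m. e \<otimes> x \<in> J"
      using K(3) right_ideal_mult[OF K(1) eK] right_ideal_mult_left[OF mi]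
        right_ideal_carrier[OF mi] by (simp add: subset_iff)
  qed (use ef in auto)
qed

end

section \<open>Modules over right duo perfect rings\<close>

locale right_duo_perfect_module = right_duo_perfect_ring T + right_module_over T M
  for T :: "('t, 'y) ring_scheme" (structure) and M :: "('m, 't) right_module"
begin

text \<open>The submodule usually written \<open>M I\<close>. Defined as a span, it is handled
  without finite sums.\<close>

definition mult_span :: "'t set \<Rightarrow> 'm set" where
  "mult_span I = submodule_span T M {x \<cdot>\<^bsub>M\<^esub> s | x s. x \<in> carrier M \<and> s \<in> I}"

lemma submodule_mult_span: "I \<subseteq> carrier T \<Longrightarrow> submodule_of T M (mult_span I)"
  unfolding mult_span_def by (rule submodule_span_submodule) (clarsimp simp: subset_iff)

lemma mult_span_upper: "\<lbrakk>x \<in> carrier M; s \<in> I\<rbrakk> \<Longrightarrow> x \<cdot>\<^bsub>M\<^esub> s \<in> mult_span I"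
  unfolding mult_span_def by (rule subsetD[OF submodule_span_upper]) blast

lemma mult_span_least:
  assumes "submodule_of T M N" "\<And>x s. \<lbrakk>x \<in> carrier M; s \<in> I\<rbrakk> \<Longrightarrow> x \<cdot>\<^bsub>M\<^esub> s \<in> N"
  shows "mult_span I \<subseteq> N"
  unfolding mult_span_def using assms by (intro submodule_span_least) auto

lemma mult_span_mono: "I \<subseteq> K \<Longrightarrow> mult_span I \<subseteq> mult_span K"
  unfolding mult_span_def submodule_span_def by blast

text \<open>Closure under scalars uses that \<open>T\<close> is right duo: \<open>r t\<close> is a right multiple of \<open>t\<close>.\<close>

lemma submodule_annihilator:
  assumes t: "t \<in> carrier T"
  shows "submodule_of T M {x \<in> carrier M. x \<cdot>\<^bsub>M\<^esub> t = \<zero>\<^bsub>M\<^esub>}"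
proof (rule submoduleI)
  fix x r assume x: "x \<in> {x \<in> carrier M. x \<cdot>\<^bsub>M\<^esub> t = \<zero>\<^bsub>M\<^esub>}" and r: "r \<in> carrier T"
  obtain s where s: "s \<in> carrier T" "r \<otimes> t = t \<otimes> s"
    using mult_swap[OF t r] .
  have "x \<in> carrier M"
    using x by simp
  then have "(x \<cdot>\<^bsub>M\<^esub> r) \<cdot>\<^bsub>M\<^esub> t = (x \<cdot>\<^bsub>M\<^esub> t) \<cdot>\<^bsub>M\<^esub> s"
    using r t s by (simp add: smult_assoc)
  then show "x \<cdot>\<^bsub>M\<^esub> r \<in> {x \<in> carrier M. x \<cdot>\<^bsub>M\<^esub> t = \<zero>\<^bsub>M\<^esub>}"
    using x r s by simp
qed (use t in \<open>auto simp: smult_add_left\<close>)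

text \<open>If \<open>x\<close> is a sum of terms \<open>x' s\<close> and \<open>x t\<close> is
  nonzero, then some \<open>x' s t\<close> is nonzero. The sum itself is never written down:
  otherwise the annihilator of \<open>t\<close>, a submodule, would contain every generator of
  \<open>M I\<close> and with them \<open>x\<close>. This supplies the new left factor for
  \<open>right_T_nilpotent_induct\<close>.\<close>

lemma ex_mult_not_in_annihilator:
  assumes "x \<in> mult_span I" "t \<in> carrier T" "x \<cdot>\<^bsub>M\<^esub> t \<noteq> \<zero>\<^bsub>M\<^esub>" "I \<subseteq> carrier T"
  obtains x' s where "x' \<in> carrier M" "s \<in> I" "x' \<cdot>\<^bsub>M\<^esub> (s \<otimes> t) \<noteq> \<zero>\<^bsub>M\<^esub>"
proof -
  have "\<exists>x'\<in>carrier M. \<exists>s\<in>I. x' \<cdot>\<^bsub>M\<^esub> (s \<otimes> t) \<noteq> \<zero>\<^bsub>M\<^esub>"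
  proof (rule ccontr)
    assume "\<not> ?thesis"
    then have "mult_span I \<subseteq> {x \<in> carrier M. x \<cdot>\<^bsub>M\<^esub> t = \<zero>\<^bsub>M\<^esub>}"
      using assms(2,4)
      by (intro mult_span_least[OF submodule_annihilator[OF assms(2)]])
        (simp add: smult_assoc subset_iff)
    then show False
      using assms(1,3) by blast
  qed
  then show thesis
    using that by blast
qed

text \<open>The socle consists of the elements killed by \<open>J\<close>, so this says that it is
  essential. If every nonzero multiple of \<open>x\<close> survived some further factor from
  \<open>J\<close>, left T-nilpotence would be contradicted.\<close>

lemma ex_socle_multiple:
  assumes x: "x \<in> carrier M" "x \<noteq> \<zero>\<^bsub>M\<^esub>"
  obtains t where "t \<in> carrier T" "x \<cdot>\<^bsub>M\<^esub> t \<noteq> \<zero>\<^bsub>M\<^esub>" "\<forall>j\<in>J. (x \<cdot>\<^bsub>M\<^esub> t) \<cdot>\<^bsub>M\<^esub> j = \<zero>\<^bsub>M\<^esub>"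
proof (rule ccontr)
  assume "\<not> thesis"
  then have *: "\<exists>j\<in>J. (x \<cdot>\<^bsub>M\<^esub> t) \<cdot>\<^bsub>M\<^esub> j \<noteq> \<zero>\<^bsub>M\<^esub>" if "t \<in> carrier T" "x \<cdot>\<^bsub>M\<^esub> t \<noteq> \<zero>\<^bsub>M\<^esub>" for t
    using that \<open>\<And>t. \<lbrakk>t \<in> carrier T; x \<cdot>\<^bsub>M\<^esub> t \<noteq> \<zero>\<^bsub>M\<^esub>; \<forall>j\<in>J. (x \<cdot>\<^bsub>M\<^esub> t) \<cdot>\<^bsub>M\<^esub> j = \<zero>\<^bsub>M\<^esub>\<rbrakk> \<Longrightarrow> thesis\<close>
    by metis
  have "x \<cdot>\<^bsub>M\<^esub> \<zero> \<noteq> \<zero>\<^bsub>M\<^esub>"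
  proof (rule left_T_nilpotent_induct)
    show "x \<cdot>\<^bsub>M\<^esub> \<one> \<noteq> \<zero>\<^bsub>M\<^esub>"
      using x by simp
    show "\<exists>j\<in>J. x \<cdot>\<^bsub>M\<^esub> (t \<otimes> j) \<noteq> \<zero>\<^bsub>M\<^esub>" if "t \<in> carrier T" "x \<cdot>\<^bsub>M\<^esub> t \<noteq> \<zero>\<^bsub>M\<^esub>" for t
      using *[OF that] that x right_ideal_carrier[OF right_ideal_jacobson]
      by (metis smult_assoc)
  qed
  then show False
    using x by simp
qed

text \<open>The scalars that move \<open>x\<close> into \<open>L\<close> form a proper right ideal;
  take \<open>m\<close> maximal above it. Its idempotent \<open>e\<close> is outside
  \<open>m\<close>, because \<open>1 - e\<close> is inside, so \<open>x e\<close> stays outside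
  \<open>L\<close>. The gain is that \<open>(x e) a = x (e a)\<close> is a multiple by an element of
  \<open>J\<close> for every \<open>a\<close> in \<open>m\<close>.\<close>

lemma separating_idempotent:
  assumes L: "submodule_of T M L" and x: "x \<in> carrier M" "x \<notin> L"
  obtains m e where "maximal_right_ideal m T" "e \<in> carrier T" "x \<cdot>\<^bsub>M\<^esub> e \<notin> L"
    "\<forall>s\<in>carrier T. s \<otimes> e = e \<otimes> s" "\<forall>a\<in>m. e \<otimes> a \<in> J"
proof -
  define I where "I = {t \<in> carrier T. x \<cdot>\<^bsub>M\<^esub> t \<in> L}"
  have "right_ideal I T"
    by (rule right_idealI)
      (auto simp: I_def x submodule_zero[OF L] smult_add_right submodule_add[OF L]
        smult_assoc[symmetric] submodule_smult[OF L])
  moreover have "\<one> \<notin> I"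
    using x by (simp add: I_def)
  ultimately obtain m where m: "maximal_right_ideal m T" "I \<subseteq> m"
    by (rule ex_maximal_right_ideal)
  obtain e f where ef: "e \<in> carrier T" "f \<in> m" "f \<oplus> e = \<one>"
    and e: "\<forall>s\<in>carrier T. s \<otimes> e = e \<otimes> s" "\<forall>a\<in>m. e \<otimes> a \<in> J"
    by (rule maximal_right_ideal_idempotent[OF m(1)])
  have "e \<notin> m"
    using right_ideal_add[OF maximal_right_ideal_right_ideal[OF m(1)] ef(2), of e]
      maximal_right_ideal_one[OF m(1)] ef(3) by auto
  then have "x \<cdot>\<^bsub>M\<^esub> e \<notin> L"
    using m(2) ef(1) by (auto simp: I_def)
  then show thesis
    using that m(1) ef(1) e by blast
qed

text \<open>In other words, \<open>M J\<close> is the intersection of the \<open>M m\<close>. For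
  the idempotent \<open>e\<close> belonging to \<open>m\<close>, multiplication by \<open>e\<close>
  maps \<open>M m\<close> into \<open>M J\<close>, because \<open>e m\<close> lies in
  \<open>J\<close> and \<open>e\<close> is central; so \<open>x e\<close> outside \<open>M J\<close>
  forces \<open>x\<close> outside \<open>M m\<close>.\<close>

lemma ex_maximal_mult_span:
  assumes x: "x \<in> carrier M" "x \<notin> mult_span J"
  obtains m where "maximal_right_ideal m T" "x \<notin> mult_span m"
proof -
  note MJ = submodule_mult_span[of J, OF subsetI, OF right_ideal_carrier[OF right_ideal_jacobson]]
  obtain m e where m: "maximal_right_ideal m T" and e: "e \<in> carrier T" "x \<cdot>\<^bsub>M\<^esub> e \<notin> mult_span J"
    "\<forall>s\<in>carrier T. s \<otimes> e = e \<otimes> s" "\<forall>a\<in>m. e \<otimes> a \<in> J"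
    by (rule separating_idempotent[OF MJ x])
  note mc = right_ideal_carrier[OF maximal_right_ideal_right_ideal[OF m]]
  have "submodule_of T M {z \<in> carrier M. z \<cdot>\<^bsub>M\<^esub> e \<in> mult_span J}"
  proof (rule submoduleI)
    fix z r assume z: "z \<in> {z \<in> carrier M. z \<cdot>\<^bsub>M\<^esub> e \<in> mult_span J}" and r: "r \<in> carrier T"
    then have "(z \<cdot>\<^bsub>M\<^esub> r) \<cdot>\<^bsub>M\<^esub> e = (z \<cdot>\<^bsub>M\<^esub> e) \<cdot>\<^bsub>M\<^esub> r"
      using e by (simp add: smult_assoc)
    then show "z \<cdot>\<^bsub>M\<^esub> r \<in> {z \<in> carrier M. z \<cdot>\<^bsub>M\<^esub> e \<in> mult_span J}"
      using z r submodule_smult[OF MJ] by simp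
  qed (use e submodule_zero[OF MJ] submodule_add[OF MJ] in \<open>auto simp: smult_add_left\<close>)
  then have "mult_span m \<subseteq> {z \<in> carrier M. z \<cdot>\<^bsub>M\<^esub> e \<in> mult_span J}"
  proof (rule mult_span_least)
    fix z s assume z: "z \<in> carrier M" and s: "s \<in> m"
    then have "(z \<cdot>\<^bsub>M\<^esub> s) \<cdot>\<^bsub>M\<^esub> e = z \<cdot>\<^bsub>M\<^esub> (e \<otimes> s)"
      using e mc[OF s] by (simp add: smult_assoc)
    then show "z \<cdot>\<^bsub>M\<^esub> s \<in> {z \<in> carrier M. z \<cdot>\<^bsub>M\<^esub> e \<in> mult_span J}"
      using z s e mult_span_upper mc by simp
  qed
  then show thesis
    using that m e(2) by blast
qed

text \<open>If \<open>T/m\<close> is a quotient of \<open>M\<close>, then it embeds in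
  \<open>M\<close>, as \<open>y T\<close>. Since \<open>x (1 - e)\<close> lies in
  \<open>M m\<close>, the element \<open>x e\<close> does not, and it is nonzero. A nonzero multiple
  \<open>y\<close> of it is killed by \<open>J\<close>. As \<open>y e = y\<close>, one gets
  \<open>y a = y (e a) = 0\<close> for \<open>a\<close> in \<open>m\<close>.\<close>

lemma ex_socle_element:
  assumes m: "maximal_right_ideal m T" and x: "x \<in> carrier M" "x \<notin> mult_span m"
  obtains y where "y \<in> carrier M" "y \<noteq> \<zero>\<^bsub>M\<^esub>" "\<forall>a\<in>m. y \<cdot>\<^bsub>M\<^esub> a = \<zero>\<^bsub>M\<^esub>"
proof -
  note mc = right_ideal_carrier[OF maximal_right_ideal_right_ideal[OF m]]
  have Mm: "submodule_of T M (mult_span m)"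
    using mc by (intro submodule_mult_span) blast
  obtain e f where ef: "e \<in> carrier T" "f \<in> m" "f \<oplus> e = \<one>" "e \<otimes> e = e"
    and e: "\<forall>s\<in>carrier T. s \<otimes> e = e \<otimes> s" "\<forall>a\<in>m. e \<otimes> a \<in> J"
    by (rule maximal_right_ideal_idempotent[OF m])
  have "x \<cdot>\<^bsub>M\<^esub> f \<oplus>\<^bsub>M\<^esub> x \<cdot>\<^bsub>M\<^esub> e = x"
    using x ef mc by (simp flip: smult_add_right)
  then have "x \<cdot>\<^bsub>M\<^esub> e \<notin> mult_span m"
    using submodule_add[OF Mm mult_span_upper[OF x(1) ef(2)], of "x \<cdot>\<^bsub>M\<^esub> e"] x(2) by auto
  then have "x \<cdot>\<^bsub>M\<^esub> e \<noteq> \<zero>\<^bsub>M\<^esub>"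
    using submodule_zero[OF Mm] by auto
  then obtain t where t: "t \<in> carrier T" "(x \<cdot>\<^bsub>M\<^esub> e) \<cdot>\<^bsub>M\<^esub> t \<noteq> \<zero>\<^bsub>M\<^esub>"
    "\<forall>j\<in>J. ((x \<cdot>\<^bsub>M\<^esub> e) \<cdot>\<^bsub>M\<^esub> t) \<cdot>\<^bsub>M\<^esub> j = \<zero>\<^bsub>M\<^esub>"
    by (rule ex_socle_multiple[OF smult_closed[OF x(1) ef(1)]])
  define y where "y = (x \<cdot>\<^bsub>M\<^esub> e) \<cdot>\<^bsub>M\<^esub> t"
  have y: "y \<in> carrier M"
    using x ef t by (simp add: y_def)
  have "e \<otimes> t \<otimes> e = e \<otimes> t"
    using e(1) t(1) ef(1,4) by (metis m_assoc)
  then have ye: "y \<cdot>\<^bsub>M\<^esub> e = y"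
    unfolding y_def using x ef t by (simp add: smult_assoc m_assoc)
  have "y \<cdot>\<^bsub>M\<^esub> a = \<zero>\<^bsub>M\<^esub>" if a: "a \<in> m" for a
  proof -
    have "y \<cdot>\<^bsub>M\<^esub> a = y \<cdot>\<^bsub>M\<^esub> (e \<otimes> a)"
      using ye y ef(1) mc[OF a] by (simp flip: smult_assoc)
    then show ?thesis
      using t(3) e(2) a by (simp add: y_def)
  qed
  then show thesis
    using that y t(2) by (simp add: y_def)
qed

text \<open>The converse passage: if \<open>T/m\<close> embeds in \<open>M\<close>, then it is a
  quotient of \<open>M\<close>. If \<open>M m\<close> were all of \<open>M\<close>, each
  \<open>x\<close> in a nonzero \<open>x t e\<close> could be expanded into multiples by
  \<open>m\<close>, producing left factors forever.\<close>

lemma mult_span_maximal_proper: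
  assumes m: "maximal_right_ideal m T" and y: "y \<in> carrier M" "y \<noteq> \<zero>\<^bsub>M\<^esub>"
    and ym: "\<forall>a\<in>m. y \<cdot>\<^bsub>M\<^esub> a = \<zero>\<^bsub>M\<^esub>"
  obtains x where "x \<in> carrier M" "x \<notin> mult_span m"
proof (rule ccontr)
  assume nex: "\<not> thesis"
  have Mm: "x \<in> mult_span m" if "x \<in> carrier M" for x
    using nex that \<open>\<And>x. \<lbrakk>x \<in> carrier M; x \<notin> mult_span m\<rbrakk> \<Longrightarrow> thesis\<close> by blast
  note mc = right_ideal_carrier[OF maximal_right_ideal_right_ideal[OF m]]
  obtain e f where ef: "e \<in> carrier T" "f \<in> m" "f \<oplus> e = \<one>" "e \<otimes> e = e"
    and e: "\<forall>s\<in>carrier T. s \<otimes> e = e \<otimes> s" "\<forall>a\<in>m. e \<otimes> a \<in> J"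
    by (rule maximal_right_ideal_idempotent[OF m])
  \<comment> \<open>The trailing \<open>e\<close> is carried along so that a factor \<open>s\<close>
    from \<open>m\<close> may be replaced by \<open>e s\<close>, which lies in
    \<open>J\<close>.\<close>
  have "\<exists>x\<in>carrier M. x \<cdot>\<^bsub>M\<^esub> (\<zero> \<otimes> e) \<noteq> \<zero>\<^bsub>M\<^esub>"
  proof (rule right_T_nilpotent_induct)
    have "y \<cdot>\<^bsub>M\<^esub> f \<oplus>\<^bsub>M\<^esub> y \<cdot>\<^bsub>M\<^esub> e = y"
      using y ef mc by (simp flip: smult_add_right)
    then have "y \<cdot>\<^bsub>M\<^esub> e = y"
      using ym ef y by simp
    then show "\<exists>x\<in>carrier M. x \<cdot>\<^bsub>M\<^esub> (\<one> \<otimes> e) \<noteq> \<zero>\<^bsub>M\<^esub>"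
      using y ef(1) by (intro bexI[of _ y]) auto
  next
    fix t assume t: "t \<in> carrier T" and "\<exists>x\<in>carrier M. x \<cdot>\<^bsub>M\<^esub> (t \<otimes> e) \<noteq> \<zero>\<^bsub>M\<^esub>"
    then obtain x where x: "x \<in> carrier M" "x \<cdot>\<^bsub>M\<^esub> (t \<otimes> e) \<noteq> \<zero>\<^bsub>M\<^esub>"
      by blast
    have te: "t \<otimes> e \<in> carrier T"
      using t ef by simp
    have "m \<subseteq> carrier T"
      using mc by blast
    then obtain x' s where s: "x' \<in> carrier M" "s \<in> m" "x' \<cdot>\<^bsub>M\<^esub> (s \<otimes> (t \<otimes> e)) \<noteq> \<zero>\<^bsub>M\<^esub>"
      by (rule ex_mult_not_in_annihilator[OF Mm[OF x(1)] te x(2)])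
    \<comment> \<open>Centrality moves the new \<open>e\<close> to the right, where idempotency
      absorbs it.\<close>
    have "(e \<otimes> s) \<otimes> t \<otimes> e = (e \<otimes> (s \<otimes> t)) \<otimes> e"
      using ef(1) mc[OF s(2)] t by (simp add: m_assoc)
    also have "\<dots> = (s \<otimes> t) \<otimes> e \<otimes> e"
      using e(1) mc[OF s(2)] t by simp
    also have "\<dots> = s \<otimes> (t \<otimes> e)"
      using ef mc[OF s(2)] t by (simp add: m_assoc)
    finally show "\<exists>j\<in>J. \<exists>x\<in>carrier M. x \<cdot>\<^bsub>M\<^esub> (j \<otimes> t \<otimes> e) \<noteq> \<zero>\<^bsub>M\<^esub>"
      using s e(2) by metis
  qed
  then show False
    using ef(1) by simp
qed

text \<open>Choose \<open>N\<close> above \<open>M m\<close> maximal without \<open>x\<close>. For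
  \<open>z\<close> outside \<open>N\<close> maximality gives \<open>x = n + z t\<close>. Here
  \<open>t\<close> is not in \<open>m\<close>, as \<open>z m\<close> lies in \<open>N\<close>; so
  \<open>t\<close> is invertible modulo \<open>m\<close>, and the equation can be solved for
  \<open>z\<close>. Thus \<open>M/N\<close> is a copy of \<open>T/m\<close> generated by the class
  of \<open>x\<close>.\<close>

lemma maximal_submodule_generated:
  assumes m: "maximal_right_ideal m T" and x: "x \<in> carrier M" "x \<notin> mult_span m"
  obtains N where "submodule_of T M N" "mult_span m \<subseteq> N" "x \<notin> N"
    "\<forall>z\<in>carrier M. \<exists>n\<in>N. \<exists>t\<in>carrier T. z = n \<oplus>\<^bsub>M\<^esub> x \<cdot>\<^bsub>M\<^esub> t"
proof -
  note mc = right_ideal_carrier[OF maximal_right_ideal_right_ideal[OF m]]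
  have "submodule_of T M (mult_span m)" "mult_span m \<inter> {x} = {}"
    using mc x by (auto intro: submodule_mult_span)
  from ex_maximal_submodule_avoiding[OF this] obtain N where
    N: "submodule_of T M N" "mult_span m \<subseteq> N" "x \<notin> N"
    and max: "\<forall>Q. submodule_of T M Q \<longrightarrow> N \<subset> Q \<longrightarrow> Q \<inter> {x} \<noteq> {}"
    by blast
  note Nc = submodule_carrier[OF N(1)]
  have "\<exists>n\<in>N. \<exists>t\<in>carrier T. z = n \<oplus>\<^bsub>M\<^esub> x \<cdot>\<^bsub>M\<^esub> t" if z: "z \<in> carrier M" for z
  proof (cases "z \<in> N")
    case True
    then show ?thesis
      using x z by (intro bexI[of _ z] bexI[of _ \<zero>]) auto
  next
    case False
    have "N \<subset> N <+>\<^bsub>M\<^esub> cyclic z"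
      using set_add_upper1[OF N(1) submodule_cyclic[OF z]]
        set_add_upper2[OF N(1) submodule_cyclic[OF z]] cyclic_self[OF z] False by blast
    then have "x \<in> N <+>\<^bsub>M\<^esub> cyclic z"
      using max submodule_set_add[OF N(1) submodule_cyclic[OF z]] by blast
    then obtain n t where nt: "n \<in> N" "t \<in> carrier T" "x = n \<oplus>\<^bsub>M\<^esub> z \<cdot>\<^bsub>M\<^esub> t"
      unfolding mem_add_cyclic by blast
    have "t \<notin> m"
    proof
      assume "t \<in> m"
      then have "z \<cdot>\<^bsub>M\<^esub> t \<in> N"
        using mult_span_upper[OF z] N(2) by blast
      then show False
        using submodule_add[OF N(1) nt(1)] nt(3) N(3) by blast
    qed
    then obtain a s where as: "a \<in> m" "s \<in> carrier T" "a \<oplus> t \<otimes> s = \<one>"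
      by (rule maximal_right_ideal_invertible[OF m nt(2)])
    have "\<ominus>\<^bsub>M\<^esub> n \<oplus>\<^bsub>M\<^esub> (n \<oplus>\<^bsub>M\<^esub> z \<cdot>\<^bsub>M\<^esub> t) = z \<cdot>\<^bsub>M\<^esub> t"
      using Nc[OF nt(1)] z nt(2) by (intro M.r_neg1) auto
    then have zt: "z \<cdot>\<^bsub>M\<^esub> t = \<ominus>\<^bsub>M\<^esub> n \<oplus>\<^bsub>M\<^esub> x"
      unfolding nt(3)[symmetric] by (rule sym)
    have "z = z \<cdot>\<^bsub>M\<^esub> (a \<oplus> t \<otimes> s)"
      using z as by simp
    also have "\<dots> = z \<cdot>\<^bsub>M\<^esub> a \<oplus>\<^bsub>M\<^esub> (\<ominus>\<^bsub>M\<^esub> n \<oplus>\<^bsub>M\<^esub> x) \<cdot>\<^bsub>M\<^esub> s"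
      using z as(1,2) nt(2) mc by (simp add: smult_add_right smult_assoc[symmetric] zt)
    also have "\<dots> = (z \<cdot>\<^bsub>M\<^esub> a \<oplus>\<^bsub>M\<^esub> (\<ominus>\<^bsub>M\<^esub> n) \<cdot>\<^bsub>M\<^esub> s) \<oplus>\<^bsub>M\<^esub> x \<cdot>\<^bsub>M\<^esub> s"
      using z x(1) as(1,2) mc Nc[OF nt(1)] by (simp add: smult_add_left M.a_assoc)
    finally have "z = (z \<cdot>\<^bsub>M\<^esub> a \<oplus>\<^bsub>M\<^esub> (\<ominus>\<^bsub>M\<^esub> n) \<cdot>\<^bsub>M\<^esub> s) \<oplus>\<^bsub>M\<^esub> x \<cdot>\<^bsub>M\<^esub> s" .
    moreover have "z \<cdot>\<^bsub>M\<^esub> a \<in> N"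
      using mult_span_upper[OF z as(1)] N(2) by blast
    then have "z \<cdot>\<^bsub>M\<^esub> a \<oplus>\<^bsub>M\<^esub> (\<ominus>\<^bsub>M\<^esub> n) \<cdot>\<^bsub>M\<^esub> s \<in> N"
      using submodule_add[OF N(1)] submodule_smult[OF N(1)] submodule_neg[OF N(1)] nt(1) as(2) by simp
    ultimately show ?thesis
      using as(2) by blast
  qed
  then show thesis
    using that N by blast
qed

text \<open>The composite of \<open>M\<close> onto \<open>M/N\<close>, which is \<open>T/m\<close>,
  with the map from \<open>T/m\<close> onto \<open>y T\<close>. Concretely it sends
  \<open>n + x t\<close> to \<open>y t\<close>.\<close>

lemma ex_endomorphism:
  assumes m: "maximal_right_ideal m T" and x: "x \<in> carrier M" "x \<notin> mult_span m"
    and y: "y \<in> carrier M" "\<forall>a\<in>m. y \<cdot>\<^bsub>M\<^esub> a = \<zero>\<^bsub>M\<^esub>"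
  obtains f where "f \<in> module_hom T M M" "f x = y" "\<forall>z\<in>mult_span m. f z = \<zero>\<^bsub>M\<^esub>"
    "\<forall>z\<in>carrier M. \<exists>t\<in>carrier T. f z = y \<cdot>\<^bsub>M\<^esub> t"
proof -
  obtain N where N: "submodule_of T M N" "mult_span m \<subseteq> N" "x \<notin> N"
    and dec: "\<forall>z\<in>carrier M. \<exists>n\<in>N. \<exists>t\<in>carrier T. z = n \<oplus>\<^bsub>M\<^esub> x \<cdot>\<^bsub>M\<^esub> t"
    by (rule maximal_submodule_generated[OF m x])
  note mi = maximal_right_ideal_right_ideal[OF m]
  note mc = right_ideal_carrier[OF mi] and Nc = submodule_carrier[OF N(1)]
  define f where "f = (\<lambda>z\<in>carrier M. THE w. \<exists>n\<in>N. \<exists>t\<in>carrier T. z = n \<oplus>\<^bsub>M\<^esub> x \<cdot>\<^bsub>M\<^esub> t \<and> w = y \<cdot>\<^bsub>M\<^esub> t)"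
  \<comment> \<open>Inverting a \<open>t\<close> outside \<open>m\<close> would bring
    \<open>x\<close> itself into \<open>N\<close>. Together with \<open>y m = 0\<close> this makes
    \<open>y t\<close> independent of the chosen decomposition.\<close>
  have xt: "t \<in> m" if t: "t \<in> carrier T" "x \<cdot>\<^bsub>M\<^esub> t \<in> N" for t
  proof (rule ccontr)
    assume "t \<notin> m"
    then obtain a s where as: "a \<in> m" "s \<in> carrier T" "a \<oplus> t \<otimes> s = \<one>"
      by (rule maximal_right_ideal_invertible[OF m t(1)])
    have "x = x \<cdot>\<^bsub>M\<^esub> (a \<oplus> t \<otimes> s)"
      using x as by simp
    also have "\<dots> = x \<cdot>\<^bsub>M\<^esub> a \<oplus>\<^bsub>M\<^esub> (x \<cdot>\<^bsub>M\<^esub> t) \<cdot>\<^bsub>M\<^esub> s"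
      using x as(1,2) t(1) mc by (simp add: smult_add_right smult_assoc)
    also have "\<dots> \<in> N"
      using submodule_add[OF N(1) subsetD[OF N(2) mult_span_upper[OF x(1) as(1)]]
          submodule_smult[OF N(1) t(2) as(2)]] .
    finally show False
      using N(3) by simp
  qed
  have f: "f (n \<oplus>\<^bsub>M\<^esub> x \<cdot>\<^bsub>M\<^esub> t) = y \<cdot>\<^bsub>M\<^esub> t" if nt: "n \<in> N" "t \<in> carrier T" for n t
  proof -
    have "y \<cdot>\<^bsub>M\<^esub> t' = y \<cdot>\<^bsub>M\<^esub> t"
      if n't': "n' \<in> N" "t' \<in> carrier T" "n \<oplus>\<^bsub>M\<^esub> x \<cdot>\<^bsub>M\<^esub> t = n' \<oplus>\<^bsub>M\<^esub> x \<cdot>\<^bsub>M\<^esub> t'" for n' t'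
    proof -
      have c: "n \<in> carrier M" "n' \<in> carrier M" "x \<cdot>\<^bsub>M\<^esub> t \<in> carrier M" "x \<cdot>\<^bsub>M\<^esub> t' \<in> carrier M"
        using Nc nt n't'(1,2) x by auto
      have "x \<cdot>\<^bsub>M\<^esub> (t' \<ominus> t) = (n' \<oplus>\<^bsub>M\<^esub> x \<cdot>\<^bsub>M\<^esub> t') \<oplus>\<^bsub>M\<^esub> (\<ominus>\<^bsub>M\<^esub> n' \<oplus>\<^bsub>M\<^esub> \<ominus>\<^bsub>M\<^esub> (x \<cdot>\<^bsub>M\<^esub> t))"
        using c x(1) nt(2) n't'(2)
        by (simp add: a_minus_def smult_add_right smult_minus_right M.r_neg2 M.r_neg1 M.add.m_ac)
      also have "\<dots> = n \<oplus>\<^bsub>M\<^esub> \<ominus>\<^bsub>M\<^esub> n'"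
        unfolding n't'(3)[symmetric] using c by (simp add: M.r_neg2 M.r_neg1 M.r_neg M.add.m_ac)
      also have "\<dots> \<in> N"
        using submodule_minus[OF N(1) nt(1) n't'(1)] by (simp add: a_minus_def)
      finally have "t' \<ominus> t \<in> m"
        using xt nt n't' by simp
      then have "y \<cdot>\<^bsub>M\<^esub> (t' \<ominus> t) = \<zero>\<^bsub>M\<^esub>"
        using y(2) by blast
      then have "y \<cdot>\<^bsub>M\<^esub> t' \<oplus>\<^bsub>M\<^esub> \<ominus>\<^bsub>M\<^esub> (y \<cdot>\<^bsub>M\<^esub> t) = \<zero>\<^bsub>M\<^esub>"
        using y(1) nt(2) n't'(2) by (simp add: a_minus_def smult_add_right smult_minus_right)
      then show ?thesis
        using M.minus_equality[of "y \<cdot>\<^bsub>M\<^esub> t'" "\<ominus>\<^bsub>M\<^esub> (y \<cdot>\<^bsub>M\<^esub> t)"] y(1) nt(2) n't'(2) by simp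
    qed
    then have "(THE w. \<exists>n'\<in>N. \<exists>t'\<in>carrier T. n \<oplus>\<^bsub>M\<^esub> x \<cdot>\<^bsub>M\<^esub> t = n' \<oplus>\<^bsub>M\<^esub> x \<cdot>\<^bsub>M\<^esub> t' \<and> w = y \<cdot>\<^bsub>M\<^esub> t') = y \<cdot>\<^bsub>M\<^esub> t"
      using nt by (intro the_equality) blast+
    then show ?thesis
      using nt x(1) Nc by (simp add: f_def)
  qed
  have fN: "f n = \<zero>\<^bsub>M\<^esub>" if "n \<in> N" for n
    using f[OF that zero_closed] Nc[OF that] x(1) y(1) by simp
  have range: "\<exists>t\<in>carrier T. f z = y \<cdot>\<^bsub>M\<^esub> t" if z: "z \<in> carrier M" for z
    using bspec[OF dec z] f by blast
  have "f \<in> module_hom T M M"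
  proof (rule module_homI)
    show "f \<in> carrier M \<rightarrow>\<^sub>E carrier M"
    proof (rule PiE_I)
      show "f z \<in> carrier M" if "z \<in> carrier M" for z
        using range[OF that] y(1) by auto
    qed (simp add: f_def)
    fix z assume z: "z \<in> carrier M"
    obtain n t where nt: "n \<in> N" "t \<in> carrier T" "z = n \<oplus>\<^bsub>M\<^esub> x \<cdot>\<^bsub>M\<^esub> t"
      using bspec[OF dec z] by blast
    show "f (z \<oplus>\<^bsub>M\<^esub> w) = f z \<oplus>\<^bsub>M\<^esub> f w" if w: "w \<in> carrier M" for w
    proof -
      obtain n' t' where nt': "n' \<in> N" "t' \<in> carrier T" "w = n' \<oplus>\<^bsub>M\<^esub> x \<cdot>\<^bsub>M\<^esub> t'"
        using bspec[OF dec w] by blast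
      have "z \<oplus>\<^bsub>M\<^esub> w = (n \<oplus>\<^bsub>M\<^esub> n') \<oplus>\<^bsub>M\<^esub> x \<cdot>\<^bsub>M\<^esub> (t \<oplus> t')"
        unfolding nt(3) nt'(3) using Nc nt(1,2) nt'(1,2) x(1)
        by (simp add: smult_add_right M.add.m_ac)
      then have "f (z \<oplus>\<^bsub>M\<^esub> w) = y \<cdot>\<^bsub>M\<^esub> (t \<oplus> t')"
        using f submodule_add[OF N(1)] nt(1,2) nt'(1,2) by simp
      then show ?thesis
        using f nt nt' y(1) by (simp add: smult_add_right)
    qed
    show "f (z \<cdot>\<^bsub>M\<^esub> r) = f z \<cdot>\<^bsub>M\<^esub> r" if r: "r \<in> carrier T" for r
    proof -
      have "z \<cdot>\<^bsub>M\<^esub> r = n \<cdot>\<^bsub>M\<^esub> r \<oplus>\<^bsub>M\<^esub> x \<cdot>\<^bsub>M\<^esub> (t \<otimes> r)"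
        unfolding nt(3) using Nc nt(1,2) r x(1) by (simp add: smult_add_left smult_assoc)
      then have "f (z \<cdot>\<^bsub>M\<^esub> r) = y \<cdot>\<^bsub>M\<^esub> (t \<otimes> r)"
        using f submodule_smult[OF N(1)] nt(1,2) r by simp
      then show ?thesis
        using f nt y(1) r by (simp add: smult_assoc)
    qed
  qed
  moreover have "f x = y"
    using f[OF submodule_zero[OF N(1)] one_closed] x(1) y(1) by simp
  ultimately show thesis
    using that fN N(2) range by blast
qed

text \<open>Such an \<open>M\<close> is a module over the semisimple ring \<open>T/J\<close>. The
  argument is that of \<open>semisimple_imp_complemented\<close>, with the simple submodule supplied
  as \<open>z T\<close> for \<open>z = x e\<close>: here \<open>z a = x (e a) = 0\<close> for
  \<open>a\<close> in \<open>m\<close>, and scalars outside \<open>m\<close> are invertible modulo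
  \<open>m\<close>.\<close>

lemma complemented_of_annihilated:
  assumes MJ: "\<forall>x\<in>carrier M. \<forall>j\<in>J. x \<cdot>\<^bsub>M\<^esub> j = \<zero>\<^bsub>M\<^esub>"
  shows complemented
  unfolding complemented_def
proof safe
  fix N assume N: "submodule_of T M N"
  obtain P where P: "submodule_of T M P" "N \<inter> P = {\<zero>\<^bsub>M\<^esub>}"
    and max: "\<And>x. \<lbrakk>x \<in> carrier M; x \<notin> P\<rbrakk> \<Longrightarrow>
      \<exists>p\<in>P. \<exists>r\<in>carrier T. p \<oplus>\<^bsub>M\<^esub> x \<cdot>\<^bsub>M\<^esub> r \<in> N \<and> p \<oplus>\<^bsub>M\<^esub> x \<cdot>\<^bsub>M\<^esub> r \<noteq> \<zero>\<^bsub>M\<^esub>"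
    using maximal_complement[OF N] by blast
  note NP = submodule_set_add[OF N P(1)]
  have "x \<in> N <+>\<^bsub>M\<^esub> P" if x: "x \<in> carrier M" for x
  proof (rule ccontr)
    assume "x \<notin> N <+>\<^bsub>M\<^esub> P"
    then obtain m e where m: "maximal_right_ideal m T"
      and e: "e \<in> carrier T" "x \<cdot>\<^bsub>M\<^esub> e \<notin> N <+>\<^bsub>M\<^esub> P" "\<forall>a\<in>m. e \<otimes> a \<in> J"
      by (rule separating_idempotent[OF NP x])
    note mc = right_ideal_carrier[OF maximal_right_ideal_right_ideal[OF m]]
    define z where "z = x \<cdot>\<^bsub>M\<^esub> e"
    have z: "z \<in> carrier M" "z \<notin> N <+>\<^bsub>M\<^esub> P"
      using x e by (simp_all add: z_def)
    have zm: "z \<cdot>\<^bsub>M\<^esub> a = \<zero>\<^bsub>M\<^esub>" if "a \<in> m" for a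
      using MJ x e that mc by (simp add: z_def smult_assoc)
    have "z \<notin> P"
      using z(2) set_add_upper2[OF N P(1)] by blast
    then obtain p r where pr: "p \<in> P" "r \<in> carrier T"
      "p \<oplus>\<^bsub>M\<^esub> z \<cdot>\<^bsub>M\<^esub> r \<in> N" "p \<oplus>\<^bsub>M\<^esub> z \<cdot>\<^bsub>M\<^esub> r \<noteq> \<zero>\<^bsub>M\<^esub>"
      using max[OF z(1)] by blast
    show False
    proof (cases "r \<in> m")
      case True
      then have "p \<oplus>\<^bsub>M\<^esub> z \<cdot>\<^bsub>M\<^esub> r = p"
        using zm pr(1) submodule_carrier[OF P(1)] by simp
      then show False
        using P(2) pr by auto
    next
      case False
      then obtain a s where as: "a \<in> m" "s \<in> carrier T" "a \<oplus> r \<otimes> s = \<one>"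
        by (rule maximal_right_ideal_invertible[OF m pr(2)])
      have "z = z \<cdot>\<^bsub>M\<^esub> (a \<oplus> r \<otimes> s)"
        using z as by simp
      also have "\<dots> = (z \<cdot>\<^bsub>M\<^esub> r) \<cdot>\<^bsub>M\<^esub> s"
        using z(1) as(1,2) pr(2) mc zm by (simp add: smult_add_right smult_assoc)
      also have "\<dots> \<in> N <+>\<^bsub>M\<^esub> P"
      proof (rule submodule_smult[OF NP _ as(2)])
        have "p \<in> N <+>\<^bsub>M\<^esub> P" "p \<oplus>\<^bsub>M\<^esub> z \<cdot>\<^bsub>M\<^esub> r \<in> N <+>\<^bsub>M\<^esub> P"
          using pr(1,3) set_add_upper1[OF N P(1)] set_add_upper2[OF N P(1)] by auto
        then show "z \<cdot>\<^bsub>M\<^esub> r \<in> N <+>\<^bsub>M\<^esub> P"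
          using submodule_add_cancel[OF NP _ smult_closed[OF z(1) pr(2)]] by blast
      qed
      finally show False
        using z(2) by simp
    qed
  qed
  then have "N <+>\<^bsub>M\<^esub> P = carrier M"
    using submodule_subset[OF NP] by blast
  then show "direct_summand T M N"
    unfolding direct_summand_def using N P by blast
qed

text \<open>The Baer condition gives a projection \<open>e\<close> onto \<open>M J\<close>. Then
  \<open>x t = e x t\<close> for \<open>t\<close> in \<open>J\<close>, where \<open>e x\<close> can
  be expanded into multiples by \<open>J\<close>; so a nonzero \<open>x t\<close> yields nonzero
  \<open>x' s t\<close> with \<open>s\<close> in \<open>J\<close>, again and again, against right
  T-nilpotence. Hence \<open>M J = 0\<close>.\<close>

lemma baer_imp_complemented:
  assumes "baer_module T M" shows complemented
proof (rule complemented_of_annihilated, rule ccontr)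
  note J = right_ideal_carrier[OF right_ideal_jacobson]
  then have Jc: "J \<subseteq> carrier T"
    by blast
  \<comment> \<open>The endomorphisms killing \<open>M J\<close>. Their common kernel is no larger:
    a point outside \<open>M J\<close> is outside some \<open>M m\<close>, and an endomorphism
    killing \<open>M m\<close> sends it to a nonzero socle element.\<close>
  define X where "X = {f \<in> module_hom T M M. \<forall>z\<in>mult_span J. f z = \<zero>\<^bsub>M\<^esub>}"
  have "(\<lambda>z\<in>carrier M. \<zero>\<^bsub>M\<^esub>) \<in> X"
    using module_hom_const_zero[OF right_module right_module]
      submodule_carrier[OF submodule_mult_span[OF Jc]] by (simp add: X_def)
  then have "X \<subseteq> module_hom T M M" "X \<noteq> {}"
    by (auto simp: X_def)
  then obtain e where e: "e \<in> module_hom T M M" "\<forall>f\<in>X. \<forall>x\<in>carrier M. f (e x) = \<zero>\<^bsub>M\<^esub>"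
    "\<forall>x\<in>carrier M. (\<forall>f\<in>X. f x = \<zero>\<^bsub>M\<^esub>) \<longrightarrow> e x = x"
    using assms unfolding baer_iff_projection by metis
  have e_MJ: "e x \<in> mult_span J" if x: "x \<in> carrier M" for x
  proof (rule ccontr)
    assume "e x \<notin> mult_span J"
    then obtain m where m: "maximal_right_ideal m T" "e x \<notin> mult_span m"
      by (rule ex_maximal_mult_span[OF module_hom_closed[OF e(1) x]])
    obtain y where y: "y \<in> carrier M" "y \<noteq> \<zero>\<^bsub>M\<^esub>" "\<forall>a\<in>m. y \<cdot>\<^bsub>M\<^esub> a = \<zero>\<^bsub>M\<^esub>"
      by (rule ex_socle_element[OF m(1) module_hom_closed[OF e(1) x] m(2)])
    obtain f where "f \<in> module_hom T M M" "f (e x) = y" "\<forall>z\<in>mult_span m. f z = \<zero>\<^bsub>M\<^esub>"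
      by (rule ex_endomorphism[OF m(1) module_hom_closed[OF e(1) x] m(2) y(1,3)])
    moreover have "f \<in> X"
      using calculation mult_span_mono[OF jacobson_subset[OF m(1)]] by (auto simp: X_def)
    ultimately show False
      using e(2) x y(2) by auto
  qed
  have e_id: "e z = z" if "z \<in> mult_span J" for z
    using e(3) that submodule_carrier[OF submodule_mult_span[OF Jc] that] by (simp add: X_def)
  assume "\<not> (\<forall>x\<in>carrier M. \<forall>j\<in>J. x \<cdot>\<^bsub>M\<^esub> j = \<zero>\<^bsub>M\<^esub>)"
  then obtain x0 j0 where x0: "x0 \<in> carrier M" "j0 \<in> J" "x0 \<cdot>\<^bsub>M\<^esub> j0 \<noteq> \<zero>\<^bsub>M\<^esub>"
    by blast
  \<comment> \<open>The induction starts at the unit, where \<open>e\<close> gives no information;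
    the first factor is then the given \<open>j0\<close>, and from there on \<open>t\<close> lies in
    \<open>J\<close>.\<close>
  have "(\<zero> = \<one> \<or> \<zero> \<in> J) \<and> (\<exists>x\<in>carrier M. x \<cdot>\<^bsub>M\<^esub> \<zero> \<noteq> \<zero>\<^bsub>M\<^esub>)"
  proof (rule right_T_nilpotent_induct)
    have "x0 \<noteq> \<zero>\<^bsub>M\<^esub>"
      using x0 J by auto
    then show "(\<one> = \<one> \<or> \<one> \<in> J) \<and> (\<exists>x\<in>carrier M. x \<cdot>\<^bsub>M\<^esub> \<one> \<noteq> \<zero>\<^bsub>M\<^esub>)"
      using x0(1) by auto
  next
    fix t assume t: "t \<in> carrier T" and "(t = \<one> \<or> t \<in> J) \<and> (\<exists>x\<in>carrier M. x \<cdot>\<^bsub>M\<^esub> t \<noteq> \<zero>\<^bsub>M\<^esub>)"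
    then obtain x where x: "x \<in> carrier M" "x \<cdot>\<^bsub>M\<^esub> t \<noteq> \<zero>\<^bsub>M\<^esub>" and "t = \<one> \<or> t \<in> J"
      by blast
    from this(3) show "\<exists>j\<in>J. (j \<otimes> t = \<one> \<or> j \<otimes> t \<in> J) \<and> (\<exists>x\<in>carrier M. x \<cdot>\<^bsub>M\<^esub> (j \<otimes> t) \<noteq> \<zero>\<^bsub>M\<^esub>)"
    proof
      assume "t = \<one>"
      then show ?thesis
        using x0 J by (intro bexI[of _ j0]) auto
    next
      assume tJ: "t \<in> J"
      \<comment> \<open>\<open>x t\<close> lies in \<open>M J\<close> and is fixed by
        \<open>e\<close>, so \<open>x\<close> may be replaced by \<open>e x\<close>, which is itself
        in \<open>M J\<close>.\<close>
      have "e x \<cdot>\<^bsub>M\<^esub> t = x \<cdot>\<^bsub>M\<^esub> t"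
        using module_hom_smult[OF e(1) x(1) t] e_id[OF mult_span_upper[OF x(1) tJ]] by simp
      then have "e x \<cdot>\<^bsub>M\<^esub> t \<noteq> \<zero>\<^bsub>M\<^esub>"
        using x(2) by simp
      then obtain x' s where "x' \<in> carrier M" "s \<in> J" "x' \<cdot>\<^bsub>M\<^esub> (s \<otimes> t) \<noteq> \<zero>\<^bsub>M\<^esub>"
        using Jc by (rule ex_mult_not_in_annihilator[OF e_MJ[OF x(1)] t])
      then show ?thesis
        using right_ideal_mult[OF right_ideal_jacobson _ t] by blast
    qed
  qed
  then show False
    by auto
qed

text \<open>For the socle \<open>S\<close> the dual Baer condition gives an \<open>e\<close> with
  values in \<open>S\<close> that fixes every image of an endomorphism into \<open>S\<close>. These
  images generate \<open>S\<close>, so \<open>e\<close> projects onto \<open>S\<close>; since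
  \<open>S\<close> is essential, the kernel of \<open>e\<close> is zero.\<close>

lemma dual_baer_imp_complemented:
  assumes "dual_baer_module T M" shows complemented
proof (rule complemented_of_annihilated)
  note J = right_ideal_carrier[OF right_ideal_jacobson]
  define S where "S = {x \<in> carrier M. \<forall>j\<in>J. x \<cdot>\<^bsub>M\<^esub> j = \<zero>\<^bsub>M\<^esub>}"
  have S: "submodule_of T M S"
    by (rule submoduleI)
      (auto simp: S_def J smult_add_left smult_assoc right_ideal_mult_left[OF right_ideal_jacobson])
  obtain e where e: "e \<in> module_hom T M M" and eS: "\<forall>x\<in>carrier M. e x \<in> S"
    and ef: "\<forall>f\<in>module_hom T M M. (\<forall>x\<in>carrier M. f x \<in> S) \<longrightarrow> (\<forall>x\<in>carrier M. e (f x) = f x)"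
    using assms S unfolding dual_baer_iff_projection by blast
  \<comment> \<open>The fixed points form a submodule, so a \<open>y\<close> of \<open>S\<close>
    outside it can be replaced by a multiple \<open>z\<close> that generates a simple submodule and
    is still outside. That \<open>z\<close> is a value of an endomorphism into \<open>S\<close>,
    hence fixed after all.\<close>
  define E where "E = {z \<in> carrier M. e z = z}"
  have E: "submodule_of T M E"
    by (rule submoduleI)
      (auto simp: E_def module_hom_add[OF e] module_hom_smult[OF e]
        module_hom_zero[OF right_module right_module e])
  have e_id: "e y = y" if y: "y \<in> S" for y
  proof (rule ccontr)
    assume "e y \<noteq> y"
    then have y': "y \<in> carrier M" "y \<notin> E"
      using y by (auto simp: S_def E_def)
    then obtain m g where m: "maximal_right_ideal m T"
      and g: "g \<in> carrier T" "y \<cdot>\<^bsub>M\<^esub> g \<notin> E" "\<forall>a\<in>m. g \<otimes> a \<in> J"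
      by (rule separating_idempotent[OF E])
    define z where "z = y \<cdot>\<^bsub>M\<^esub> g"
    have z: "z \<in> carrier M" "z \<in> S" "z \<notin> E" "z \<noteq> \<zero>\<^bsub>M\<^esub>"
      using y' g submodule_smult[OF S y] submodule_zero[OF E] by (auto simp: z_def)
    have zm: "\<forall>a\<in>m. z \<cdot>\<^bsub>M\<^esub> a = \<zero>\<^bsub>M\<^esub>"
      using y g right_ideal_carrier[OF maximal_right_ideal_right_ideal[OF m]]
      by (auto simp: z_def smult_assoc S_def)
    obtain x where x: "x \<in> carrier M" "x \<notin> mult_span m"
      by (rule mult_span_maximal_proper[OF m z(1,4) zm])
    obtain f where f: "f \<in> module_hom T M M" "f x = z" "\<forall>w\<in>carrier M. \<exists>t\<in>carrier T. f w = z \<cdot>\<^bsub>M\<^esub> t"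
      by (rule ex_endomorphism[OF m x z(1) zm])
    have "\<forall>w\<in>carrier M. f w \<in> S"
      using f(3) submodule_smult[OF S z(2)] by auto
    then have "e z = z"
      using ef f(1,2) x(1) by blast
    then show False
      using z by (simp add: E_def)
  qed
  show "\<forall>x\<in>carrier M. \<forall>j\<in>J. x \<cdot>\<^bsub>M\<^esub> j = \<zero>\<^bsub>M\<^esub>"
  proof
    fix x assume x: "x \<in> carrier M"
    have ex: "e x \<in> S" "e x \<in> carrier M"
      using eS x by (auto simp: S_def)
    \<comment> \<open>The difference \<open>x - e x\<close>, written with the scalar -1 so that
      linearity of \<open>e\<close> applies directly.\<close>
    define k where "k = x \<oplus>\<^bsub>M\<^esub> (e x) \<cdot>\<^bsub>M\<^esub> (\<ominus> \<one>)"
    have k: "k \<in> carrier M"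
      using x ex by (simp add: k_def)
    have "e k = e x \<oplus>\<^bsub>M\<^esub> e (e x) \<cdot>\<^bsub>M\<^esub> (\<ominus> \<one>)"
      unfolding k_def using x ex by (simp add: module_hom_add[OF e] module_hom_smult[OF e])
    also have "\<dots> = \<zero>\<^bsub>M\<^esub>"
      using ex e_id by (simp add: smult_minus_one M.r_neg)
    finally have ek: "e k = \<zero>\<^bsub>M\<^esub>" .
    have "k = \<zero>\<^bsub>M\<^esub>"
    proof (rule ccontr)
      assume "k \<noteq> \<zero>\<^bsub>M\<^esub>"
      then obtain t where t: "t \<in> carrier T" "k \<cdot>\<^bsub>M\<^esub> t \<noteq> \<zero>\<^bsub>M\<^esub>"
        "\<forall>j\<in>J. (k \<cdot>\<^bsub>M\<^esub> t) \<cdot>\<^bsub>M\<^esub> j = \<zero>\<^bsub>M\<^esub>"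
        by (rule ex_socle_multiple[OF k])
      have "e (k \<cdot>\<^bsub>M\<^esub> t) = k \<cdot>\<^bsub>M\<^esub> t"
        using e_id t k by (simp add: S_def)
      then show False
        using t module_hom_smult[OF e k t(1)] ek by simp
    qed
    then have "x \<oplus>\<^bsub>M\<^esub> \<ominus>\<^bsub>M\<^esub> e x = \<zero>\<^bsub>M\<^esub>"
      using ex by (simp add: k_def smult_minus_one)
    then have "x = e x"
      using M.minus_equality[of x "\<ominus>\<^bsub>M\<^esub> e x"] x ex by simp
    then show "\<forall>j\<in>J. x \<cdot>\<^bsub>M\<^esub> j = \<zero>\<^bsub>M\<^esub>"
      using ex(1) by (simp add: S_def)
  qed
qed

end

section \<open>Image modules and quotients\<close>

text \<open>Transport of structure along a map that need not be injective: it suffices that the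
  relation "equal image under \<open>q\<close>" is a congruence. One construction thus serves for
  quotients, where \<open>q\<close> picks representatives, and for copies along an injection into
  another type.\<close>

definition image_module :: "('m \<Rightarrow> 'u) \<Rightarrow> ('m, 'r) right_module \<Rightarrow> ('u, 'r) right_module" where
  "image_module q M =
    (let s = inv_into (carrier M) q in
      \<lparr>carrier = q ` carrier M, mult = undefined, one = undefined, zero = q \<zero>\<^bsub>M\<^esub>,
       add = (\<lambda>a b. q (s a \<oplus>\<^bsub>M\<^esub> s b)), rsmult = (\<lambda>a r. q (s a \<cdot>\<^bsub>M\<^esub> r))\<rparr>)"

context right_module_over
begin

context
  fixes q :: "'m \<Rightarrow> 'u"
  assumes q_add: "\<And>x x' y y'. \<lbrakk>x \<in> carrier M; x' \<in> carrier M; y \<in> carrier M; y' \<in> carrier M; q x = q x'; q y = q y'\<rbrakk>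
      \<Longrightarrow> q (x \<oplus>\<^bsub>M\<^esub> y) = q (x' \<oplus>\<^bsub>M\<^esub> y')"
    and q_smult: "\<And>x x' r. \<lbrakk>x \<in> carrier M; x' \<in> carrier M; r \<in> carrier R; q x = q x'\<rbrakk>
      \<Longrightarrow> q (x \<cdot>\<^bsub>M\<^esub> r) = q (x' \<cdot>\<^bsub>M\<^esub> r)"
begin

lemma image_module_simps:
  "carrier (image_module q M) = q ` carrier M" "\<zero>\<^bsub>image_module q M\<^esub> = q \<zero>\<^bsub>M\<^esub>"
  by (simp_all add: image_module_def Let_def)

lemma image_module_add:
  assumes "x \<in> carrier M" "y \<in> carrier M"
  shows "q x \<oplus>\<^bsub>image_module q M\<^esub> q y = q (x \<oplus>\<^bsub>M\<^esub> y)"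
proof -
  have "q (inv_into (carrier M) q (q x) \<oplus>\<^bsub>M\<^esub> inv_into (carrier M) q (q y)) = q (x \<oplus>\<^bsub>M\<^esub> y)"
    using assms by (intro q_add) (auto simp: f_inv_into_f inv_into_into)
  then show ?thesis
    by (simp add: image_module_def Let_def)
qed

lemma image_module_smult:
  assumes "x \<in> carrier M" "r \<in> carrier R"
  shows "q x \<cdot>\<^bsub>image_module q M\<^esub> r = q (x \<cdot>\<^bsub>M\<^esub> r)"
proof -
  have "q (inv_into (carrier M) q (q x) \<cdot>\<^bsub>M\<^esub> r) = q (x \<cdot>\<^bsub>M\<^esub> r)"
    using assms by (intro q_smult) (auto simp: f_inv_into_f inv_into_into)
  then show ?thesis
    by (simp add: image_module_def Let_def)
qed

lemma image_module_is_right_module: "is_right_module R (image_module q M)"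
proof -
  have "abelian_group (image_module q M)"
  proof (rule abelian_groupI; unfold image_module_simps)
    fix a b c assume "a \<in> q ` carrier M" "b \<in> q ` carrier M" "c \<in> q ` carrier M"
    then obtain x y z where *: "x \<in> carrier M" "y \<in> carrier M" "z \<in> carrier M" "a = q x" "b = q y" "c = q z"
      by blast
    then show "a \<oplus>\<^bsub>image_module q M\<^esub> b \<oplus>\<^bsub>image_module q M\<^esub> c = a \<oplus>\<^bsub>image_module q M\<^esub> (b \<oplus>\<^bsub>image_module q M\<^esub> c)"
      by (simp add: image_module_add M.a_assoc)
  next
    fix a b assume "a \<in> q ` carrier M" "b \<in> q ` carrier M"
    then obtain x y where *: "x \<in> carrier M" "y \<in> carrier M" "a = q x" "b = q y"
      by blast
    then show "a \<oplus>\<^bsub>image_module q M\<^esub> b = b \<oplus>\<^bsub>image_module q M\<^esub> a"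
      by (simp add: image_module_add M.a_comm)
    show "a \<oplus>\<^bsub>image_module q M\<^esub> b \<in> q ` carrier M"
      using * by (simp add: image_module_add)
  next
    fix a assume "a \<in> q ` carrier M"
    then obtain x where *: "x \<in> carrier M" "a = q x"
      by blast
    then show "q \<zero>\<^bsub>M\<^esub> \<oplus>\<^bsub>image_module q M\<^esub> a = a"
      by (simp add: image_module_add)
    have "q (\<ominus>\<^bsub>M\<^esub> x) \<oplus>\<^bsub>image_module q M\<^esub> a = q \<zero>\<^bsub>M\<^esub>"
      using * by (simp add: image_module_add M.l_neg)
    then show "\<exists>b\<in>q ` carrier M. b \<oplus>\<^bsub>image_module q M\<^esub> a = q \<zero>\<^bsub>M\<^esub>"
      using *(1) by blast
  qed simp
  then show ?thesis
    unfolding is_right_module_def image_module_simps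
    by (auto simp: R.ring_axioms image_module_add image_module_smult smult_add_left smult_add_right
        smult_assoc)
qed

lemma image_module_hom: "(\<lambda>x\<in>carrier M. q x) \<in> module_hom R M (image_module q M)"
  by (rule module_homI) (auto simp: image_module_simps image_module_add image_module_smult)

end

text \<open>The quotient is realised on representatives, so that it lives on the type of \<open>M\<close> itself.\<close>

lemma ex_quotient_hom:
  assumes N: "submodule_of R M N"
  obtains Q :: "('m, 'r) right_module" and q where "is_right_module R Q" "q \<in> module_hom R M Q"
    "\<forall>x\<in>carrier M. q x = \<zero>\<^bsub>Q\<^esub> \<longleftrightarrow> x \<in> N"
proof -
  define rep where "rep x = (SOME y. y \<in> carrier M \<and> x \<ominus>\<^bsub>M\<^esub> y \<in> N)" for x
  note Nc = submodule_carrier[OF N]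
  have refl: "x \<ominus>\<^bsub>M\<^esub> x \<in> N" if "x \<in> carrier M" for x
    using that submodule_zero[OF N] by (simp add: a_minus_def M.r_neg)
  have rep: "rep x \<in> carrier M \<and> x \<ominus>\<^bsub>M\<^esub> rep x \<in> N" if "x \<in> carrier M" for x
  proof -
    have "\<exists>y. y \<in> carrier M \<and> x \<ominus>\<^bsub>M\<^esub> y \<in> N"
      using refl that by blast
    then show ?thesis
      unfolding rep_def by (rule someI_ex)
  qed
  have trans: "x \<ominus>\<^bsub>M\<^esub> z \<in> N" if N': "x \<ominus>\<^bsub>M\<^esub> y \<in> N" "y \<ominus>\<^bsub>M\<^esub> z \<in> N"
    and c: "x \<in> carrier M" "y \<in> carrier M" "z \<in> carrier M" for x y z
  proof -
    have "x \<ominus>\<^bsub>M\<^esub> z = (x \<ominus>\<^bsub>M\<^esub> y) \<oplus>\<^bsub>M\<^esub> (y \<ominus>\<^bsub>M\<^esub> z)"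
      using c by (simp add: a_minus_def M.a_assoc M.r_neg1)
    then show ?thesis
      using submodule_add[OF N N'] by simp
  qed
  have sym: "y \<ominus>\<^bsub>M\<^esub> x \<in> N" if N': "x \<ominus>\<^bsub>M\<^esub> y \<in> N" and c: "x \<in> carrier M" "y \<in> carrier M" for x y
  proof -
    have "y \<ominus>\<^bsub>M\<^esub> x = \<ominus>\<^bsub>M\<^esub> (x \<ominus>\<^bsub>M\<^esub> y)"
      using c by (simp add: a_minus_def M.minus_add M.a_comm)
    then show ?thesis
      using submodule_neg[OF N N'] by simp
  qed
  have rep_eq: "rep x = rep y \<longleftrightarrow> x \<ominus>\<^bsub>M\<^esub> y \<in> N" if c: "x \<in> carrier M" "y \<in> carrier M" for x y
  proof
    assume "rep x = rep y"
    then show "x \<ominus>\<^bsub>M\<^esub> y \<in> N"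
      using rep[OF c(1)] rep[OF c(2)] trans[of x "rep x" y] sym[of y "rep y"] c by simp
  next
    assume xy: "x \<ominus>\<^bsub>M\<^esub> y \<in> N"
    \<comment> \<open>Congruent elements have the same set of admissible representatives, and choice
      from equal sets gives equal results.\<close>
    have "x \<ominus>\<^bsub>M\<^esub> z \<in> N \<longleftrightarrow> y \<ominus>\<^bsub>M\<^esub> z \<in> N" if "z \<in> carrier M" for z
      using trans[OF xy _ c that] trans[OF sym[OF xy c] _ c(2,1) that] by blast
    then show "rep x = rep y"
      unfolding rep_def by (intro arg_cong[of _ _ Eps]) blast
  qed
  have add: "rep (x \<oplus>\<^bsub>M\<^esub> y) = rep (x' \<oplus>\<^bsub>M\<^esub> y')"
    if c: "x \<in> carrier M" "x' \<in> carrier M" "y \<in> carrier M" "y' \<in> carrier M"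
      and eq: "rep x = rep x'" "rep y = rep y'" for x x' y y'
  proof -
    have "(x \<oplus>\<^bsub>M\<^esub> y) \<ominus>\<^bsub>M\<^esub> (x' \<oplus>\<^bsub>M\<^esub> y') = (x \<ominus>\<^bsub>M\<^esub> x') \<oplus>\<^bsub>M\<^esub> (y \<ominus>\<^bsub>M\<^esub> y')"
      using c by (simp add: a_minus_def M.minus_add M.add.m_ac)
    also have "\<dots> \<in> N"
      using eq rep_eq[OF c(1,2)] rep_eq[OF c(3,4)] submodule_add[OF N] by simp
    finally show ?thesis
      using c by (simp add: rep_eq)
  qed
  have smult: "rep (x \<cdot>\<^bsub>M\<^esub> r) = rep (x' \<cdot>\<^bsub>M\<^esub> r)"
    if c: "x \<in> carrier M" "x' \<in> carrier M" "r \<in> carrier R" and eq: "rep x = rep x'" for x x' r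
  proof -
    have "x \<cdot>\<^bsub>M\<^esub> r \<ominus>\<^bsub>M\<^esub> x' \<cdot>\<^bsub>M\<^esub> r = (x \<ominus>\<^bsub>M\<^esub> x') \<cdot>\<^bsub>M\<^esub> r"
      using c by (simp add: a_minus_def smult_add_left smult_minus_left)
    also have "\<dots> \<in> N"
      using eq rep_eq[OF c(1,2)] submodule_smult[OF N _ c(3)] by simp
    finally show ?thesis
      using c by (simp add: rep_eq)
  qed
  show thesis
  proof (rule that[of "image_module rep M" "\<lambda>x\<in>carrier M. rep x"])
    show "is_right_module R (image_module rep M)"
      by (rule image_module_is_right_module[OF add smult])
    show "(\<lambda>x\<in>carrier M. rep x) \<in> module_hom R M (image_module rep M)"
      by (rule image_module_hom[OF add smult])
    have "x \<ominus>\<^bsub>M\<^esub> \<zero>\<^bsub>M\<^esub> = x" if "x \<in> carrier M" for x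
      using that M.minus_equality[of "\<zero>\<^bsub>M\<^esub>" "\<zero>\<^bsub>M\<^esub>"] by (simp add: M.minus_eq)
    then show "\<forall>x\<in>carrier M. (\<lambda>x\<in>carrier M. rep x) x = \<zero>\<^bsub>image_module rep M\<^esub> \<longleftrightarrow> x \<in> N"
      by (simp add: image_module_simps[OF add smult] rep_eq)
  qed
qed

text \<open>Needed because the functors act only on modules over the universe type, whereas
  \<open>M\<close> may have elements of any type.\<close>

lemma ex_copy:
  fixes \<iota> :: "'m \<Rightarrow> 'u"
  assumes "inj \<iota>"
  obtains M' :: "('u, 'r) right_module" and \<phi> \<psi> where "is_right_module R M'"
    "\<phi> \<in> module_hom R M' M" "\<psi> \<in> module_hom R M M'"
    "\<forall>x\<in>carrier M. \<phi> (\<psi> x) = x" "\<forall>x\<in>carrier M'. \<psi> (\<phi> x) = x"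
proof -
  have eq: "\<iota> x = \<iota> y \<longleftrightarrow> x = y" for x y
    using assms by (auto dest: injD)
  define M' where "M' = image_module \<iota> M"
  define \<psi> where "\<psi> = (\<lambda>x\<in>carrier M. \<iota> x)"
  have M': "is_right_module R M'"
    unfolding M'_def by (rule image_module_is_right_module) (auto simp: eq)
  have \<psi>: "\<psi> \<in> module_hom R M M'"
    unfolding M'_def \<psi>_def by (rule image_module_hom) (auto simp: eq)
  have "carrier M' = \<iota> ` carrier M"
    unfolding M'_def by (rule image_module_simps) (auto simp: eq)
  then have "bij_betw \<psi> (carrier M) (carrier M')"
    unfolding \<psi>_def bij_betw_def inj_on_def by (auto simp: eq)
  then obtain \<phi> where "\<phi> \<in> module_hom R M' M" "\<And>x. x \<in> carrier M \<Longrightarrow> \<phi> (\<psi> x) = x"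
    "\<And>y. y \<in> carrier M' \<Longrightarrow> \<psi> (\<phi> y) = y"
    using bij_module_hom_inv[OF right_module \<psi>] by metis
  then show thesis
    using that M' \<psi> by blast
qed

end


section \<open>Categorical forms of the Baer conditions\<close>

abbreviation zero_hom :: "('m, 'r) right_module \<Rightarrow> ('n, 'r) right_module \<Rightarrow> 'm \<Rightarrow> 'n" where
  "zero_hom M N \<equiv> \<lambda>x\<in>carrier M. \<zero>\<^bsub>N\<^esub>"

text \<open>The map \<open>e\<close> is a projection onto the joint kernel of \<open>X\<close>,
  expressed by the universal property: whatever is killed by \<open>X\<close> factors through
  \<open>e\<close>. The test objects \<open>L\<close> have the type of \<open>M\<close>, which
  accommodates all its submodules.\<close>

definition categorical_baer :: "('r, 'x) ring_scheme \<Rightarrow> ('u, 'r) right_module \<Rightarrow> bool" where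
  "categorical_baer R M \<longleftrightarrow> (\<forall>X. X \<subseteq> module_hom R M M \<longrightarrow> X \<noteq> {} \<longrightarrow>
    (\<exists>e\<in>module_hom R M M. (\<forall>f\<in>X. compose (carrier M) f e = zero_hom M M) \<and>
      (\<forall>(L :: ('u, 'r) right_module) h. is_right_module R L \<longrightarrow> h \<in> module_hom R L M \<longrightarrow>
        (\<forall>f\<in>X. compose (carrier L) f h = zero_hom L M) \<longrightarrow> compose (carrier L) e h = h)))"

text \<open>Here the image of \<open>e\<close> is the sum of the images of the members of
  \<open>X\<close>: it contains them as \<open>e f = f\<close>, and it is no larger because every
  \<open>h\<close> vanishing on them vanishes on it.\<close>

definition categorical_dual_baer :: "('r, 'x) ring_scheme \<Rightarrow> ('u, 'r) right_module \<Rightarrow> bool" where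
  "categorical_dual_baer R M \<longleftrightarrow> (\<forall>X. X \<subseteq> module_hom R M M \<longrightarrow> X \<noteq> {} \<longrightarrow>
    (\<exists>e\<in>module_hom R M M. (\<forall>f\<in>X. compose (carrier M) e f = f) \<and>
      (\<forall>(L :: ('u, 'r) right_module) h. is_right_module R L \<longrightarrow> h \<in> module_hom R M L \<longrightarrow>
        (\<forall>f\<in>X. compose (carrier M) h f = zero_hom M L) \<longrightarrow> compose (carrier M) h e = zero_hom M L)))"

lemma compose_eq_iff:
  assumes "f \<in> extensional A"
  shows "compose A g h = f \<longleftrightarrow> (\<forall>x\<in>A. g (h x) = f x)"
  using assms by (auto simp: fun_eq_iff compose_def extensional_def)

lemma compose_eq_zero_hom_iff:
  "compose (carrier M) g h = zero_hom M N \<longleftrightarrow> (\<forall>x\<in>carrier M. g (h x) = \<zero>\<^bsub>N\<^esub>)"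
  by (subst compose_eq_iff) auto

text \<open>Besides forgetting elements, this crosses types: endomorphisms of \<open>M'\<close> are
  conjugated to \<open>M\<close> by \<open>\<phi>\<close> and \<open>\<psi>\<close>, and the
  projection found there is conjugated back.\<close>

lemma baer_imp_categorical_baer:
  fixes M :: "('m, 'r) right_module" and M' :: "('u, 'r) right_module"
  assumes M: "is_right_module R M" and M': "is_right_module R M'"
    and \<phi>: "\<phi> \<in> module_hom R M' M" and \<psi>: "\<psi> \<in> module_hom R M M'"
    and \<psi>\<phi>: "\<forall>x\<in>carrier M'. \<psi> (\<phi> x) = x"
    and baer: "baer_module R M"
  shows "categorical_baer R M'"
  unfolding categorical_baer_def
proof (intro allI impI)
  fix X assume X: "X \<subseteq> module_hom R M' M'" "X \<noteq> {}"
  interpret M: right_module_over R M by unfold_locales (rule M)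
  note c\<phi> = module_hom_closed[OF \<phi>]
  define conj where "conj f = compose (carrier M) \<phi> (compose (carrier M) f \<psi>)" for f
  have conj: "conj f \<in> module_hom R M M" if "f \<in> module_hom R M' M'" for f
    unfolding conj_def using module_hom_compose[OF M module_hom_compose[OF M \<psi> that] \<phi>] .
  have conj_app: "conj f x = \<phi> (f (\<psi> x))" if "x \<in> carrier M" for f x
    using that by (simp add: conj_def compose_eq)
  have "conj ` X \<subseteq> module_hom R M M" "conj ` X \<noteq> {}"
    using X conj by auto
  then obtain p where p: "p \<in> module_hom R M M" "\<forall>g\<in>conj ` X. \<forall>x\<in>carrier M. g (p x) = \<zero>\<^bsub>M\<^esub>"
    "\<forall>x\<in>carrier M. (\<forall>g\<in>conj ` X. g x = \<zero>\<^bsub>M\<^esub>) \<longrightarrow> p x = x"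
    using baer[unfolded M.baer_iff_projection, rule_format, of "conj ` X"] by blast
  note cp = module_hom_closed[OF p(1)]
  define e where "e = compose (carrier M') \<psi> (compose (carrier M') p \<phi>)"
  have e: "e \<in> module_hom R M' M'"
    unfolding e_def using module_hom_compose[OF M' module_hom_compose[OF M' \<phi> p(1)] \<psi>] .
  have e_app: "e x = \<psi> (p (\<phi> x))" if "x \<in> carrier M'" for x
    using that by (simp add: e_def compose_eq)
  show "\<exists>e\<in>module_hom R M' M'. (\<forall>f\<in>X. compose (carrier M') f e = zero_hom M' M') \<and>
      (\<forall>(L :: ('u, 'r) right_module) h. is_right_module R L \<longrightarrow> h \<in> module_hom R L M' \<longrightarrow>
        (\<forall>f\<in>X. compose (carrier L) f h = zero_hom L M') \<longrightarrow> compose (carrier L) e h = h)"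
  proof (intro bexI[OF _ e] conjI ballI allI impI)
    fix f assume f: "f \<in> X"
    have "f (e x) = \<zero>\<^bsub>M'\<^esub>" if x: "x \<in> carrier M'" for x
    proof -
      have "\<phi> (f (e x)) = conj f (p (\<phi> x))"
        using x c\<phi> cp by (simp add: conj_app e_app)
      also have "\<dots> = \<zero>\<^bsub>M\<^esub>"
        using p(2) f c\<phi>[OF x] by blast
      finally have "\<psi> (\<phi> (f (e x))) = \<zero>\<^bsub>M'\<^esub>"
        using module_hom_zero[OF M M' \<psi>] by simp
      then show ?thesis
        using \<psi>\<phi> f X module_hom_closed[of f R M' M'] module_hom_closed[OF e x] by auto
    qed
    then show "compose (carrier M') f e = zero_hom M' M'"
      by (simp add: compose_eq_zero_hom_iff)
  next
    fix L :: "('u, 'r) right_module" and h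
    assume L: "is_right_module R L" and h: "h \<in> module_hom R L M'"
      and fh: "\<forall>f\<in>X. compose (carrier L) f h = zero_hom L M'"
    have "e (h x) = h x" if x: "x \<in> carrier L" for x
    proof -
      note hx = module_hom_closed[OF h x]
      have "g (\<phi> (h x)) = \<zero>\<^bsub>M\<^esub>" if g: "g \<in> conj ` X" for g
      proof -
        obtain f where f: "f \<in> X" "g = conj f"
          using g by blast
        then have "f (h x) = \<zero>\<^bsub>M'\<^esub>"
          using fh x by (simp add: compose_eq_zero_hom_iff)
        then show ?thesis
          using f(2) conj_app[OF c\<phi>[OF hx]] \<psi>\<phi> hx module_hom_zero[OF M' M \<phi>] by simp
      qed
      then have "p (\<phi> (h x)) = \<phi> (h x)"
        using p(3) c\<phi>[OF hx] by blast
      then show ?thesis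
        using e_app[OF hx] \<psi>\<phi> hx by simp
    qed
    then show "compose (carrier L) e h = h"
      by (simp add: compose_eq_iff[OF module_hom_extensional[OF h]])
  qed
qed

text \<open>The universal property is tested on the inclusion of the joint kernel.\<close>

lemma categorical_baer_imp_baer:
  fixes M :: "('u, 'r) right_module"
  assumes M: "is_right_module R M" and baer: "categorical_baer R M"
  shows "baer_module R M"
proof -
  interpret right_module_over R M by unfold_locales (rule M)
  show ?thesis
    unfolding baer_iff_projection
  proof (intro allI impI)
    fix X assume X: "X \<subseteq> module_hom R M M" "X \<noteq> {}"
    obtain e where e: "e \<in> module_hom R M M" "\<forall>f\<in>X. compose (carrier M) f e = zero_hom M M"
      and univ: "\<forall>(L :: ('u, 'r) right_module) h. is_right_module R L \<longrightarrow> h \<in> module_hom R L M \<longrightarrow>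
        (\<forall>f\<in>X. compose (carrier L) f h = zero_hom L M) \<longrightarrow> compose (carrier L) e h = h"
      using baer[unfolded categorical_baer_def, rule_format, OF X] by blast
    define K where "K = (\<Inter>f\<in>X. hom_kernel M M f)"
    have K: "submodule_of R M K"
      unfolding K_def using X hom_kernel_submodule[OF M M] by (intro submodule_Inter) auto
    have K_iff: "x \<in> K \<longleftrightarrow> x \<in> carrier M \<and> (\<forall>f\<in>X. f x = \<zero>\<^bsub>M\<^esub>)" for x
      unfolding K_def hom_kernel_def using X(2) by auto
    have "compose (carrier (M\<lparr>carrier := K\<rparr>)) f (\<lambda>x\<in>K. x) = zero_hom (M\<lparr>carrier := K\<rparr>) M" if "f \<in> X" for f
      using that K_iff by (subst compose_eq_zero_hom_iff) simp
    then have eq: "compose (carrier (M\<lparr>carrier := K\<rparr>)) e (\<lambda>x\<in>K. x) = (\<lambda>x\<in>K. x)"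
      using univ submodule_is_right_module[OF K] submodule_inclusion_hom[OF M K] by blast
    have "e x = x" if "x \<in> K" for x
      using that fun_cong[OF eq, of x] by (simp add: compose_def)
    then have "\<forall>x\<in>carrier M. (\<forall>f\<in>X. f x = \<zero>\<^bsub>M\<^esub>) \<longrightarrow> e x = x"
      using K_iff by blast
    moreover have "\<forall>f\<in>X. \<forall>x\<in>carrier M. f (e x) = \<zero>\<^bsub>M\<^esub>"
      using e(2) by (simp add: compose_eq_zero_hom_iff)
    ultimately show "\<exists>e\<in>module_hom R M M. (\<forall>f\<in>X. \<forall>x\<in>carrier M. f (e x) = \<zero>\<^bsub>M\<^esub>) \<and>
        (\<forall>x\<in>carrier M. (\<forall>f\<in>X. f x = \<zero>\<^bsub>M\<^esub>) \<longrightarrow> e x = x)"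
      using e(1) by blast
  qed
qed

text \<open>The dual Baer condition is applied to the submodule \<open>N\<close> generated by all
  images of \<open>X\<close>, transported to \<open>M\<close>. A morphism killing \<open>X\<close>
  vanishes on \<open>N\<close>, since its kernel is a submodule containing the generators.\<close>

lemma dual_baer_imp_categorical_dual_baer:
  fixes M :: "('m, 'r) right_module" and M' :: "('u, 'r) right_module"
  assumes M: "is_right_module R M" and M': "is_right_module R M'"
    and \<phi>: "\<phi> \<in> module_hom R M' M" and \<psi>: "\<psi> \<in> module_hom R M M'"
    and \<psi>\<phi>: "\<forall>x\<in>carrier M'. \<psi> (\<phi> x) = x"
    and baer: "dual_baer_module R M"
  shows "categorical_dual_baer R M'"
  unfolding categorical_dual_baer_def
proof (intro allI impI)
  fix X assume X: "X \<subseteq> module_hom R M' M'" "X \<noteq> {}"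
  interpret M: right_module_over R M by unfold_locales (rule M)
  note c\<phi> = module_hom_closed[OF \<phi>] and c\<psi> = module_hom_closed[OF \<psi>]
  define N where "N = submodule_span R M {\<phi> (f x) | f x. f \<in> X \<and> x \<in> carrier M'}"
  have N: "submodule_of R M N"
    unfolding N_def
  proof (rule M.submodule_span_submodule)
    show "{\<phi> (f x) | f x. f \<in> X \<and> x \<in> carrier M'} \<subseteq> carrier M"
      using X c\<phi> module_hom_closed[of _ R M' M'] by (auto simp: subset_iff)
  qed
  have mem_N: "\<phi> (f x) \<in> N" if "f \<in> X" "x \<in> carrier M'" for f x
    unfolding N_def using that by (intro subsetD[OF M.submodule_span_upper]) blast
  obtain p where p: "p \<in> module_hom R M M" "\<forall>x\<in>carrier M. p x \<in> N"
    "\<forall>f\<in>module_hom R M M. (\<forall>x\<in>carrier M. f x \<in> N) \<longrightarrow> (\<forall>x\<in>carrier M. p (f x) = f x)"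
    using baer N unfolding M.dual_baer_iff_projection by blast
  note cp = module_hom_closed[OF p(1)]
  define e where "e = compose (carrier M') \<psi> (compose (carrier M') p \<phi>)"
  have e: "e \<in> module_hom R M' M'"
    unfolding e_def using module_hom_compose[OF M' module_hom_compose[OF M' \<phi> p(1)] \<psi>] .
  have e_app: "e x = \<psi> (p (\<phi> x))" if "x \<in> carrier M'" for x
    using that by (simp add: e_def compose_eq)
  show "\<exists>e\<in>module_hom R M' M'. (\<forall>f\<in>X. compose (carrier M') e f = f) \<and>
      (\<forall>(L :: ('u, 'r) right_module) h. is_right_module R L \<longrightarrow> h \<in> module_hom R M' L \<longrightarrow>
        (\<forall>f\<in>X. compose (carrier M') h f = zero_hom M' L) \<longrightarrow> compose (carrier M') h e = zero_hom M' L)"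
  proof (intro bexI[OF _ e] conjI ballI allI impI)
    fix f assume f: "f \<in> X"
    then have f': "f \<in> module_hom R M' M'"
      using X by blast
    define g where "g = compose (carrier M) \<phi> (compose (carrier M) f \<psi>)"
    have g: "g \<in> module_hom R M M"
      unfolding g_def using module_hom_compose[OF M module_hom_compose[OF M \<psi> f'] \<phi>] .
    have g_app: "g x = \<phi> (f (\<psi> x))" if "x \<in> carrier M" for x
      using that by (simp add: g_def compose_eq)
    have "\<forall>x\<in>carrier M. g x \<in> N"
      using mem_N[OF f] c\<psi> by (simp add: g_app)
    then have pg: "\<forall>x\<in>carrier M. p (g x) = g x"
      using p(3) g by blast
    have "e (f x) = f x" if x: "x \<in> carrier M'" for x
    proof -
      have "g (\<phi> x) = \<phi> (f x)"
        using g_app c\<phi> x \<psi>\<phi> by simp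
      then have "p (\<phi> (f x)) = \<phi> (f x)"
        using pg c\<phi>[OF x] by metis
      then show ?thesis
        using e_app \<psi>\<phi> module_hom_closed[OF f' x] by simp
    qed
    then show "compose (carrier M') e f = f"
      by (simp add: compose_eq_iff[OF module_hom_extensional[OF f']])
  next
    fix L :: "('u, 'r) right_module" and h
    assume L: "is_right_module R L" and h: "h \<in> module_hom R M' L"
      and hf: "\<forall>f\<in>X. compose (carrier M') h f = zero_hom M' L"
    have h\<psi>: "compose (carrier M) h \<psi> \<in> module_hom R M L"
      using module_hom_compose[OF M \<psi> h] .
    have "N \<subseteq> hom_kernel M L (compose (carrier M) h \<psi>)"
      unfolding N_def
    proof (rule M.submodule_span_least[OF hom_kernel_submodule[OF M L h\<psi>]], safe)
      fix f x assume f: "f \<in> X" and x: "x \<in> carrier M'"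
      have "h (f x) = \<zero>\<^bsub>L\<^esub>"
        using hf f x by (simp add: compose_eq_zero_hom_iff)
      moreover have "f x \<in> carrier M'"
        using module_hom_closed[of f R M' M'] f x X by blast
      ultimately show "\<phi> (f x) \<in> hom_kernel M L (compose (carrier M) h \<psi>)"
        using c\<phi> \<psi>\<phi> by (simp add: hom_kernel_def compose_eq)
    qed
    then have "compose (carrier M) h \<psi> (p (\<phi> x)) = \<zero>\<^bsub>L\<^esub>" if "x \<in> carrier M'" for x
      using p(2) c\<phi>[OF that] by (auto simp: hom_kernel_def)
    then have "h (e x) = \<zero>\<^bsub>L\<^esub>" if "x \<in> carrier M'" for x
      using that by (simp add: e_app cp c\<phi> compose_eq)
    then show "compose (carrier M') h e = zero_hom M' L"
      by (simp add: compose_eq_zero_hom_iff)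
  qed
qed

text \<open>Take for \<open>X\<close> all endomorphisms into \<open>N\<close> and test on the
  quotient map by \<open>N\<close>. This is where a quotient on the type of \<open>M\<close> itself
  is required.\<close>

lemma categorical_dual_baer_imp_dual_baer:
  fixes M :: "('u, 'r) right_module"
  assumes M: "is_right_module R M" and baer: "categorical_dual_baer R M"
  shows "dual_baer_module R M"
proof -
  interpret right_module_over R M by unfold_locales (rule M)
  show ?thesis
    unfolding dual_baer_iff_projection
  proof (intro allI impI)
    fix N assume N: "submodule_of R M N"
    define X where "X = {f \<in> module_hom R M M. \<forall>x\<in>carrier M. f x \<in> N}"
    have "zero_hom M M \<in> X"
      using module_hom_const_zero[OF M M] submodule_zero[OF N] by (simp add: X_def)
    then have X: "X \<subseteq> module_hom R M M" "X \<noteq> {}"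
      by (auto simp: X_def)
    obtain e where e: "e \<in> module_hom R M M" "\<forall>f\<in>X. compose (carrier M) e f = f"
      and univ: "\<forall>(L :: ('u, 'r) right_module) h. is_right_module R L \<longrightarrow> h \<in> module_hom R M L \<longrightarrow>
        (\<forall>f\<in>X. compose (carrier M) h f = zero_hom M L) \<longrightarrow> compose (carrier M) h e = zero_hom M L"
      using baer[unfolded categorical_dual_baer_def, rule_format, OF X] by blast
    obtain Q :: "('u, 'r) right_module" and q where Q: "is_right_module R Q" "q \<in> module_hom R M Q"
      and q: "\<forall>x\<in>carrier M. q x = \<zero>\<^bsub>Q\<^esub> \<longleftrightarrow> x \<in> N"
      by (rule ex_quotient_hom[OF N])
    have "compose (carrier M) q f = zero_hom M Q" if "f \<in> X" for f
      using that q module_hom_closed[of f R M M] by (simp add: compose_eq_zero_hom_iff X_def)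
    then have "compose (carrier M) q e = zero_hom M Q"
      using univ Q by blast
    then have "\<forall>x\<in>carrier M. e x \<in> N"
      using q module_hom_closed[OF e(1)] by (simp add: compose_eq_zero_hom_iff)
    moreover have "e (f x) = f x"
      if "f \<in> module_hom R M M" "\<forall>x\<in>carrier M. f x \<in> N" "x \<in> carrier M" for f x
      using e(2) that compose_eq[of x "carrier M" e f] by (simp add: X_def)
    ultimately show "\<exists>e\<in>module_hom R M M. (\<forall>x\<in>carrier M. e x \<in> N) \<and>
        (\<forall>f\<in>module_hom R M M. (\<forall>x\<in>carrier M. f x \<in> N) \<longrightarrow> (\<forall>x\<in>carrier M. e (f x) = f x))"
      using e(1) by blast
  qed
qed

text \<open>Project onto the image, then invert \<open>i\<close> there. This turns a summand into a
  split injection, a notion the functor can carry.\<close>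

lemma direct_summand_image_retraction:
  assumes N: "is_right_module R N" and M: "is_right_module R M"
    and i: "i \<in> module_hom R N M" "inj_on i (carrier N)"
    and ds: "direct_summand R M (i ` carrier N)"
  obtains r where "r \<in> module_hom R M N" "\<forall>x\<in>carrier N. r (i x) = x"
proof -
  interpret M: right_module_over R M by unfold_locales (rule M)
  interpret N: right_module_over R N by unfold_locales (rule N)
  obtain p where p: "p \<in> module_hom R M M" "\<forall>y\<in>carrier M. p y \<in> i ` carrier N"
    "\<forall>y\<in>i ` carrier N. p y = y"
    using ds unfolding M.direct_summand_iff_projection by blast
  define r where "r = (\<lambda>y\<in>carrier M. inv_into (carrier N) i (p y))"
  have rc: "r y \<in> carrier N" and ir: "i (r y) = p y" if "y \<in> carrier M" for y
    using that p(2) by (auto simp: r_def f_inv_into_f inv_into_into)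
  note inj = inj_onD[OF i(2)]
  have "r \<in> module_hom R M N"
  proof (rule module_homI)
    show "r \<in> carrier M \<rightarrow>\<^sub>E carrier N"
      using rc by (auto simp: r_def)
    show "r (y \<oplus>\<^bsub>M\<^esub> z) = r y \<oplus>\<^bsub>N\<^esub> r z" if "y \<in> carrier M" "z \<in> carrier M" for y z
      using that by (intro inj) (simp_all add: ir rc module_hom_add[OF i(1)] module_hom_add[OF p(1)])
    show "r (y \<cdot>\<^bsub>M\<^esub> s) = r y \<cdot>\<^bsub>N\<^esub> s" if "y \<in> carrier M" "s \<in> carrier R" for y s
      using that by (intro inj) (simp_all add: ir rc module_hom_smult[OF i(1)] module_hom_smult[OF p(1)])
  qed
  moreover have "\<forall>x\<in>carrier N. r (i x) = x"
    using p(3) i(2) module_hom_closed[OF i(1)] by (simp add: r_def)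
  ultimately show thesis
    by (rule that)
qed

section \<open>Transfer along an equivalence of module categories\<close>

text \<open>What the transfer uses of an equivalence. The inverse functor and the natural
  isomorphisms are consumed once, in
  \<open>module_equivalence_of_categories_equivalent\<close>.\<close>

locale module_equivalence =
  fixes R :: "('r, 'x) ring_scheme" and T :: "('t, 'y) ring_scheme"
    and Fo :: "('u, 'r, 't) ob_map" and Fm :: "('u, 'r) mor_map"
  assumes is_functor: "module_functor R T Fo Fm"
    and faithful: "\<And>M N f g. \<lbrakk>is_right_module R M; is_right_module R N; f \<in> module_hom R M N;
      g \<in> module_hom R M N; Fm M N f = Fm M N g\<rbrakk> \<Longrightarrow> f = g"
    and full: "\<And>M N g. \<lbrakk>is_right_module R M; is_right_module R N; g \<in> module_hom T (Fo M) (Fo N)\<rbrakk>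
      \<Longrightarrow> \<exists>f\<in>module_hom R M N. Fm M N f = g"
    and Fm_zero: "\<And>M N. \<lbrakk>is_right_module R M; is_right_module R N\<rbrakk>
      \<Longrightarrow> Fm M N (zero_hom M N) = zero_hom (Fo M) (Fo N)"
    and essentially_surjective: "\<And>L :: ('u, 't) right_module. is_right_module T L \<Longrightarrow>
      \<exists>K \<epsilon>. is_right_module R K \<and> \<epsilon> \<in> module_hom T L (Fo K) \<and> bij_betw \<epsilon> (carrier L) (carrier (Fo K))"
begin

lemma Fo_module: "is_right_module R M \<Longrightarrow> is_right_module T (Fo M)"
  using is_functor by (simp add: module_functor_def)

lemma Fm_hom:
  "\<lbrakk>is_right_module R M; is_right_module R N; f \<in> module_hom R M N\<rbrakk> \<Longrightarrow> Fm M N f \<in> module_hom T (Fo M) (Fo N)"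
  using is_functor by (simp add: module_functor_def)

lemma Fm_id: "is_right_module R M \<Longrightarrow> Fm M M (\<lambda>x\<in>carrier M. x) = (\<lambda>x\<in>carrier (Fo M). x)"
  using is_functor by (simp add: module_functor_def)

lemma Fm_compose:
  "\<lbrakk>is_right_module R L; is_right_module R M; is_right_module R N; f \<in> module_hom R L M; g \<in> module_hom R M N\<rbrakk>
    \<Longrightarrow> Fm L N (compose (carrier L) g f) = compose (carrier (Fo L)) (Fm M N g) (Fm L M f)"
  using is_functor unfolding module_functor_def by blast

lemma ex_iso_preimage:
  fixes L :: "('u, 't) right_module"
  assumes "is_right_module T L"
  obtains K \<epsilon> \<epsilon>' where "is_right_module R K" "\<epsilon> \<in> module_hom T L (Fo K)" "\<epsilon>' \<in> module_hom T (Fo K) L"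
    "\<forall>x\<in>carrier L. \<epsilon>' (\<epsilon> x) = x"
proof -
  obtain K \<epsilon> where K: "is_right_module R K" and \<epsilon>: "\<epsilon> \<in> module_hom T L (Fo K)"
    and bij: "bij_betw \<epsilon> (carrier L) (carrier (Fo K))"
    using essentially_surjective[OF assms] by blast
  obtain \<epsilon>' where "\<epsilon>' \<in> module_hom T (Fo K) L" "\<And>x. x \<in> carrier L \<Longrightarrow> \<epsilon>' (\<epsilon> x) = x"
    using bij_module_hom_inv[OF assms \<epsilon> bij] by metis
  then show thesis
    using that K \<epsilon> by blast
qed

text \<open>By fullness \<open>X\<close> is the image of a set \<open>Y\<close> of endomorphisms of
  \<open>M\<close>, and the image of the projection for \<open>Y\<close> serves for
  \<open>X\<close>. A test object over \<open>T\<close> is isomorphic to some \<open>Fo K\<close>,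
  so the test morphism comes from one over \<open>R\<close>, and faithfulness reflects the vanishing
  of composites.\<close>

lemma categorical_baer_Fo:
  assumes M: "is_right_module R M" and baer: "categorical_baer R M"
  shows "categorical_baer T (Fo M)"
  unfolding categorical_baer_def
proof (intro allI impI)
  fix X assume X: "X \<subseteq> module_hom T (Fo M) (Fo M)" "X \<noteq> {}"
  define Y where "Y = {f \<in> module_hom R M M. Fm M M f \<in> X}"
  have X_eq: "\<exists>f\<in>Y. g = Fm M M f" if "g \<in> X" for g
    using full[OF M M, of g] X that by (auto simp: Y_def)
  then have Y: "Y \<subseteq> module_hom R M M" "Y \<noteq> {}"
    using X by (auto simp: Y_def)
  obtain e where e: "e \<in> module_hom R M M" "\<forall>f\<in>Y. compose (carrier M) f e = zero_hom M M"
    and univ: "\<forall>(L :: ('u, 'r) right_module) h. is_right_module R L \<longrightarrow> h \<in> module_hom R L M \<longrightarrow>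
      (\<forall>f\<in>Y. compose (carrier L) f h = zero_hom L M) \<longrightarrow> compose (carrier L) e h = h"
    using baer[unfolded categorical_baer_def, rule_format, OF Y] by blast
  show "\<exists>e\<in>module_hom T (Fo M) (Fo M). (\<forall>f\<in>X. compose (carrier (Fo M)) f e = zero_hom (Fo M) (Fo M)) \<and>
    (\<forall>(L :: ('u, 't) right_module) h. is_right_module T L \<longrightarrow> h \<in> module_hom T L (Fo M) \<longrightarrow>
      (\<forall>f\<in>X. compose (carrier L) f h = zero_hom L (Fo M)) \<longrightarrow> compose (carrier L) e h = h)"
  proof (intro bexI[OF _ Fm_hom[OF M M e(1)]] conjI ballI allI impI)
    fix g assume "g \<in> X"
    then obtain f where f: "f \<in> Y" "g = Fm M M f"
      using X_eq by blast
    then have "compose (carrier (Fo M)) g (Fm M M e) = Fm M M (compose (carrier M) f e)"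
      using Fm_compose[OF M M M e(1)] Y by auto
    also have "\<dots> = zero_hom (Fo M) (Fo M)"
      using e(2) f(1) Fm_zero[OF M M] by simp
    finally show "compose (carrier (Fo M)) g (Fm M M e) = zero_hom (Fo M) (Fo M)" .
  next
    fix L :: "('u, 't) right_module" and h
    assume L: "is_right_module T L" and h: "h \<in> module_hom T L (Fo M)"
      and gh: "\<forall>g\<in>X. compose (carrier L) g h = zero_hom L (Fo M)"
    obtain K \<epsilon> \<epsilon>' where K: "is_right_module R K" and \<epsilon>: "\<epsilon> \<in> module_hom T L (Fo K)"
      and \<epsilon>': "\<epsilon>' \<in> module_hom T (Fo K) L" and inv: "\<forall>x\<in>carrier L. \<epsilon>' (\<epsilon> x) = x"
      by (rule ex_iso_preimage[OF L])
    \<comment> \<open>The isomorphism is inserted in front of \<open>h\<close>, whose domain is not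
      literally of the form \<open>Fo K\<close>; it is removed at the end by evaluating at
      \<open>\<epsilon> x\<close>.\<close>
    obtain k where k: "k \<in> module_hom R K M" "Fm K M k = compose (carrier (Fo K)) h \<epsilon>'"
      using full[OF K M module_hom_compose[OF Fo_module[OF K] \<epsilon>' h]] by blast
    have "compose (carrier K) f k = zero_hom K M" if f: "f \<in> Y" for f
    proof (rule faithful[OF K M])
      have f': "f \<in> module_hom R M M" "Fm M M f \<in> X"
        using f by (auto simp: Y_def)
      show "compose (carrier K) f k \<in> module_hom R K M"
        using module_hom_compose[OF K k(1) f'(1)] .
      show "zero_hom K M \<in> module_hom R K M"
        by (rule module_hom_const_zero[OF K M])
      have "Fm M M f (h x) = \<zero>\<^bsub>Fo M\<^esub>" if "x \<in> carrier L" for x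
        using gh f'(2) that by (simp add: compose_eq_zero_hom_iff)
      then have "compose (carrier (Fo K)) (Fm M M f) (Fm K M k) = zero_hom (Fo K) (Fo M)"
        unfolding k(2) compose_eq_zero_hom_iff using module_hom_closed[OF \<epsilon>'] by (simp add: compose_eq)
      then show "Fm K M (compose (carrier K) f k) = Fm K M (zero_hom K M)"
        using Fm_compose[OF K M M k(1) f'(1)] Fm_zero[OF K M] by simp
    qed
    then have "compose (carrier K) e k = k"
      using univ K k(1) by blast
    then have eq: "compose (carrier (Fo K)) (Fm M M e) (Fm K M k) = Fm K M k"
      using Fm_compose[OF K M M k(1) e(1)] by simp
    have "Fm M M e (h x) = h x" if x: "x \<in> carrier L" for x
      using fun_cong[OF eq, of "\<epsilon> x"] inv x module_hom_closed[OF \<epsilon> x] by (simp add: k(2) compose_eq)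
    then show "compose (carrier L) (Fm M M e) h = h"
      by (simp add: compose_eq_iff[OF module_hom_extensional[OF h]])
  qed
qed

text \<open>As before, but the test morphisms now start at \<open>Fo M\<close>, so the isomorphism
  is attached behind \<open>h\<close> and cancelled by \<open>\<epsilon>'\<close>.\<close>

lemma categorical_dual_baer_Fo:
  assumes M: "is_right_module R M" and baer: "categorical_dual_baer R M"
  shows "categorical_dual_baer T (Fo M)"
  unfolding categorical_dual_baer_def
proof (intro allI impI)
  fix X assume X: "X \<subseteq> module_hom T (Fo M) (Fo M)" "X \<noteq> {}"
  define Y where "Y = {f \<in> module_hom R M M. Fm M M f \<in> X}"
  have X_eq: "\<exists>f\<in>Y. g = Fm M M f" if "g \<in> X" for g
    using full[OF M M, of g] X that by (auto simp: Y_def)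
  then have Y: "Y \<subseteq> module_hom R M M" "Y \<noteq> {}"
    using X by (auto simp: Y_def)
  obtain e where e: "e \<in> module_hom R M M" "\<forall>f\<in>Y. compose (carrier M) e f = f"
    and univ: "\<forall>(L :: ('u, 'r) right_module) h. is_right_module R L \<longrightarrow> h \<in> module_hom R M L \<longrightarrow>
      (\<forall>f\<in>Y. compose (carrier M) h f = zero_hom M L) \<longrightarrow> compose (carrier M) h e = zero_hom M L"
    using baer[unfolded categorical_dual_baer_def, rule_format, OF Y] by blast
  show "\<exists>e\<in>module_hom T (Fo M) (Fo M). (\<forall>f\<in>X. compose (carrier (Fo M)) e f = f) \<and>
    (\<forall>(L :: ('u, 't) right_module) h. is_right_module T L \<longrightarrow> h \<in> module_hom T (Fo M) L \<longrightarrow>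
      (\<forall>f\<in>X. compose (carrier (Fo M)) h f = zero_hom (Fo M) L) \<longrightarrow>
      compose (carrier (Fo M)) h e = zero_hom (Fo M) L)"
  proof (intro bexI[OF _ Fm_hom[OF M M e(1)]] conjI ballI allI impI)
    fix g assume "g \<in> X"
    then obtain f where f: "f \<in> Y" "g = Fm M M f"
      using X_eq by blast
    then have f': "f \<in> module_hom R M M"
      using Y by blast
    show "compose (carrier (Fo M)) (Fm M M e) g = g"
      using Fm_compose[OF M M M f' e(1)] e(2) f by simp
  next
    fix L :: "('u, 't) right_module" and h
    assume L: "is_right_module T L" and h: "h \<in> module_hom T (Fo M) L"
      and hg: "\<forall>g\<in>X. compose (carrier (Fo M)) h g = zero_hom (Fo M) L"
    obtain K \<epsilon> \<epsilon>' where K: "is_right_module R K" and \<epsilon>: "\<epsilon> \<in> module_hom T L (Fo K)"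
      and \<epsilon>': "\<epsilon>' \<in> module_hom T (Fo K) L" and inv: "\<forall>x\<in>carrier L. \<epsilon>' (\<epsilon> x) = x"
      by (rule ex_iso_preimage[OF L])
    obtain k where k: "k \<in> module_hom R M K" "Fm M K k = compose (carrier (Fo M)) \<epsilon> h"
      using full[OF M K module_hom_compose[OF Fo_module[OF M] h \<epsilon>]] by blast
    have "compose (carrier M) k f = zero_hom M K" if f: "f \<in> Y" for f
    proof (rule faithful[OF M K])
      have f': "f \<in> module_hom R M M" "Fm M M f \<in> X"
        using f by (auto simp: Y_def)
      show "compose (carrier M) k f \<in> module_hom R M K"
        using module_hom_compose[OF M f'(1) k(1)] .
      show "zero_hom M K \<in> module_hom R M K"
        by (rule module_hom_const_zero[OF M K])
      have "h (Fm M M f x) = \<zero>\<^bsub>L\<^esub>" if "x \<in> carrier (Fo M)" for x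
        using hg f'(2) that by (simp add: compose_eq_zero_hom_iff)
      then have "compose (carrier (Fo M)) (Fm M K k) (Fm M M f) = zero_hom (Fo M) (Fo K)"
        unfolding k(2) compose_eq_zero_hom_iff
        using module_hom_closed[OF Fm_hom[OF M M f'(1)]] module_hom_zero[OF L Fo_module[OF K] \<epsilon>]
        by (simp add: compose_eq)
      then show "Fm M K (compose (carrier M) k f) = Fm M K (zero_hom M K)"
        using Fm_compose[OF M M K f'(1) k(1)] Fm_zero[OF M K] by simp
    qed
    then have "compose (carrier M) k e = zero_hom M K"
      using univ K k(1) by blast
    then have "compose (carrier (Fo M)) (Fm M K k) (Fm M M e) = zero_hom (Fo M) (Fo K)"
      using Fm_compose[OF M M K e(1) k(1)] Fm_zero[OF M K] by simp
    then have ke: "\<forall>x\<in>carrier (Fo M). Fm M K k (Fm M M e x) = \<zero>\<^bsub>Fo K\<^esub>"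
      by (simp only: compose_eq_zero_hom_iff)
    have "\<epsilon> (h (Fm M M e x)) = \<zero>\<^bsub>Fo K\<^esub>" if "x \<in> carrier (Fo M)" for x
      using bspec[OF ke that] module_hom_closed[OF Fm_hom[OF M M e(1)] that]
      by (simp add: k(2) compose_eq)
    then have "h (Fm M M e x) = \<zero>\<^bsub>L\<^esub>" if "x \<in> carrier (Fo M)" for x
      using that inv module_hom_closed[OF h module_hom_closed[OF Fm_hom[OF M M e(1)] that]]
        module_hom_zero[OF Fo_module[OF K] L \<epsilon>'] by metis
    then show "compose (carrier (Fo M)) h (Fm M M e) = zero_hom (Fo M) L"
      by (simp add: compose_eq_zero_hom_iff)
  qed
qed

text \<open>The inclusion of the kernel of \<open>Fm N M i\<close> is, up to isomorphism, the image
  of some \<open>k\<close> over \<open>R\<close>. Faithfulness gives \<open>i k = 0\<close>,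
  injectivity gives \<open>k = 0\<close>, and so the inclusion is zero.\<close>

lemma inj_Fm:
  assumes N: "is_right_module R N" and M: "is_right_module R M"
    and i: "i \<in> module_hom R N M" "inj_on i (carrier N)"
  shows "inj_on (Fm N M i) (carrier (Fo N))"
proof -
  note FN = Fo_module[OF N] and FM = Fo_module[OF M] and Fi = Fm_hom[OF N M i(1)]
  interpret FN: right_module_over T "Fo N" by unfold_locales (rule FN)
  define K where "K = hom_kernel (Fo N) (Fo M) (Fm N M i)"
  have K: "submodule_of T (Fo N) K"
    unfolding K_def by (rule hom_kernel_submodule[OF FN FM Fi])
  let ?K = "Fo N\<lparr>carrier := K\<rparr>"
  note Km = FN.submodule_is_right_module[OF K]
  obtain L \<epsilon> \<epsilon>' where L: "is_right_module R L" and \<epsilon>: "\<epsilon> \<in> module_hom T ?K (Fo L)"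
    and \<epsilon>': "\<epsilon>' \<in> module_hom T (Fo L) ?K" and inv: "\<forall>x\<in>carrier ?K. \<epsilon>' (\<epsilon> x) = x"
    by (rule ex_iso_preimage[OF Km])
  have \<epsilon>'K: "\<epsilon>' x \<in> K" if "x \<in> carrier (Fo L)" for x
    using module_hom_closed[OF \<epsilon>' that] by simp
  obtain k where k: "k \<in> module_hom R L N" "Fm L N k = compose (carrier (Fo L)) (\<lambda>x\<in>K. x) \<epsilon>'"
    using full[OF L N module_hom_compose[OF Fo_module[OF L] \<epsilon>' submodule_inclusion_hom[OF FN K]]]
    by blast
  have "compose (carrier L) i k = zero_hom L M"
  proof (rule faithful[OF L M])
    show "compose (carrier L) i k \<in> module_hom R L M"
      by (rule module_hom_compose[OF L k(1) i(1)])
    show "zero_hom L M \<in> module_hom R L M"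
      by (rule module_hom_const_zero[OF L M])
    have "compose (carrier (Fo L)) (Fm N M i) (Fm L N k) = zero_hom (Fo L) (Fo M)"
      unfolding compose_eq_zero_hom_iff k(2) using \<epsilon>'K by (auto simp: compose_eq K_def hom_kernel_def)
    then show "Fm L M (compose (carrier L) i k) = Fm L M (zero_hom L M)"
      using Fm_compose[OF L N M k(1) i(1)] Fm_zero[OF L M] by simp
  qed
  then have "i (k x) = i \<zero>\<^bsub>N\<^esub>" if "x \<in> carrier L" for x
    using that module_hom_zero[OF N M i(1)] by (simp add: compose_eq_zero_hom_iff)
  moreover interpret N: right_module_over R N by unfold_locales (rule N)
  have "k x = \<zero>\<^bsub>N\<^esub>" if "x \<in> carrier L" for x
    using inj_onD[OF i(2) calculation[OF that]] module_hom_closed[OF k(1) that] by simp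
  then have "k = zero_hom L N"
    by (intro module_hom_eqI[OF k(1) module_hom_const_zero[OF L N]]) simp
  then have Fk: "Fm L N k = zero_hom (Fo L) (Fo N)"
    using Fm_zero[OF L N] by simp
  have K0: "x = \<zero>\<^bsub>Fo N\<^esub>" if x: "x \<in> K" for x
  proof -
    have "\<epsilon> x \<in> carrier (Fo L)"
      using module_hom_closed[OF \<epsilon>] x by simp
    then have "\<epsilon>' (\<epsilon> x) = \<zero>\<^bsub>Fo N\<^esub>"
      using fun_cong[OF Fk, of "\<epsilon> x"] \<epsilon>'K by (simp add: k(2) compose_eq)
    then show ?thesis
      using inv x by simp
  qed
  show ?thesis
  proof (rule inj_onI)
    fix x y assume xy: "x \<in> carrier (Fo N)" "y \<in> carrier (Fo N)" "Fm N M i x = Fm N M i y"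
    interpret FM: right_module_over T "Fo M" by unfold_locales (rule FM)
    have c: "x \<oplus>\<^bsub>Fo N\<^esub> y \<cdot>\<^bsub>Fo N\<^esub> (\<ominus>\<^bsub>T\<^esub> \<one>\<^bsub>T\<^esub>) \<in> carrier (Fo N)"
      using xy by simp
    have "Fm N M i (x \<oplus>\<^bsub>Fo N\<^esub> y \<cdot>\<^bsub>Fo N\<^esub> (\<ominus>\<^bsub>T\<^esub> \<one>\<^bsub>T\<^esub>))
      = Fm N M i y \<oplus>\<^bsub>Fo M\<^esub> Fm N M i y \<cdot>\<^bsub>Fo M\<^esub> (\<ominus>\<^bsub>T\<^esub> \<one>\<^bsub>T\<^esub>)"
      using xy by (simp add: module_hom_add[OF Fi] module_hom_smult[OF Fi])
    also have "\<dots> = \<zero>\<^bsub>Fo M\<^esub>"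
      using module_hom_closed[OF Fi xy(2)] by (simp add: FM.smult_minus_one FM.M.r_neg)
    finally have "x \<oplus>\<^bsub>Fo N\<^esub> y \<cdot>\<^bsub>Fo N\<^esub> (\<ominus>\<^bsub>T\<^esub> \<one>\<^bsub>T\<^esub>) = \<zero>\<^bsub>Fo N\<^esub>"
      using c by (intro K0) (simp add: K_def hom_kernel_def)
    then show "x = y"
      using xy FN.M.minus_equality[of x "\<ominus>\<^bsub>Fo N\<^esub> y"] by (simp add: FN.smult_minus_one)
  qed
qed

text \<open>The image of \<open>i\<close> under the functor is injective and splits over
  \<open>T\<close>; by fullness its retraction comes from one over \<open>R\<close>, and
  faithfulness reflects the identity.\<close>

lemma ex_retraction:
  fixes N M :: "('u, 'r) right_module"
  assumes N: "is_right_module R N" and M: "is_right_module R M"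
    and i: "i \<in> module_hom R N M" "inj_on i (carrier N)"
    and compl: "right_module_over.complemented T (Fo M)"
  obtains r where "r \<in> module_hom R M N" "\<forall>x\<in>carrier N. r (i x) = x"
proof -
  note FN = Fo_module[OF N] and FM = Fo_module[OF M] and Fi = Fm_hom[OF N M i(1)]
  interpret FM: right_module_over T "Fo M" by unfold_locales (rule FM)
  interpret FN: right_module_over T "Fo N" by unfold_locales (rule FN)
  have "direct_summand T (Fo M) (Fm N M i ` carrier (Fo N))"
    using compl module_hom_image_submodule[OF FN FM Fi FN.submodule_carrier_self]
    unfolding FM.complemented_def by blast
  then obtain s where s: "s \<in> module_hom T (Fo M) (Fo N)" "\<forall>x\<in>carrier (Fo N). s (Fm N M i x) = x"
    by (rule direct_summand_image_retraction[OF FN FM Fi inj_Fm[OF N M i]])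
  obtain r where r: "r \<in> module_hom R M N" "Fm M N r = s"
    using full[OF M N s(1)] by blast
  have "compose (carrier N) r i = (\<lambda>x\<in>carrier N. x)"
  proof (rule faithful[OF N N])
    show "compose (carrier N) r i \<in> module_hom R N N"
      by (rule module_hom_compose[OF N i(1) r(1)])
    show "(\<lambda>x\<in>carrier N. x) \<in> module_hom R N N"
      by (rule module_hom_id[OF N])
    have "compose (carrier (Fo N)) s (Fm N M i) = (\<lambda>x\<in>carrier (Fo N). x)"
      using s(2) by (subst compose_eq_iff) auto
    then show "Fm N N (compose (carrier N) r i) = Fm N N (\<lambda>x\<in>carrier N. x)"
      using Fm_compose[OF N M N i(1) r(1)] Fm_id[OF N] r(2) by simp
  qed
  then have "\<forall>x\<in>carrier N. r (i x) = x"
    by (subst (asm) compose_eq_iff) auto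
  then show thesis
    using that r(1) by blast
qed

text \<open>A submodule of \<open>M\<close> is carried to \<open>M'\<close>, where its inclusion is
  an injection that splits. Conjugating the retraction back gives the projection.\<close>

lemma complemented_of_complemented_Fo:
  fixes M :: "('m, 'r) right_module"
  assumes M: "is_right_module R M" and M': "is_right_module R M'"
    and \<phi>: "\<phi> \<in> module_hom R M' M" and \<psi>: "\<psi> \<in> module_hom R M M'"
    and \<phi>\<psi>: "\<forall>x\<in>carrier M. \<phi> (\<psi> x) = x"
    and compl: "right_module_over.complemented T (Fo M')"
  shows "right_module_over.complemented R M"
proof -
  interpret M: right_module_over R M by unfold_locales (rule M)
  interpret M': right_module_over R M' by unfold_locales (rule M')
  show ?thesis
    unfolding M.complemented_def
  proof (intro allI impI)
    fix N assume N: "submodule_of R M N"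
    note Nc = M.submodule_carrier[OF N]
    have N': "submodule_of R M' (\<psi> ` N)"
      by (rule module_hom_image_submodule[OF M M' \<psi> N])
    let ?N = "M'\<lparr>carrier := \<psi> ` N\<rparr>"
    note Nm = M'.submodule_is_right_module[OF N'] and i = submodule_inclusion_hom[OF M' N']
    have "inj_on (\<lambda>x\<in>\<psi> ` N. x) (carrier ?N)"
      by (simp add: inj_on_def)
    then obtain r where r: "r \<in> module_hom R M' ?N" "\<forall>x\<in>carrier ?N. r ((\<lambda>x\<in>\<psi> ` N. x) x) = x"
      by (rule ex_retraction[OF Nm M' i _ compl])
    have rN: "r x \<in> \<psi> ` N" if "x \<in> carrier M'" for x
      using module_hom_closed[OF r(1) that] by simp
    have \<phi>N: "\<phi> x \<in> N" if "x \<in> \<psi> ` N" for x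
      using that \<phi>\<psi> Nc by auto
    define e where "e = compose (carrier M) (compose (carrier M') \<phi> r) \<psi>"
    have "r \<in> module_hom R M' M'"
      using r(1) rN M'.submodule_carrier[OF N'] by (auto simp: module_hom_def)
    then have "e \<in> module_hom R M M"
      unfolding e_def using module_hom_compose[OF M \<psi> module_hom_compose[OF M' _ \<phi>]] by blast
    moreover have e_app: "e x = \<phi> (r (\<psi> x))" if "x \<in> carrier M" for x
      using that module_hom_closed[OF \<psi>] by (simp add: e_def compose_eq)
    have "\<forall>x\<in>carrier M. e x \<in> N"
      using e_app \<phi>N rN module_hom_closed[OF \<psi>] by simp
    moreover have "\<forall>x\<in>N. e x = x"
      using e_app r(2) Nc \<phi>\<psi> by simp
    ultimately show "direct_summand R M N"
      unfolding M.direct_summand_iff_projection using N by blast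
  qed
qed

end

text \<open>Only the unit is used, so this applies to both functors of an equivalence.\<close>

lemma faithful_of_unit:
  fixes Fo :: "('u, 'r, 't) ob_map" and Go :: "('u, 't, 'r) ob_map"
  assumes unit: "naturally_isomorphic R R (\<lambda>M. M) (\<lambda>M N f. f)
      (\<lambda>M. Go (Fo M)) (\<lambda>M N f. Gm (Fo M) (Fo N) (Fm M N f))"
    and M: "is_right_module R M" and N: "is_right_module R N"
    and f: "f \<in> module_hom R M N" and g: "g \<in> module_hom R M N" and eq: "Fm M N f = Fm M N g"
  shows "f = g"
proof (rule module_hom_eqI[OF f g])
  fix x assume x: "x \<in> carrier M"
  obtain \<eta> where bij: "bij_betw (\<eta> N) (carrier N) (carrier (Go (Fo N)))"
    and nat: "\<forall>f\<in>module_hom R M N. compose (carrier M) (\<eta> N) f =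
      compose (carrier M) (Gm (Fo M) (Fo N) (Fm M N f)) (\<eta> M)"
    using unit M N unfolding naturally_isomorphic_def by blast
  have "compose (carrier M) (\<eta> N) f = compose (carrier M) (\<eta> N) g"
    using nat f g eq by simp
  then have "\<eta> N (f x) = \<eta> N (g x)"
    using x by (metis compose_eq)
  then show "f x = g x"
    using bij x module_hom_closed[OF f] module_hom_closed[OF g] by (meson bij_betw_def inj_onD)
qed

text \<open>Faithfulness of \<open>Gm\<close>, which comes from the counit, is the key to the rest:
  an identity between morphisms over \<open>T\<close> may be checked after applying
  \<open>Gm\<close>, where naturality of \<open>\<eta>\<close> computes the composite
  functor.\<close>

lemma module_equivalence_of_categories_equivalent:
  fixes R :: "('r, 'x) ring_scheme" and T :: "('t, 'y) ring_scheme"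
  assumes "module_categories_equivalent TYPE('u) R T"
  obtains Fo :: "('u, 'r, 't) ob_map" and Fm :: "('u, 'r) mor_map" where "module_equivalence R T Fo Fm"
proof -
  obtain Fo :: "('u, 'r, 't) ob_map" and Fm and Go :: "('u, 't, 'r) ob_map" and Gm where
    F: "module_functor R T Fo Fm" and G: "module_functor T R Go Gm"
    and unit: "naturally_isomorphic R R (\<lambda>M. M) (\<lambda>M N f. f)
      (\<lambda>M. Go (Fo M)) (\<lambda>M N f. Gm (Fo M) (Fo N) (Fm M N f))"
    and counit: "naturally_isomorphic T T (\<lambda>M. M) (\<lambda>M N f. f)
      (\<lambda>M. Fo (Go M)) (\<lambda>M N f. Fm (Go M) (Go N) (Gm M N f))"
    using assms unfolding module_categories_equivalent_def by blast
  have Fo: "is_right_module T (Fo M)" if "is_right_module R M" for M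
    using F that by (simp add: module_functor_def)
  have Go: "is_right_module R (Go M)" if "is_right_module T M" for M
    using G that by (simp add: module_functor_def)
  have Fm: "Fm M N f \<in> module_hom T (Fo M) (Fo N)"
    if "is_right_module R M" "is_right_module R N" "f \<in> module_hom R M N" for M N f
    using F that by (simp add: module_functor_def)
  have Gm: "Gm M N f \<in> module_hom R (Go M) (Go N)"
    if "is_right_module T M" "is_right_module T N" "f \<in> module_hom T M N" for M N f
    using G that by (simp add: module_functor_def)
  have Gm_compose: "Gm L N (compose (carrier L) g f) = compose (carrier (Go L)) (Gm M N g) (Gm L M f)"
    if "is_right_module T L" "is_right_module T M" "is_right_module T N"
      "f \<in> module_hom T L M" "g \<in> module_hom T M N" for L M N f g
    using G that unfolding module_functor_def by blast
  note faithful_F = faithful_of_unit[where Fo = Fo and Fm = Fm and Go = Go and Gm = Gm, OF unit]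
    and faithful_G = faithful_of_unit[where Fo = Go and Fm = Gm and Go = Fo and Gm = Fm, OF counit]
  obtain \<eta> where \<eta>: "\<forall>M. is_right_module R M \<longrightarrow> \<eta> M \<in> module_hom R M (Go (Fo M)) \<and>
      bij_betw (\<eta> M) (carrier M) (carrier (Go (Fo M)))"
    and nat: "\<forall>M N f. is_right_module R M \<and> is_right_module R N \<and> f \<in> module_hom R M N \<longrightarrow>
      compose (carrier M) (\<eta> N) f = compose (carrier M) (Gm (Fo M) (Fo N) (Fm M N f)) (\<eta> M)"
    using unit unfolding naturally_isomorphic_def by blast
  have nat_app: "\<eta> N (f x) = Gm (Fo M) (Fo N) (Fm M N f) (\<eta> M x)"
    if "is_right_module R M" "is_right_module R N" "f \<in> module_hom R M N" "x \<in> carrier M" for M N f x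
  proof -
    have "compose (carrier M) (\<eta> N) f = compose (carrier M) (Gm (Fo M) (Fo N) (Fm M N f)) (\<eta> M)"
      using nat that(1-3) by simp
    then show ?thesis
      using that(4) by (metis compose_eq)
  qed
  have \<eta>_surj: "\<exists>x\<in>carrier M. y = \<eta> M x" if "is_right_module R M" "y \<in> carrier (Go (Fo M))" for M y
  proof -
    have "\<eta> M ` carrier M = carrier (Go (Fo M))"
      using \<eta> that(1) by (simp add: bij_betw_def)
    then show ?thesis
      using that(2) by blast
  qed
  have "module_equivalence R T Fo Fm"
  proof unfold_locales
    show "module_functor R T Fo Fm"
      by (rule F)
    show "f = g" if "is_right_module R M" "is_right_module R N" "f \<in> module_hom R M N"
      "g \<in> module_hom R M N" "Fm M N f = Fm M N g" for M N f g
      using that by (rule faithful_F)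
    show "\<exists>f\<in>module_hom R M N. Fm M N f = g"
      if M: "is_right_module R M" and N: "is_right_module R N" and g: "g \<in> module_hom T (Fo M) (Fo N)" for M N g
    proof -
      note \<eta>M = conjunct1[OF \<eta>[rule_format, OF M]] and \<eta>N = \<eta>[rule_format, OF N]
      obtain \<theta> where \<theta>: "\<theta> \<in> module_hom R (Go (Fo N)) N" "\<And>x. x \<in> carrier N \<Longrightarrow> \<theta> (\<eta> N x) = x"
        "\<And>y. y \<in> carrier (Go (Fo N)) \<Longrightarrow> \<eta> N (\<theta> y) = y"
        using bij_module_hom_inv[OF N conjunct1[OF \<eta>N] conjunct2[OF \<eta>N]] by metis
      note Gg = Gm[OF Fo[OF M] Fo[OF N] g]
      \<comment> \<open>The only candidate: naturality requires
        \<open>\<eta> f = (Gm g) \<eta>\<close>, which is solved for \<open>f\<close> by the inverse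
        \<open>\<theta>\<close>.\<close>
      define f where "f = compose (carrier M) \<theta> (compose (carrier M) (Gm (Fo M) (Fo N) g) (\<eta> M))"
      have f: "f \<in> module_hom R M N"
        unfolding f_def by (rule module_hom_compose[OF M module_hom_compose[OF M \<eta>M Gg] \<theta>(1)])
      have "Gm (Fo M) (Fo N) (Fm M N f) = Gm (Fo M) (Fo N) g"
      proof (rule module_hom_eqI[OF Gm[OF Fo[OF M] Fo[OF N] Fm[OF M N f]] Gg])
        fix y assume "y \<in> carrier (Go (Fo M))"
        then obtain x where x: "x \<in> carrier M" "y = \<eta> M x"
          using \<eta>_surj[OF M] by blast
        have "\<eta> N (f x) = Gm (Fo M) (Fo N) g (\<eta> M x)"
          using x(1) \<theta>(3) module_hom_closed[OF Gg module_hom_closed[OF \<eta>M x(1)]]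
          by (simp add: f_def compose_eq)
        then show "Gm (Fo M) (Fo N) (Fm M N f) y = Gm (Fo M) (Fo N) g y"
          using nat_app[OF M N f x(1)] x(2) by simp
      qed
      then have "Fm M N f = g"
        by (rule faithful_G[OF Fo[OF M] Fo[OF N] Fm[OF M N f] g])
      then show ?thesis
        using f by blast
    qed
    show "Fm M N (zero_hom M N) = zero_hom (Fo M) (Fo N)"
      if M: "is_right_module R M" and N: "is_right_module R N" for M N
    proof -
      note FM = Fo[OF M] and FN = Fo[OF N]
      interpret M: right_module_over R M by unfold_locales (rule M)
      let ?z = "Fm M N (zero_hom M N)"
      have z: "?z \<in> module_hom T (Fo M) (Fo N)"
        by (rule Fm[OF M N module_hom_const_zero[OF M N]])
      note zM = module_hom_const_zero[OF FM FM]
      have G0: "Gm (Fo M) (Fo N) ?z y = \<zero>\<^bsub>Go (Fo N)\<^esub>" if "y \<in> carrier (Go (Fo M))" for y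
      proof -
        obtain x where x: "x \<in> carrier M" "y = \<eta> M x"
          using \<eta>_surj[OF M \<open>y \<in> _\<close>] by blast
        have "\<eta> N \<zero>\<^bsub>N\<^esub> = \<zero>\<^bsub>Go (Fo N)\<^esub>"
          using module_hom_zero[OF N Go[OF FN]] \<eta> N by blast
        then show ?thesis
          using nat_app[OF M N module_hom_const_zero[OF M N] x(1)] x by simp
      qed
      note z0 = module_hom_compose[OF FM zM z]
      \<comment> \<open>Naturality shows that \<open>Gm\<close> sends \<open>?z\<close> to zero, but
        \<open>Gm\<close> is not yet known to preserve zero morphisms. So \<open>?z\<close> is
        compared with its composite with a zero endomorphism, which visibly vanishes and which
        \<open>Gm\<close> also sends to zero.\<close>
      have "?z = compose (carrier (Fo M)) ?z (zero_hom (Fo M) (Fo M))"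
      proof (rule faithful_G[OF FM FN z z0])
        show "Gm (Fo M) (Fo N) ?z = Gm (Fo M) (Fo N) (compose (carrier (Fo M)) ?z (zero_hom (Fo M) (Fo M)))"
        proof (rule module_hom_eqI[OF Gm[OF FM FN z] Gm[OF FM FN z0]])
          fix y assume y: "y \<in> carrier (Go (Fo M))"
          then show "Gm (Fo M) (Fo N) ?z y =
              Gm (Fo M) (Fo N) (compose (carrier (Fo M)) ?z (zero_hom (Fo M) (Fo M))) y"
            using G0 module_hom_closed[OF Gm[OF FM FM zM] y]
            by (simp add: Gm_compose[OF FM FM FN zM z] compose_eq)
        qed
      qed
      also have "\<dots> = zero_hom (Fo M) (Fo N)"
        using module_hom_zero[OF FM FN z] by (simp add: compose_eq_zero_hom_iff)
      finally show ?thesis .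
    qed
    show "\<exists>K \<epsilon>. is_right_module R K \<and> \<epsilon> \<in> module_hom T L (Fo K) \<and> bij_betw \<epsilon> (carrier L) (carrier (Fo K))"
      if L: "is_right_module T L" for L :: "('u, 't) right_module"
    proof -
      obtain \<epsilon> where "\<epsilon> L \<in> module_hom T L (Fo (Go L)) \<and> bij_betw (\<epsilon> L) (carrier L) (carrier (Fo (Go L)))"
        using counit L unfolding naturally_isomorphic_def by blast
      then show ?thesis
        using Go[OF L] by blast
    qed
  qed
  then show thesis
    by (rule that)
qed

section \<open>The equivalence of the three conditions over \<open>R\<close>\<close>

theorem theorem3p13:
  fixes R :: "('r, 'x) ring_scheme" and T :: "('t, 'y) ring_scheme"
    and M :: "('m, 'r) right_module"
  assumes "ring R"
    and "ring T" and "right_duo T" and "perfect_ring T"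
    and "morita_equivalent TYPE('m) R T"
    and "is_right_module R M"
  shows "(baer_module R M \<longleftrightarrow> dual_baer_module R M) \<and>
         (dual_baer_module R M \<longleftrightarrow> semisimple_module R M)"
proof -
  interpret M: right_module_over R M by unfold_locales (rule assms(6))
  have "module_categories_equivalent TYPE(('m, 'r, 't) module_universe) R T"
    using assms(5) by (simp add: morita_equivalent_def)
  then obtain Fo :: "(('m, 'r, 't) module_universe, 'r, 't) ob_map" and Fm where "module_equivalence R T Fo Fm"
    by (rule module_equivalence_of_categories_equivalent)
  then interpret F: module_equivalence R T Fo Fm .
  \<comment> \<open>The copy of \<open>M\<close> sits in the first summand of the universe type, so
    that the functor can be applied to it.\<close>
  obtain M' :: "(('m, 'r, 't) module_universe, 'r) right_module" and \<phi> \<psi> where M': "is_right_module R M'"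
    and iso: "\<phi> \<in> module_hom R M' M" "\<psi> \<in> module_hom R M M'"
      "\<forall>x\<in>carrier M. \<phi> (\<psi> x) = x" "\<forall>x\<in>carrier M'. \<psi> (\<phi> x) = x"
    by (rule M.ex_copy[OF inj_Inl])
  note FM = F.Fo_module[OF M']
  interpret FM: right_duo_perfect_module T "Fo M'"
    using assms(2-4) FM
    by (simp add: right_duo_perfect_module_def right_duo_perfect_ring_def right_duo_ring_def
        right_duo_ring_axioms_def right_duo_perfect_ring_axioms_def right_module_over_def)
  have compl: "M.complemented" if "FM.complemented"
    by (rule F.complemented_of_complemented_Fo[OF assms(6) M' iso(1-3) that])
  have "M.complemented" if "baer_module R M"
  proof -
    have "categorical_baer R M'"
      by (rule baer_imp_categorical_baer[OF assms(6) M' iso(1,2,4) that])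
    then have "baer_module T (Fo M')"
      by (rule categorical_baer_imp_baer[OF FM F.categorical_baer_Fo[OF M']])
    then show ?thesis
      by (rule compl[OF FM.baer_imp_complemented])
  qed
  moreover have "M.complemented" if "dual_baer_module R M"
  proof -
    have "categorical_dual_baer R M'"
      by (rule dual_baer_imp_categorical_dual_baer[OF assms(6) M' iso(1,2,4) that])
    then have "dual_baer_module T (Fo M')"
      by (rule categorical_dual_baer_imp_dual_baer[OF FM F.categorical_dual_baer_Fo[OF M']])
    then show ?thesis
      by (rule compl[OF FM.dual_baer_imp_complemented])
  qed
  moreover have "semisimple_module R M \<longleftrightarrow> M.complemented"
    using M.semisimple_imp_complemented M.complemented_imp_semisimple by blast
  ultimately show ?thesis
    using M.complemented_imp_baer M.complemented_imp_dual_baer by blast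
qed

end
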